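(* Let $g\colon\widehat{\mathbb{C}}\to\widehat{\mathbb{C}}$ be a rational map with $\deg(g)\ge2$. If there exists a dynamical quasi-visual approximation $\{\mathbf{X}^n\}_{n\in\mathbb{N}_0}$ (of some width $w\in\mathbb{N}_0$) of $(\mathcal{J}(g),\sigma)$, then $g$ is semi-hyperbolic.
   Context: $\mathbb{N}_0=\{0,1,2,\dots\}$, $\mathbb{N}=\{1,2,\dots\}$. $\widehat{\mathbb{C}}=\mathbb{C}\cup\{\infty\}$ is the Riemann sphere with the spherical metric $\sigma$, the length metric with length element $ds=\frac{2|dz|}{1+|z|^2}$; the Julia set $\mathcal{J}(g)$ carries the restriction of $\sigma$. $g^n$ is the $n$-th iterate of $g$. Semi-hyperbolic: a rational map $g$ with $\deg(g)\ge2$ is semi-hyperbolic if $g$ has no parabolic cycles (no periodic cycle whose multiplier is a root of unity) and every critical point $c$ of $g$ in $\mathcal{J}(g)$ is non-recurrent, i.e. $c\notin\overline{\{g^n(c):n\in\mathbb{N}\}}$. (A critical point is a point near which $g$ is not a local homeomorphism.) Quasi-visual approximation: let $(S,d)$ be a bounded metric space with more than one point and $\{\mathbf{X}^n\}_{n\in\mathbb{N}_0}$ a sequence of covers of $S$ (collections, possibly infinite, of subsets of $S$ with union $S$). For $X\in\mathbf{X}^n$ and $w\in\mathbb{N}_0$, $U_w(X)$ is the union of all $Y\in\mathbf{X}^n$ such that there are $X_0=X,\dots,X_k=Y$ in $\mathbf{X}^n$ with $k\le w$ and $X_j\cap X_{j+1}\neq\emptyset$ for all $j<k$. $\{\mathbf{X}^n\}$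 is a quasi-visual approximation of width $w$ for $(S,d)$ if $\mathbf{X}^0=\{S\}$ and there are $C\ge1$, $k_0\in\mathbb{N}$, $\lambda\in(0,1)$ such that for all $n\in\mathbb{N}_0$: (1) $\frac1C\operatorname{diam}(Y)\le\operatorname{diam}(X)\le C\operatorname{diam}(Y)$ for $X,Y\in\mathbf{X}^n$ with $X\cap Y\neq\emptyset$; (2) $\operatorname{dist}(X,Y)\ge\frac1C\operatorname{diam}(X)$ for $X,Y\in\mathbf{X}^n$ with $U_w(X)\cap U_w(Y)=\emptyset$, where $\operatorname{dist}(X,Y)=\inf\{d(x,y):x\in X,\,y\in Y\}$; (3) $\frac1C\operatorname{diam}(Y)\le\operatorname{diam}(X)\le C\operatorname{diam}(Y)$ for $X\in\mathbf{X}^n$, $Y\in\mathbf{X}^{n+1}$ with $X\cap Y\ne\emptyset$; (4) $\operatorname{diam}(Y)\le\lambda\operatorname{diam}(X)$ for $X\in\mathbf{X}^n$, $Y\in\mathbf{X}^{n+k_0}$ with $X\cap Y\ne\emptyset$. A quasi-visual approximation $\{\mathbf{X}^n\}$ of $(\mathcal{J}(g),\sigma)$ is dynamical if $g(X)\in\mathbf{X}^n$ for all $n\in\mathbb{N}$ and $X\in\mathbf{X}^{n+1}$ (no condition is imposed on $\mathbf{X}^0$). *)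

theory Defs
  imports "HOL-Analysis.Analysis" "HOL-Computational_Algebra.Polynomial"
begin

section \<open>The Riemann sphere with the spherical metric\<close>

datatype rsphere = Fin complex | Infty

text \<open>The value at \<open>Infty\<close> is a dummy.\<close>

primrec to_complex :: "rsphere \<Rightarrow> complex" where
  "to_complex (Fin z) = z"
| "to_complex Infty = 0"

primrec sphere_inversion :: "rsphere \<Rightarrow> rsphere" where
  "sphere_inversion (Fin z) = (if z = 0 then Infty else Fin (1 / z))"
| "sphere_inversion Infty = Fin 0"

text \<open>The topology is that of the one-point compactification of the plane; the spherical metric
  below is shown to induce it.\<close>

instantiation rsphere :: topological_space
begin

definition open_rsphere :: "rsphere set \<Rightarrow> bool" where
  "open_rsphere U \<longleftrightarrow> open (Fin -` U) \<and> (Infty \<in> U \<longrightarrow> compact (- (Fin -` U)))"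

instance
proof
  show "open (UNIV :: rsphere set)"
    by (simp add: open_rsphere_def)
next
  fix S T :: "rsphere set"
  assume "open S" "open T"
  then show "open (S \<inter> T)"
    by (auto simp: open_rsphere_def vimage_Int Compl_Int intro: open_Int compact_Un)
next
  fix K :: "rsphere set set"
  assume K: "\<forall>S\<in>K. open S"
  have op: "open (Fin -` \<Union>K)"
    using K by (auto simp: open_rsphere_def vimage_Union)
  moreover have "compact (- (Fin -` \<Union>K))" if inf: "Infty \<in> \<Union>K"
  proof -
    obtain S where S: "S \<in> K" "Infty \<in> S"
      using inf by auto
    have "compact (- (Fin -` S) \<inter> - (Fin -` \<Union>K))"
      using K S op by (intro compact_Int_closed) (auto simp: open_rsphere_def)
    moreover have "- (Fin -` S) \<inter> - (Fin -` \<Union>K) = - (Fin -` \<Union>K)"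
      using S by auto
    ultimately show ?thesis by simp
  qed
  ultimately show "open (\<Union>K)"
    by (simp add: open_rsphere_def)
qed

end

text \<open>Piecewise \<open>C\<^sup>1\<close> paths in the sphere. They may pass through \<open>Infty\<close>, but only
  at the finitely many exceptional parameters.\<close>

definition spherical_path :: "rsphere \<Rightarrow> rsphere \<Rightarrow> (real \<Rightarrow> rsphere) \<Rightarrow> bool" where
  "spherical_path x y \<gamma> \<longleftrightarrow>
     path \<gamma> \<and> pathstart \<gamma> = x \<and> pathfinish \<gamma> = y \<and>
     (\<exists>S. finite S \<and> Infty \<notin> \<gamma> ` ({0..1} - S) \<and>
        (\<lambda>t. to_complex (\<gamma> t)) C1_differentiable_on ({0..1} - S))"

text \<open>The integral of the length element \<open>2\<bar>dz\<bar> / (1 + \<bar>z\<bar>\<^sup>2)\<close> along a path.\<close>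

definition spherical_speed :: "(real \<Rightarrow> rsphere) \<Rightarrow> real \<Rightarrow> real" where
  "spherical_speed \<gamma> t =
     2 * norm (vector_derivative (\<lambda>s. to_complex (\<gamma> s)) (at t)) / (1 + (norm (to_complex (\<gamma> t)))\<^sup>2)"

definition spherical_length :: "(real \<Rightarrow> rsphere) \<Rightarrow> ennreal" where
  "spherical_length \<gamma> = (\<integral>\<^sup>+t\<in>{0..1}. ennreal (spherical_speed \<gamma> t) \<partial>lborel)"

definition spherical_edist :: "rsphere \<Rightarrow> rsphere \<Rightarrow> ennreal" where
  "spherical_edist x y = (INF \<gamma>\<in>Collect (spherical_path x y). spherical_length \<gamma>)"

subsection \<open>Lengths of paths\<close>

lemma spherical_speed_nonneg [simp]: "0 \<le> spherical_speed \<gamma> t"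
  by (simp add: spherical_speed_def)

lemma spherical_pathE:
  assumes "spherical_path x y \<gamma>"
  obtains S where "finite S" "0 \<in> S" "1 \<in> S" "\<And>t. t \<in> {0..1} - S \<Longrightarrow> \<gamma> t \<noteq> Infty"
    "(\<lambda>t. to_complex (\<gamma> t)) C1_differentiable_on ({0..1} - S)" "open ({0..1} - S)"
proof -
  obtain S where S: "finite S" "Infty \<notin> \<gamma> ` ({0..1} - S)"
      "(\<lambda>t. to_complex (\<gamma> t)) C1_differentiable_on ({0..1} - S)"
    using assms by (auto simp: spherical_path_def)
  have eq: "{0..1} - insert 0 (insert 1 S) = {0<..<1::real} - S" by auto
  show thesis
  proof (rule that[of "insert 0 (insert 1 S)"])
    show "open ({0..1} - insert 0 (insert 1 S))"
      unfolding eq using S(1) by (intro open_Diff finite_imp_closed) auto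
    show "(\<lambda>t. to_complex (\<gamma> t)) C1_differentiable_on ({0..1} - insert 0 (insert 1 S))"
      by (rule C1_differentiable_on_subset[OF S(3)]) auto
    show "\<gamma> t \<noteq> Infty" if "t \<in> {0..1} - insert 0 (insert 1 S)" for t
      using S(2) that by (metis DiffD1 DiffD2 DiffI image_eqI insertCI)
  qed (use S in auto)
qed

lemma spherical_speed_measurable:
  assumes "spherical_path x y \<gamma>"
  shows "(\<lambda>t. indicator {0..1} t * spherical_speed \<gamma> t) \<in> borel_measurable borel"
proof -
  obtain S where S: "finite S" "0 \<in> S" "1 \<in> S"
      "(\<lambda>t. to_complex (\<gamma> t)) C1_differentiable_on ({0..1} - S)" "open ({0..1} - S)"
    using spherical_pathE[OF assms] by metis
  have c1: "continuous_on ({0..1} - S) (\<lambda>t. to_complex (\<gamma> t))"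
    using S(4) by (rule C1_differentiable_imp_continuous_on)
  have c2: "continuous_on ({0..1} - S) (\<lambda>t. vector_derivative (\<lambda>t. to_complex (\<gamma> t)) (at t))"
    using S(4) by (simp add: C1_differentiable_on_eq)
  have ne: "1 + (norm z)\<^sup>2 \<noteq> 0" for z :: complex
    by (metis add_nonneg_eq_0_iff zero_le_one zero_le_power2 zero_neq_one)
  have "continuous_on ({0..1} - S) (spherical_speed \<gamma>)"
    unfolding spherical_speed_def by (intro continuous_intros c1 c2) (auto simp: ne)
  then have "(\<lambda>t. indicator ({0..1} - S) t *\<^sub>R spherical_speed \<gamma> t) \<in> borel_measurable borel"
    using S(5) by (intro borel_measurable_continuous_on_indicator) auto
  then show ?thesis
    by (rule measurable_discrete_difference[where X = S])
       (use S(1) in \<open>auto simp: countable_finite indicator_def\<close>)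
qed

lemma spherical_length_eq:
  "spherical_length \<gamma> = (\<integral>\<^sup>+t. ennreal (indicator {0..1} t * spherical_speed \<gamma> t) \<partial>lborel)"
  unfolding spherical_length_def by (intro nn_integral_cong) (auto simp: indicator_def)

text \<open>A function that is Lipschitz in the infinitesimal sense is Lipschitz for the length.\<close>

lemma spherical_length_lower_bound:
  fixes F :: "rsphere \<Rightarrow> 'b::euclidean_space"
  assumes \<gamma>: "spherical_path x y \<gamma>"
    and cont: "continuous_on UNIV F"
    and der: "\<And>z. ((\<lambda>z. F (Fin z)) has_derivative F' z) (at z)"
    and bound: "\<And>z h. norm (F' z h) \<le> K * (2 * norm h / (1 + (norm z)\<^sup>2))"
    and K: "0 \<le> K"
  shows "ennreal (norm (F y - F x)) \<le> ennreal K * spherical_length \<gamma>"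
proof (cases "ennreal K * spherical_length \<gamma> = \<infinity>")
  case False
  obtain S where S: "finite S" "0 \<in> S" "1 \<in> S" "\<And>t. t \<in> {0..1} - S \<Longrightarrow> \<gamma> t \<noteq> Infty"
      "(\<lambda>t. to_complex (\<gamma> t)) C1_differentiable_on ({0..1} - S)" "open ({0..1} - S)"
    using spherical_pathE[OF \<gamma>] by metis
  define c where "c = (\<lambda>t. to_complex (\<gamma> t))"
  define D where "D t = (if t \<in> {0..1} - S then F' (c t) (vector_derivative c (at t)) else 0)" for t
  have Dder: "((\<lambda>t. F (\<gamma> t)) has_vector_derivative D t) (at t)" if t: "t \<in> {0<..<1} - S" for t
  proof -
    have tS: "t \<in> {0..1} - S" using t by auto
    have cd: "(c has_vector_derivative vector_derivative c (at t)) (at t)"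
      using S(5) tS unfolding c_def C1_differentiable_on_eq vector_derivative_works by blast
    have "(c has_derivative (\<lambda>h. h *\<^sub>R vector_derivative c (at t))) (at t)"
      using cd by (simp add: has_vector_derivative_def)
    from has_derivative_compose[OF this der]
    have 1: "((\<lambda>t. F (Fin (c t))) has_derivative
              (\<lambda>h. F' (c t) (h *\<^sub>R vector_derivative c (at t)))) (at t)" .
    have lin: "linear (F' (c t))"
      using der has_derivative_linear by blast
    have 2: "((\<lambda>t. F (Fin (c t))) has_vector_derivative D t) (at t)"
      using 1 tS by (simp add: has_vector_derivative_def D_def linear_scale[OF lin])
    show ?thesis
    proof (rule has_vector_derivative_transform_within_open[OF 2 S(6) tS])
      fix s assume "s \<in> {0..1} - S"
      then have "\<gamma> s \<noteq> Infty" by (rule S(4))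
      then show "F (Fin (c s)) = F (\<gamma> s)"
        unfolding c_def by (cases "\<gamma> s") auto
    qed
  qed
  have pth: "continuous_on {0..1} \<gamma>" and ends: "\<gamma> 0 = x" "\<gamma> 1 = y"
    using \<gamma> by (auto simp: spherical_path_def path_def pathstart_def pathfinish_def)
  have "continuous_on {0..1} (\<lambda>t. F (\<gamma> t))"
    by (rule continuous_on_compose2[OF cont pth]) auto
  then have int: "(D has_integral (F (\<gamma> 1) - F (\<gamma> 0))) {0..1}"
    using Dder by (intro fundamental_theorem_of_calculus_interior_strong[OF S(1)]) auto
  define h where "h t = K * (indicator {0..1} t * spherical_speed \<gamma> t)" for t
  have hm: "h \<in> borel_measurable borel"
    unfolding h_def by (intro borel_measurable_times spherical_speed_measurable[OF \<gamma>]) auto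
  have h0: "0 \<le> h t" for t
    using K by (simp add: h_def)
  have len: "(\<integral>\<^sup>+t. ennreal (h t) \<partial>lborel) = ennreal K * spherical_length \<gamma>"
    unfolding spherical_length_eq h_def ennreal_mult'[OF K]
    by (rule nn_integral_cmult) (use spherical_speed_measurable[OF \<gamma>] in measurable)
  obtain r where r: "0 \<le> r" "ennreal K * spherical_length \<gamma> = ennreal r"
    using False by (cases "ennreal K * spherical_length \<gamma>") auto
  have "(h has_integral r) UNIV"
    using hm h0 r len by (intro nn_integral_has_integral) auto
  moreover have "(\<lambda>t. if t \<in> {0..1} then h t else 0) = h"
    by (auto simp: h_def fun_eq_iff)
  ultimately have hint: "(h has_integral r) {0..1}"
    using has_integral_restrict_UNIV[of "{0..1}" h r] by simp
  have "norm (F (\<gamma> 1) - F (\<gamma> 0)) \<le> r"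
  proof -
    have "norm (D t) \<le> h t" if "t \<in> {0..1}" for t
      using that bound[of "c t" "vector_derivative c (at t)"] h0[of t]
      by (auto simp: D_def h_def spherical_speed_def c_def)
    then have "norm (integral {0..1} D) \<le> integral {0..1} h"
      using int hint by (intro integral_norm_bound_integral) auto
    then show ?thesis
      using int hint by (simp add: integral_unique)
  qed
  then show ?thesis using r ends by (simp add: ennreal_leI)
qed auto

lemma spherical_reparametrise:
  assumes A: "open A" "(\<lambda>t. to_complex (\<gamma> t)) C1_differentiable_on A"
    and B: "B = (\<lambda>t. m * t + k) -` A"
    and eq: "\<And>t. t \<in> B \<Longrightarrow> \<eta> t = \<gamma> (m * t + k)"
  shows "open B" "(\<lambda>t. to_complex (\<eta> t)) C1_differentiable_on B"
    "\<And>t. t \<in> B \<Longrightarrow> spherical_speed \<eta> t = \<bar>m\<bar> * spherical_speed \<gamma> (m * t + k)"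
proof -
  define c where "c = (\<lambda>t. to_complex (\<gamma> t))"
  obtain D where D: "\<And>t. t \<in> A \<Longrightarrow> (c has_vector_derivative D t) (at t)" "continuous_on A D"
    using A(2) unfolding C1_differentiable_on_def c_def by auto
  show opB: "open B"
    unfolding B by (rule open_vimage[OF A(1)]) (intro continuous_intros)
  have *: "((\<lambda>t. to_complex (\<eta> t)) has_vector_derivative m *\<^sub>R D (m * t + k)) (at t)"
    if t: "t \<in> B" for t
  proof (rule has_vector_derivative_transform_within_open[OF _ opB t])
    have "((\<lambda>t. m * t + k) has_vector_derivative m) (at t)"
      by (auto intro!: derivative_eq_intros)
    from vector_diff_chain_at[OF this D(1)]
    show "((\<lambda>t. c (m * t + k)) has_vector_derivative m *\<^sub>R D (m * t + k)) (at t)"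
      using t unfolding B o_def by simp
  qed (simp only: eq c_def)
  have "continuous_on B (\<lambda>t. m *\<^sub>R D (m * t + k))"
  proof (rule continuous_on_scaleR[OF continuous_on_const continuous_on_compose2[OF D(2)]])
    show "continuous_on B (\<lambda>t. m * t + k)" by (intro continuous_intros)
    show "(\<lambda>t. m * t + k) ` B \<subseteq> A" unfolding B by blast
  qed
  with * show "(\<lambda>t. to_complex (\<eta> t)) C1_differentiable_on B"
    unfolding C1_differentiable_on_def
    by (intro exI[of _ "\<lambda>t. m *\<^sub>R D (m * t + k)"]) simp
  show "spherical_speed \<eta> t = \<bar>m\<bar> * spherical_speed \<gamma> (m * t + k)" if t: "t \<in> B" for t
  proof -
    have "m * t + k \<in> A" using t unfolding B by simp
    then have 1: "vector_derivative (\<lambda>t. to_complex (\<gamma> t)) (at (m * t + k)) = D (m * t + k)"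
      using vector_derivative_at[OF D(1)] unfolding c_def by blast
    have 2: "vector_derivative (\<lambda>t. to_complex (\<eta> t)) (at t) = m *\<^sub>R D (m * t + k)"
      by (rule vector_derivative_at[OF *[OF t]])
    show ?thesis
      unfolding spherical_speed_def 1 2 eq[OF t] by simp
  qed
qed

lemma spherical_path_reverse:
  assumes \<gamma>: "spherical_path x y \<gamma>"
  shows "spherical_path y x (reversepath \<gamma>)" "spherical_length (reversepath \<gamma>) = spherical_length \<gamma>"
proof -
  obtain S where S: "finite S" "0 \<in> S" "1 \<in> S" "\<And>t. t \<in> {0..1} - S \<Longrightarrow> \<gamma> t \<noteq> Infty"
      "(\<lambda>t. to_complex (\<gamma> t)) C1_differentiable_on ({0..1} - S)" "open ({0..1} - S)"
    using spherical_pathE[OF \<gamma>] by metis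
  define N where "N = (\<lambda>s. 1 - s) ` S"
  have B: "{0..1} - N = (\<lambda>t. -1 * t + 1) -` ({0..1} - S)"
    unfolding N_def by (force simp: image_iff)
  have fin: "finite N" using S(1) by (simp add: N_def)
  have eq: "reversepath \<gamma> t = \<gamma> (-1 * t + 1)" for t
    by (simp add: reversepath_def)
  note rep = spherical_reparametrise[OF S(6,5) B eq]
  have nI: "Infty \<notin> reversepath \<gamma> ` ({0..1} - N)"
  proof
    assume "Infty \<in> reversepath \<gamma> ` ({0..1} - N)"
    then obtain t where t: "t \<in> {0..1} - N" "Infty = \<gamma> (-1 * t + 1)"
      unfolding eq by auto
    then have "-1 * t + 1 \<in> {0..1} - S" unfolding B by simp
    from S(4)[OF this] t(2) show False by simp
  qed
  show "spherical_path y x (reversepath \<gamma>)"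
    using \<gamma> fin rep(2) nI unfolding spherical_path_def
    by (intro conjI exI[of _ N]) auto
  have "spherical_length \<gamma> =
      (\<integral>\<^sup>+t. ennreal (indicator {0..1} (1 + -1 * t) * spherical_speed \<gamma> (1 + -1 * t)) \<partial>lborel)"
    unfolding spherical_length_eq
    by (subst nn_integral_real_affine[where c = "-1" and t = 1])
       (use spherical_speed_measurable[OF \<gamma>] in auto)
  also have "\<dots> = spherical_length (reversepath \<gamma>)"
    unfolding spherical_length_eq
  proof (intro nn_integral_cong_AE AE_I'[where N = N])
    show "N \<in> null_sets lborel" using fin by (rule finite_imp_null_set_lborel)
    have "indicator {0..1} (1 + -1 * t) * spherical_speed \<gamma> (1 + -1 * t) =
        indicator {0..1} t * spherical_speed (reversepath \<gamma>) t" if "t \<notin> N" for t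
      using that rep(3)[of t] by (cases "t \<in> {0..1}") (auto simp: indicator_def add.commute)
    then show "{t \<in> space lborel. ennreal (indicator {0..1} (1 + -1 * t) * spherical_speed \<gamma> (1 + -1 * t)) \<noteq>
        ennreal (indicator {0..1} t * spherical_speed (reversepath \<gamma>) t)} \<subseteq> N"
      by auto
  qed
  finally show "spherical_length (reversepath \<gamma>) = spherical_length \<gamma>" ..
qed

lemma spherical_path_join:
  assumes \<gamma>: "spherical_path x y \<gamma>" and \<eta>: "spherical_path y z \<eta>"
  shows "spherical_path x z (\<gamma> +++ \<eta>)"
    "spherical_length (\<gamma> +++ \<eta>) = spherical_length \<gamma> + spherical_length \<eta>"
proof -
  obtain S where S: "finite S" "0 \<in> S" "1 \<in> S" "\<And>t. t \<in> {0..1} - S \<Longrightarrow> \<gamma> t \<noteq> Infty"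
      "(\<lambda>t. to_complex (\<gamma> t)) C1_differentiable_on ({0..1} - S)" "open ({0..1} - S)"
    using spherical_pathE[OF \<gamma>] by metis
  obtain T where T: "finite T" "0 \<in> T" "1 \<in> T" "\<And>t. t \<in> {0..1} - T \<Longrightarrow> \<eta> t \<noteq> Infty"
      "(\<lambda>t. to_complex (\<eta> t)) C1_differentiable_on ({0..1} - T)" "open ({0..1} - T)"
    using spherical_pathE[OF \<eta>] by metis
  define N where "N = (\<lambda>s. s / 2) ` S \<union> (\<lambda>s. (s + 1) / 2) ` T"
  define A where "A = (\<lambda>t. 2 * t + 0) -` ({0..1} - S)"
  define B where "B = (\<lambda>t. 2 * t + -1) -` ({0..1} - T)"
  have Alt: "t < 1/2" "0 < t" if "t \<in> A" for t
    using that S(2,3) by (auto simp: A_def order.order_iff_strict)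
  have Bgt: "t > 1/2" "t < 1" if t: "t \<in> B" for t
  proof -
    have "2 * t + -1 \<noteq> 0" "2 * t + -1 \<noteq> 1" "0 \<le> 2 * t + -1" "2 * t + -1 \<le> 1"
      using t T(2,3) unfolding B_def by auto
    then show "t > 1/2" "t < 1" by linarith+
  qed
  have fin: "finite N" using S(1) T(1) by (simp add: N_def)
  have cov: "{0..1} - N \<subseteq> A \<union> B"
  proof
    fix t assume t: "t \<in> {0..1} - N"
    have "2 * t \<notin> S"
    proof
      assume "2 * t \<in> S"
      then have "2 * t / 2 \<in> N" unfolding N_def by blast
      with t show False by simp
    qed
    moreover have "2 * t - 1 \<notin> T"
    proof
      assume "2 * t - 1 \<in> T"
      then have "(2 * t - 1 + 1) / 2 \<in> N" unfolding N_def by blast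
      with t show False by simp
    qed
    ultimately show "t \<in> A \<union> B" using t by (auto simp: A_def B_def)
  qed
  have eqA: "(\<gamma> +++ \<eta>) t = \<gamma> (2 * t + 0)" if "t \<in> A" for t
    using Alt[OF that] by (simp add: joinpaths_def)
  have eqB: "(\<gamma> +++ \<eta>) t = \<eta> (2 * t + -1)" if "t \<in> B" for t
    using Bgt[OF that] by (simp add: joinpaths_def)
  note rA = spherical_reparametrise[OF S(6,5) A_def eqA]
  note rB = spherical_reparametrise[OF T(6,5) B_def eqB]
  have nI: "(\<gamma> +++ \<eta>) t \<noteq> Infty" if t: "t \<in> {0..1} - N" for t
  proof -
    consider "t \<in> A" | "t \<in> B" using cov t by auto
    then show ?thesis
    proof cases
      case 1
      then have "2 * t + 0 \<in> {0..1} - S" by (simp only: A_def vimage_eq)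
      from S(4)[OF this] show ?thesis unfolding eqA[OF 1] .
    next
      case 2
      then have "2 * t + -1 \<in> {0..1} - T" by (simp only: B_def vimage_eq)
      from T(4)[OF this] show ?thesis unfolding eqB[OF 2] .
    qed
  qed
  have "(\<lambda>t. to_complex ((\<gamma> +++ \<eta>) t)) C1_differentiable_on A \<union> B"
    using rA(1,2) rB(1,2) continuous_on_open_Un[OF rA(1) rB(1)]
    unfolding C1_differentiable_on_eq by blast
  then have "(\<lambda>t. to_complex ((\<gamma> +++ \<eta>) t)) C1_differentiable_on ({0..1} - N)"
    by (rule C1_differentiable_on_subset[OF _ cov])
  moreover have "Infty \<notin> (\<gamma> +++ \<eta>) ` ({0..1} - N)"
    using nI by (metis imageE)
  ultimately show "spherical_path x z (\<gamma> +++ \<eta>)"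
    using \<gamma> \<eta> fin unfolding spherical_path_def
    by (intro conjI exI[of _ N]) (simp_all add: path_join_imp)
  let ?f = "\<lambda>t. indicator {0..1} t * spherical_speed \<gamma> t"
  let ?g = "\<lambda>t. indicator {0..1} t * spherical_speed \<eta> t"
  let ?h = "\<lambda>t. indicator {0..1} t * spherical_speed (\<gamma> +++ \<eta>) t"
  have mf [measurable]: "?f \<in> borel_measurable borel" by (rule spherical_speed_measurable[OF \<gamma>])
  have mg [measurable]: "?g \<in> borel_measurable borel" by (rule spherical_speed_measurable[OF \<eta>])
  have mf2 [measurable]: "(\<lambda>t. ?f (0 + 2 * t)) \<in> borel_measurable borel"
    by (rule measurable_compose[OF _ mf]) measurable
  have mg2 [measurable]: "(\<lambda>t. ?g (-1 + 2 * t)) \<in> borel_measurable borel"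
    by (rule measurable_compose[OF _ mg]) measurable
  have "spherical_length \<gamma> = ennreal 2 * (\<integral>\<^sup>+t. ennreal (?f (0 + 2 * t)) \<partial>lborel)"
    unfolding spherical_length_eq
    by (subst nn_integral_real_affine[where c = 2 and t = 0]) (use mf in auto)
  also have "\<dots> = (\<integral>\<^sup>+t. ennreal 2 * ennreal (?f (0 + 2 * t)) \<partial>lborel)"
    by (rule nn_integral_cmult[symmetric]) (use mf2 in measurable)
  finally have l1: "spherical_length \<gamma> = \<dots>" .
  have "spherical_length \<eta> = ennreal 2 * (\<integral>\<^sup>+t. ennreal (?g (-1 + 2 * t)) \<partial>lborel)"
    unfolding spherical_length_eq
    by (subst nn_integral_real_affine[where c = 2 and t = "-1"]) (use mg in auto)
  also have "\<dots> = (\<integral>\<^sup>+t. ennreal 2 * ennreal (?g (-1 + 2 * t)) \<partial>lborel)"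
    by (rule nn_integral_cmult[symmetric]) (use mg2 in measurable)
  finally have l2: "spherical_length \<eta> = \<dots>" .
  have "spherical_length \<gamma> + spherical_length \<eta> =
      (\<integral>\<^sup>+t. ennreal 2 * ennreal (?f (0 + 2 * t)) + ennreal 2 * ennreal (?g (-1 + 2 * t)) \<partial>lborel)"
    unfolding l1 l2 by (rule nn_integral_add[symmetric]) (use mf2 mg2 in measurable)
  also have "\<dots> = spherical_length (\<gamma> +++ \<eta>)"
    unfolding spherical_length_eq
  proof (intro nn_integral_cong_AE AE_I'[where N = N])
    show "N \<in> null_sets lborel" using fin by (rule finite_imp_null_set_lborel)
    have "ennreal 2 * ennreal (?f (0 + 2 * t)) + ennreal 2 * ennreal (?g (-1 + 2 * t)) = ennreal (?h t)"
      if t: "t \<notin> N" for t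
    proof -
      have "2 * ?f (0 + 2 * t) + 2 * ?g (-1 + 2 * t) = ?h t"
      proof (cases "t \<in> {0..1}")
        case True
        then consider "t \<in> A" | "t \<in> B" using cov t by auto
        then show ?thesis
        proof cases
          case 1
          then show ?thesis using rA(3)[OF _ 1] Alt[OF 1] by (simp add: indicator_def)
        next
          case 2
          then show ?thesis using rB(3)[OF _ 2] Bgt[OF 2] by (simp add: indicator_def)
        qed
      next
        case False
        then show ?thesis by (auto simp: indicator_def)
      qed
      moreover have "ennreal 2 * ennreal a + ennreal 2 * ennreal b = ennreal (2 * a + 2 * b)"
        if "0 \<le> a" "0 \<le> b" for a b
        using that ennreal_mult'[of 2 a] ennreal_mult'[of 2 b] ennreal_plus[of "2 * a" "2 * b"]
        by simp
      ultimately show ?thesis by (metis (no_types, lifting) spherical_speed_nonneg mult_nonneg_nonneg indicator_pos_le)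
    qed
    then show "{t \<in> space lborel. ennreal 2 * ennreal (?f (0 + 2 * t)) + ennreal 2 * ennreal (?g (-1 + 2 * t)) \<noteq>
        ennreal (?h t)} \<subseteq> N"
      by auto
  qed
  finally show "spherical_length (\<gamma> +++ \<eta>) = spherical_length \<gamma> + spherical_length \<eta>" ..
qed

lemma spherical_edist_commute: "spherical_edist x y = spherical_edist y x"
proof -
  have "spherical_edist x y \<le> spherical_edist y x" for x y
    unfolding spherical_edist_def
    by (rule INF_mono) (metis mem_Collect_eq spherical_path_reverse order_refl)
  then show ?thesis by (simp add: antisym)
qed

lemma spherical_edist_triangle: "spherical_edist x z \<le> spherical_edist x y + spherical_edist y z"
proof -
  have 1: "spherical_edist x z \<le> spherical_length \<gamma> + spherical_length \<eta>"
    if "spherical_path x y \<gamma>" "spherical_path y z \<eta>" for \<gamma> \<eta>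
    using spherical_path_join[OF that] unfolding spherical_edist_def
    by (metis INF_lower mem_Collect_eq)
  have "spherical_edist x z \<le> a + b" if ab: "spherical_edist x y < a" "spherical_edist y z < b" for a b
  proof -
    obtain \<gamma> where g: "spherical_path x y \<gamma>" "spherical_length \<gamma> < a"
      using ab(1) unfolding spherical_edist_def INF_less_iff by auto
    obtain \<eta> where h: "spherical_path y z \<eta>" "spherical_length \<eta> < b"
      using ab(2) unfolding spherical_edist_def INF_less_iff by auto
    show ?thesis
      using 1[OF g(1) h(1)] g(2) h(2) by (meson add_mono less_imp_le order_trans)
  qed
  note 2 = this
  show ?thesis
  proof (cases "spherical_edist x y = \<infinity> \<or> spherical_edist y z = \<infinity>")
    case False
    show ?thesis
    proof (rule ennreal_le_epsilon)
      fix e :: real assume e: "0 < e"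
      have "spherical_edist x y < spherical_edist x y + ennreal (e/2)"
        "spherical_edist y z < spherical_edist y z + ennreal (e/2)"
        using e False by (auto simp: ennreal_add_left_cancel_less less_top)
      note le = 2[OF this]
      have h: "ennreal (e/2) + ennreal (e/2) = ennreal e"
        using e by (simp flip: ennreal_plus)
      have "a + ennreal (e/2) + (b + ennreal (e/2)) = a + b + ennreal e" for a b
        unfolding h[symmetric] by (simp only: ac_simps)
      with le show "spherical_edist x z \<le> spherical_edist x y + spherical_edist y z + ennreal e"
        by simp
    qed
  qed auto
qed

subsection \<open>The length metric induces the topology of the sphere\<close>

lemma continuous_on_Fin [continuous_intros]:
  "continuous_on A f \<Longrightarrow> continuous_on A (\<lambda>x. Fin (f x))"
proof -
  have "continuous_on UNIV Fin"
    by (simp add: continuous_on_open_vimage open_rsphere_def)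
  then show "continuous_on A f \<Longrightarrow> continuous_on A (\<lambda>x. Fin (f x))"
    by (rule continuous_on_compose2) auto
qed

lemma tendsto_Infty:
  assumes "filterlim f at_infinity F"
  shows "((\<lambda>x. Fin (f x)) \<longlongrightarrow> Infty) F"
proof (rule topological_tendstoI)
  fix U :: "rsphere set" assume U: "open U" "Infty \<in> U"
  then have "bounded (- (Fin -` U))"
    by (auto simp: open_rsphere_def compact_imp_bounded)
  then obtain b where b: "\<And>z. z \<in> - (Fin -` U) \<Longrightarrow> norm z \<le> b"
    unfolding bounded_iff by blast
  have "eventually (\<lambda>z. Fin z \<in> U) at_infinity"
    unfolding eventually_at_infinity
  proof (intro exI allI impI)
    fix z :: complex assume "b + 1 \<le> norm z"
    with b[of z] show "Fin z \<in> U" by fastforce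
  qed
  then show "eventually (\<lambda>x. Fin (f x) \<in> U) F"
    using assms by (rule eventually_compose_filterlim)
qed

lemma continuous_on_rsphereI:
  fixes F :: "rsphere \<Rightarrow> 'b::topological_space"
  assumes fin: "continuous_on UNIV (\<lambda>z. F (Fin z))"
    and inf: "((\<lambda>z. F (Fin z)) \<longlongrightarrow> F Infty) at_infinity"
  shows "continuous_on UNIV F"
proof -
  have "open (F -` B)" if B: "open B" for B
  proof -
    have 1: "open (Fin -` (F -` B))"
      using continuous_on_open_vimage[THEN iffD1, OF _ fin, rule_format, OF _ B]
      by (simp add: vimage_def)
    have "compact (- (Fin -` (F -` B)))" if "F Infty \<in> B"
    proof -
      have "eventually (\<lambda>z. F (Fin z) \<in> B) at_infinity"
        using topological_tendstoD[OF inf B that] .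
      then obtain b where b: "\<And>z. b \<le> norm z \<Longrightarrow> F (Fin z) \<in> B"
        unfolding eventually_at_infinity by blast
      have "bounded (- (Fin -` (F -` B)))"
        unfolding bounded_iff
      proof (intro exI ballI)
        fix z assume "z \<in> - (Fin -` (F -` B))"
        then show "norm z \<le> b" using b[of z] by force
      qed
      then show ?thesis using 1 by (simp add: compact_eq_bounded_closed closed_Compl)
    qed
    with 1 show ?thesis by (simp add: open_rsphere_def)
  qed
  then show ?thesis by (simp add: continuous_on_open_vimage)
qed

lemma compact_UNIV_rsphere: "compact (UNIV :: rsphere set)"
  unfolding compact_eq_Heine_Borel
proof (intro allI impI)
  fix C :: "rsphere set set" assume C: "(\<forall>c\<in>C. open c) \<and> UNIV \<subseteq> \<Union>C"
  then obtain U where U: "U \<in> C" "Infty \<in> U" by auto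
  have "compact (- (Fin -` U))"
    using C U by (auto simp: open_rsphere_def)
  then have "compact (Fin ` (- (Fin -` U)))"
    by (rule compact_continuous_image[rotated]) (intro continuous_intros)
  then obtain D where D: "D \<subseteq> C" "finite D" "Fin ` (- (Fin -` U)) \<subseteq> \<Union>D"
    using C unfolding compact_eq_Heine_Borel by (metis subset_UNIV order_trans)
  have "x \<in> \<Union>(insert U D)" for x
    using U D(3) by (cases x) auto
  then have "UNIV \<subseteq> \<Union>(insert U D)" by blast
  moreover have "insert U D \<subseteq> C" "finite (insert U D)" using D U by auto
  ultimately show "\<exists>D\<subseteq>C. finite D \<and> UNIV \<subseteq> \<Union>D"
    by blast
qed

lemma one_plus_norm_sq_pos: "0 < 1 + (norm (z::complex))\<^sup>2"
  by (simp add: add_pos_nonneg)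

lemma spherical_edist_lower_bound:
  fixes F :: "rsphere \<Rightarrow> 'b::euclidean_space"
  assumes "continuous_on UNIV F"
    and "\<And>z. ((\<lambda>z. F (Fin z)) has_derivative F' z) (at z)"
    and "\<And>z h. norm (F' z h) \<le> K * (2 * norm h / (1 + (norm z)\<^sup>2))"
    and "0 < K"
  shows "ennreal (norm (F y - F x)) \<le> ennreal K * spherical_edist x y"
proof -
  have K: "ennreal K \<noteq> 0" "ennreal K \<noteq> \<infinity>"
    using assms(4) by auto
  have "ennreal (norm (F y - F x)) / ennreal K \<le> spherical_edist x y"
    unfolding spherical_edist_def
  proof (rule INF_greatest)
    fix \<gamma> assume "\<gamma> \<in> Collect (spherical_path x y)"
    then have "ennreal (norm (F y - F x)) \<le> ennreal K * spherical_length \<gamma>"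
      using spherical_length_lower_bound[OF _ assms(1-3)] assms(4) by simp
    then show "ennreal (norm (F y - F x)) / ennreal K \<le> spherical_length \<gamma>"
      using K by (metis divide_le_posI_ennreal mult.commute zero_less_iff_neq_zero)
  qed
  then have "ennreal K * (ennreal (norm (F y - F x)) / ennreal K) \<le> ennreal K * spherical_edist x y"
    by (intro mult_left_mono) auto
  then show ?thesis
    using K by (metis ennreal_mult_divide_eq ennreal_times_divide mult.commute infinity_ennreal_def)
qed

text \<open>Up to scaling, the coordinates of the stereographic projection.\<close>

primrec stereo_height :: "rsphere \<Rightarrow> real" where
  "stereo_height (Fin z) = 1 / (1 + (norm z)\<^sup>2)"
| "stereo_height Infty = 0"

primrec stereo_plane :: "rsphere \<Rightarrow> complex" where
  "stereo_plane (Fin z) = (1 / (1 + (norm z)\<^sup>2)) *\<^sub>R z"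
| "stereo_plane Infty = 0"

lemma norm_pow2_at_infinity: "filterlim (\<lambda>z::complex. 1 + (norm z)\<^sup>2) at_top at_infinity"
  by (intro filterlim_tendsto_add_at_top[OF tendsto_const] filterlim_pow_at_top filterlim_norm_at_top) auto

lemma continuous_stereo_height: "continuous_on UNIV stereo_height"
proof (rule continuous_on_rsphereI)
  show "continuous_on UNIV (\<lambda>z. stereo_height (Fin z))"
    using one_plus_norm_sq_pos by (auto intro!: continuous_intros simp: less_imp_neq[symmetric])
  have "((\<lambda>z::complex. inverse (1 + (norm z)\<^sup>2)) \<longlongrightarrow> 0) at_infinity"
    by (rule tendsto_inverse_0_at_top[OF norm_pow2_at_infinity])
  then show "((\<lambda>z. stereo_height (Fin z)) \<longlongrightarrow> stereo_height Infty) at_infinity"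
    by (simp add: inverse_eq_divide)
qed

lemma continuous_stereo_plane: "continuous_on UNIV stereo_plane"
proof (rule continuous_on_rsphereI)
  show "continuous_on UNIV (\<lambda>z. stereo_plane (Fin z))"
    using one_plus_norm_sq_pos by (auto intro!: continuous_intros simp: less_imp_neq[symmetric])
  have "((\<lambda>z::complex. inverse (norm z)) \<longlongrightarrow> 0) at_infinity"
    by (intro tendsto_inverse_0_at_top filterlim_norm_at_top)
  moreover have "eventually (\<lambda>z. norm (stereo_plane (Fin z)) \<le> inverse (norm z)) at_infinity"
  proof -
    have "norm (stereo_plane (Fin z)) \<le> inverse (norm z)" for z :: complex
    proof (cases "z = 0")
      case False
      have "norm (stereo_plane (Fin z)) = norm z / (1 + (norm z)\<^sup>2)"
        using one_plus_norm_sq_pos[of z] by simp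
      also have "\<dots> \<le> norm z / (norm z)\<^sup>2"
        using False by (intro divide_left_mono) (auto simp: add_pos_nonneg)
      also have "\<dots> = inverse (norm z)"
        using False by (simp add: power2_eq_square divide_inverse)
      finally show ?thesis .
    qed auto
    then show ?thesis by (simp del: stereo_plane.simps)
  qed
  ultimately show "((\<lambda>z. stereo_plane (Fin z)) \<longlongrightarrow> stereo_plane Infty) at_infinity"
    using Lim_null_comparison[of "\<lambda>z. stereo_plane (Fin z)" "\<lambda>z. inverse (norm z)" at_infinity]
    unfolding stereo_plane.simps(2) by blast
qed

lemma stereo_inj:
  assumes "stereo_height x = stereo_height y" "stereo_plane x = stereo_plane y"
  shows "x = y"
proof -
  have pos: "stereo_height (Fin z) > 0" for z
    using one_plus_norm_sq_pos by simp
  have pl: "stereo_plane (Fin z) = stereo_height (Fin z) *\<^sub>R z" for z by simp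
  show ?thesis
  proof (cases x)
    case x: (Fin z)
    show ?thesis
    proof (cases y)
      case y: (Fin w)
      have "stereo_height (Fin z) *\<^sub>R z = stereo_height (Fin z) *\<^sub>R w"
        using assms unfolding x y pl by metis
      then show ?thesis
        using pos[of z] unfolding x y scaleR_cancel_left by simp
    next
      case Infty
      then show ?thesis using assms(1) pos[of z] x by simp
    qed
  next
    case x: Infty
    then show ?thesis using assms(1) pos by (cases y) (metis less_irrefl stereo_height.simps(2))+
  qed
qed

lemma inner_over_norm_le: "\<bar>z \<bullet> h\<bar> * 2 \<le> norm h * (1 + (norm (z::complex))\<^sup>2)"
proof -
  have "\<bar>z \<bullet> h\<bar> \<le> norm z * norm h" by (rule Cauchy_Schwarz_ineq2)
  moreover have "2 * norm z \<le> 1 + (norm z)\<^sup>2"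
    using sum_squares_bound[of 1 "norm z"] by (simp add: power2_eq_square)
  then have "2 * norm z * norm h \<le> (1 + (norm z)\<^sup>2) * norm h"
    by (rule mult_right_mono) auto
  ultimately show ?thesis by (simp add: algebra_simps)
qed

lemma inverse_has_derivative:
  "((\<lambda>z::complex. 1 / (1 + (norm z)\<^sup>2)) has_derivative
    (\<lambda>h. - (2 * (z \<bullet> h)) / (1 + (norm z)\<^sup>2)\<^sup>2)) (at z)"
proof -
  have "1 + z \<bullet> z \<noteq> 0"
    using one_plus_norm_sq_pos[of z] by (simp add: power2_norm_eq_inner)
  then show ?thesis
    unfolding power2_norm_eq_inner
    by (auto intro!: derivative_eq_intros simp: power2_eq_square inner_commute fun_eq_iff field_simps)
qed

lemma stereo_height_edist: "ennreal \<bar>stereo_height y - stereo_height x\<bar> \<le> spherical_edist x y"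
proof -
  let ?D = "\<lambda>z h::complex. - (2 * (z \<bullet> h)) / (1 + (norm z)\<^sup>2)\<^sup>2"
  have "((\<lambda>z. stereo_height (Fin z)) has_derivative ?D z) (at z)" for z
    using inverse_has_derivative by simp
  moreover have "norm (?D z h) \<le> 1 * (2 * norm h / (1 + (norm z)\<^sup>2))" for z h
  proof -
    have "norm (?D z h) = 2 * \<bar>z \<bullet> h\<bar> / (1 + (norm z)\<^sup>2)\<^sup>2"
      using one_plus_norm_sq_pos[of z] by (simp add: abs_mult)
    also have "\<dots> \<le> norm h * (1 + (norm z)\<^sup>2) / (1 + (norm z)\<^sup>2)\<^sup>2"
      using inner_over_norm_le[of z h] by (intro divide_right_mono) auto
    also have "\<dots> = norm h / (1 + (norm z)\<^sup>2)"
      using one_plus_norm_sq_pos[of z] by (simp add: power2_eq_square)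
    also have "\<dots> \<le> 1 * (2 * norm h / (1 + (norm z)\<^sup>2))"
      using one_plus_norm_sq_pos[of z] by (simp add: divide_right_mono)
    finally show ?thesis .
  qed
  ultimately show ?thesis
    using spherical_edist_lower_bound[OF continuous_stereo_height, of ?D 1 y x] by simp
qed

lemma stereo_plane_edist: "ennreal (norm (stereo_plane y - stereo_plane x)) \<le> ennreal 2 * spherical_edist x y"
proof -
  let ?D = "\<lambda>z h::complex. (1 / (1 + (norm z)\<^sup>2)) *\<^sub>R h + (- (2 * (z \<bullet> h)) / (1 + (norm z)\<^sup>2)\<^sup>2) *\<^sub>R z"
  have "((\<lambda>z. stereo_plane (Fin z)) has_derivative ?D z) (at z)" for z
    unfolding stereo_plane.simps
    by (rule has_derivative_eq_rhs[OF has_derivative_scaleR[OF inverse_has_derivative has_derivative_ident]])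
       simp
  moreover have "norm (?D z h) \<le> 2 * (2 * norm h / (1 + (norm z)\<^sup>2))" for z h
  proof -
    have pos: "0 < 1 + (norm z)\<^sup>2" by (rule one_plus_norm_sq_pos)
    have "2 * \<bar>z \<bullet> h\<bar> * norm z \<le> 2 * (norm z * norm h) * norm z"
      using Cauchy_Schwarz_ineq2[of z h] by (intro mult_right_mono) auto
    also have "\<dots> = 2 * norm h * (norm z)\<^sup>2" by (simp add: power2_eq_square)
    also have "\<dots> \<le> 2 * norm h * (1 + (norm z)\<^sup>2)" by (intro mult_left_mono) auto
    finally have le: "2 * \<bar>z \<bullet> h\<bar> * norm z \<le> 2 * norm h * (1 + (norm z)\<^sup>2)" .
    have "norm (?D z h) \<le> norm ((1 / (1 + (norm z)\<^sup>2)) *\<^sub>R h) +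
        norm ((- (2 * (z \<bullet> h)) / (1 + (norm z)\<^sup>2)\<^sup>2) *\<^sub>R z)"
      by (rule norm_triangle_ineq)
    also have "\<dots> = norm h / (1 + (norm z)\<^sup>2) + 2 * \<bar>z \<bullet> h\<bar> * norm z / (1 + (norm z)\<^sup>2)\<^sup>2"
      using pos by (simp add: abs_mult)
    also have "\<dots> \<le> norm h / (1 + (norm z)\<^sup>2) + 2 * norm h * (1 + (norm z)\<^sup>2) / (1 + (norm z)\<^sup>2)\<^sup>2"
      using le by (intro add_left_mono divide_right_mono) auto
    also have "\<dots> = 3 * norm h / (1 + (norm z)\<^sup>2)"
      using pos by (simp add: power2_eq_square[of "1 + (norm z)\<^sup>2"] add_divide_distrib[symmetric])
    also have "\<dots> \<le> 2 * (2 * norm h / (1 + (norm z)\<^sup>2))"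
      using pos by (simp add: divide_right_mono)
    finally show ?thesis .
  qed
  ultimately show ?thesis
    using spherical_edist_lower_bound[OF continuous_stereo_plane, of ?D 2 y x] by simp
qed

lemma spherical_edist_separates:
  assumes U: "open U" "x \<in> U"
  obtains e where "0 < e" "\<And>y. spherical_edist x y < ennreal e \<Longrightarrow> y \<in> U"
proof (cases "U = UNIV")
  case True
  then show ?thesis using that[of 1] by auto
next
  case False
  define G where "G y = \<bar>stereo_height y - stereo_height x\<bar> + norm (stereo_plane y - stereo_plane x)" for y
  have "compact (- U)"
    using compact_Int_closed[OF compact_UNIV_rsphere closed_Compl[OF U(1)]] by simp
  moreover have "continuous_on (- U) G"
    unfolding G_def
    by (intro continuous_intros continuous_on_subset[OF continuous_stereo_height]
        continuous_on_subset[OF continuous_stereo_plane]) auto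
  ultimately obtain u where u: "u \<in> - U" "\<And>y. y \<in> - U \<Longrightarrow> G u \<le> G y"
    using continuous_attains_inf[of "- U" G] False by auto
  have "x \<noteq> u" using u(1) U(2) by auto
  then have "stereo_height u - stereo_height x \<noteq> 0 \<or> stereo_plane u - stereo_plane x \<noteq> 0"
    using stereo_inj[of x u] by auto
  then have Gu: "0 < G u"
    unfolding G_def by (smt (verit) zero_less_norm_iff norm_ge_zero)
  show ?thesis
  proof (rule that[of "G u / 3"])
    show "0 < G u / 3" using Gu by simp
    fix y assume y: "spherical_edist x y < ennreal (G u / 3)"
    show "y \<in> U"
    proof (rule ccontr)
      assume "y \<notin> U"
      then have "ennreal (G u) \<le> ennreal (G y)"
        using u(2)[of y] by (intro ennreal_leI) auto
      also have "\<dots> \<le> spherical_edist x y + ennreal 2 * spherical_edist x y"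
        unfolding G_def using stereo_height_edist[of y x] stereo_plane_edist[of y x]
        by (simp add: add_mono ennreal_plus)
      also have "\<dots> = ennreal 3 * spherical_edist x y"
        by (simp add: distrib_right[of 1 2, simplified])
      also have "\<dots> < ennreal 3 * ennreal (G u / 3)"
        using y by (intro ennreal_mult_strict_left_mono) auto
      also have "\<dots> = ennreal (G u)"
        using Gu ennreal_mult'[of 3 "G u / 3"] by simp
      finally show False by simp
    qed
  qed
qed

lemma spherical_edist_Fin_le: "spherical_edist (Fin z) (Fin w) \<le> ennreal (2 * norm (w - z))"
proof -
  let ?\<gamma> = "\<lambda>t. Fin (linepath z w t)"
  have "(\<lambda>t. linepath z w t) C1_differentiable_on ({0..1} - {})"
    unfolding C1_differentiable_on_def
    by (intro exI[of _ "\<lambda>_. w - z"] conjI ballI has_vector_derivative_linepath_within) auto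
  then have \<gamma>: "spherical_path (Fin z) (Fin w) ?\<gamma>"
    unfolding spherical_path_def path_def pathstart_def pathfinish_def
    by (intro conjI exI[of _ "{}"] continuous_intros) (auto simp: linepath_def)
  have "spherical_speed ?\<gamma> t \<le> 2 * norm (w - z)" for t
  proof -
    have "vector_derivative (linepath z w) (at t) = w - z"
      by (rule vector_derivative_at[OF has_vector_derivative_linepath_within])
    then show ?thesis
      unfolding spherical_speed_def using one_plus_norm_sq_pos[of "linepath z w t"]
      by (auto simp: divide_simps mult_le_cancel_left1 intro: mult_left_mono)
  qed
  then have "spherical_length ?\<gamma> \<le> (\<integral>\<^sup>+t\<in>{0..1::real}. ennreal (2 * norm (w - z)) \<partial>lborel)"
    unfolding spherical_length_def by (intro nn_integral_mono mult_right_mono ennreal_leI) auto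
  also have "\<dots> = ennreal (2 * norm (w - z))"
    by (simp add: nn_integral_cmult_indicator)
  finally show ?thesis
    unfolding spherical_edist_def using \<gamma> by (intro INF_lower2[of ?\<gamma>]) auto
qed

lemma spherical_edist_Infty_le:
  assumes w: "w \<noteq> 0"
  shows "spherical_edist (Fin w) Infty \<le> ennreal (2 / norm w)"
proof -
  let ?\<gamma> = "\<lambda>t::real. if t = 1 then Infty else Fin ((1 / (1 - t)) *\<^sub>R w)"
  have der: "((\<lambda>t. to_complex (?\<gamma> t)) has_vector_derivative (1 / (1 - t)\<^sup>2) *\<^sub>R w) (at t)"
    if t: "t \<noteq> 1" for t
  proof (rule has_vector_derivative_transform_within_open[where S = "- {1}"])
    show "((\<lambda>t. (1 / (1 - t)) *\<^sub>R w) has_vector_derivative (1 / (1 - t)\<^sup>2) *\<^sub>R w) (at t)"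
      using t by (auto intro!: derivative_eq_intros simp: power2_eq_square divide_simps)
  qed (use t in auto)
  have cont: "continuous_on {0..1} ?\<gamma>"
  proof -
    have "(?\<gamma> \<longlongrightarrow> ?\<gamma> t) (at t within {0..1})" if t: "t \<in> {0..1}" for t
    proof (cases "t = 1")
      case True
      have "filterlim (\<lambda>t::real. w / of_real (1 - t)) at_infinity (at 1)"
      proof -
        have "filterlim (\<lambda>t::real. complex_of_real (1 - t)) (at 0) (at 1)"
          by (auto simp: filterlim_at eventually_at_filter intro!: tendsto_eq_intros)
        then have "filterlim (\<lambda>t::real. inverse (complex_of_real (1 - t))) at_infinity (at 1)"
          by (rule filterlim_compose[OF filterlim_inverse_at_infinity])
        from tendsto_mult_filterlim_at_infinity[OF tendsto_const w this]
        show ?thesis by (simp add: divide_inverse)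
      qed
      then have "((\<lambda>t::real. Fin (w / of_real (1 - t))) \<longlongrightarrow> Infty) (at 1 within {0..1})"
        by (intro tendsto_Infty) (metis filterlim_mono at_le subset_UNIV order_refl)
      moreover have "eventually (\<lambda>t. Fin (w / of_real (1 - t)) = ?\<gamma> t) (at 1 within {0..1})"
        by (auto simp: eventually_at_filter scaleR_conv_of_real divide_inverse mult.commute
            intro!: always_eventually)
      ultimately have "(?\<gamma> \<longlongrightarrow> Infty) (at 1 within {0..1})"
        by (rule Lim_transform_eventually)
      then show ?thesis using True by simp
    next
      case False
      have "continuous_on (- {1}) (\<lambda>t::real. Fin ((1 / (1 - t)) *\<^sub>R w))"
        by (intro continuous_intros) auto
      then have "continuous_on (- {1}) ?\<gamma>"
        by (rule continuous_on_eq) auto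
      then have "isCont ?\<gamma> t"
        by (rule continuous_on_interior) (use False in \<open>simp add: interior_open open_Compl\<close>)
      then have "(?\<gamma> \<longlongrightarrow> ?\<gamma> t) (at t)"
        by (simp only: continuous_at)
      then show ?thesis by (rule tendsto_within_subset) simp
    qed
    then show ?thesis by (auto simp: continuous_on_def)
  qed
  have C1: "(\<lambda>t. to_complex (?\<gamma> t)) C1_differentiable_on ({0..1} - {1})"
    unfolding C1_differentiable_on_def
  proof (intro exI conjI ballI)
    show "continuous_on ({0..1} - {1}) (\<lambda>t::real. (1 / (1 - t)\<^sup>2) *\<^sub>R w)"
      by (intro continuous_intros) auto
    show "((\<lambda>t. to_complex (?\<gamma> t)) has_vector_derivative (1 / (1 - t)\<^sup>2) *\<^sub>R w) (at t)"
      if "t \<in> {0..1} - {1}" for t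
      using that by (intro der) auto
  qed
  have "Infty \<notin> ?\<gamma> ` ({0..1} - {1})"
    by auto
  with C1 cont have \<gamma>: "spherical_path (Fin w) Infty ?\<gamma>"
    unfolding spherical_path_def path_def pathstart_def pathfinish_def
    by (intro conjI exI[of _ "{1}"]) simp_all
  have speed: "spherical_speed ?\<gamma> t \<le> 2 / norm w" if t: "t \<noteq> 1" for t
  proof -
    define a where "a = \<bar>1 - t\<bar>"
    define b where "b = norm w"
    have ab: "0 < a" "0 < b" using t w by (auto simp: a_def b_def)
    have "spherical_speed ?\<gamma> t = 2 * (b / a\<^sup>2) / (1 + (b / a)\<^sup>2)"
      unfolding spherical_speed_def vector_derivative_at[OF der[OF t]]
      using t by (simp add: a_def b_def)
    also have "\<dots> = 2 * b / (a\<^sup>2 + b\<^sup>2)"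
      using ab by (simp add: field_simps)
    also have "\<dots> \<le> 2 * b / b\<^sup>2"
      using ab by (intro divide_left_mono mult_pos_pos add_pos_pos) auto
    also have "\<dots> = 2 / b"
      using ab by (simp add: power2_eq_square)
    finally show ?thesis by (simp add: b_def)
  qed
  have "spherical_length ?\<gamma> \<le> (\<integral>\<^sup>+t\<in>{0..1::real}. ennreal (2 / norm w) \<partial>lborel)"
    unfolding spherical_length_def
  proof (intro nn_integral_mono_AE AE_I'[where N = "{1}"])
    show "{1} \<in> null_sets (lborel :: real measure)" by (simp add: finite_imp_null_set_lborel)
    show "{t \<in> space lborel. \<not> ennreal (spherical_speed ?\<gamma> t) * indicator {0..1} t \<le>
        ennreal (2 / norm w) * indicator {0..1} t} \<subseteq> {1}"
      using speed by (auto intro!: mult_right_mono ennreal_leI)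
  qed
  also have "\<dots> = ennreal (2 / norm w)"
    by (simp add: nn_integral_cmult_indicator)
  finally show ?thesis
    unfolding spherical_edist_def using \<gamma> by (intro INF_lower2[of ?\<gamma>]) auto
qed

lemma spherical_edist_finite: "spherical_edist x y < \<infinity>"
proof -
  have 0: "spherical_edist (Fin 0) (Fin z) < \<infinity>" for z
    using spherical_edist_Fin_le[of 0 z] by (rule le_less_trans) auto
  have "spherical_edist (Fin 0) Infty \<le> spherical_edist (Fin 0) (Fin 1) + spherical_edist (Fin 1) Infty"
    by (rule spherical_edist_triangle)
  also have "\<dots> < \<infinity>"
    using 0[of 1] le_less_trans[OF spherical_edist_Infty_le[of 1], of \<infinity>] by simp
  finally have *: "spherical_edist (Fin 0) z < \<infinity>" for z
    using 0 by (cases z) auto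
  have "spherical_edist x y \<le> spherical_edist x (Fin 0) + spherical_edist (Fin 0) y"
    by (rule spherical_edist_triangle)
  also have "\<dots> < \<infinity>"
    using * by (simp add: spherical_edist_commute[of x])
  finally show ?thesis .
qed

lemma open_rsphere_iff_spherical_edist:
  "open U \<longleftrightarrow> (\<forall>x\<in>U. \<exists>e>0. \<forall>y. spherical_edist x y < ennreal e \<longrightarrow> y \<in> U)"
proof
  assume "open U"
  then show "\<forall>x\<in>U. \<exists>e>0. \<forall>y. spherical_edist x y < ennreal e \<longrightarrow> y \<in> U"
    by (metis spherical_edist_separates)
next
  assume U: "\<forall>x\<in>U. \<exists>e>0. \<forall>y. spherical_edist x y < ennreal e \<longrightarrow> y \<in> U"
  have op: "open (Fin -` U)"
    unfolding open_dist
  proof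
    fix z assume "z \<in> Fin -` U"
    then obtain e where e: "e > 0" "\<And>y. spherical_edist (Fin z) y < ennreal e \<Longrightarrow> y \<in> U"
      using U by auto
    have "w \<in> Fin -` U" if "dist w z < e / 2" for w
    proof -
      have "spherical_edist (Fin z) (Fin w) \<le> ennreal (2 * norm (w - z))"
        by (rule spherical_edist_Fin_le)
      also have "\<dots> < ennreal e"
        using that e(1) by (intro ennreal_lessI) (auto simp: dist_norm)
      finally show ?thesis using e(2) by simp
    qed
    then show "\<exists>e>0. \<forall>w. dist w z < e \<longrightarrow> w \<in> Fin -` U"
      using e(1) by (intro exI[of _ "e / 2"]) auto
  qed
  have "compact (- (Fin -` U))" if inf: "Infty \<in> U"
  proof -
    obtain e where e: "e > 0" "\<And>y. spherical_edist Infty y < ennreal e \<Longrightarrow> y \<in> U"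
      using bspec[OF U inf] by auto
    have "norm z \<le> 2 / e" if z: "z \<in> - (Fin -` U)" for z
    proof (rule ccontr)
      assume n: "\<not> norm z \<le> 2 / e"
      then have big: "2 / e < norm z" by simp
      moreover have "0 < 2 / e" using e(1) by simp
      ultimately have "z \<noteq> 0" by force
      have "spherical_edist Infty (Fin z) \<le> ennreal (2 / norm z)"
        using spherical_edist_Infty_le[OF \<open>z \<noteq> 0\<close>] by (simp add: spherical_edist_commute)
      also have "\<dots> < ennreal e"
        using big e(1) \<open>z \<noteq> 0\<close> by (intro ennreal_lessI) (auto simp: field_simps)
      finally show False using e(2) z by auto
    qed
    then have "bounded (- (Fin -` U))"
      unfolding bounded_iff by blast
    then show ?thesis using op by (simp add: compact_eq_bounded_closed closed_Compl)
  qed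
  with op show "open U" by (simp add: open_rsphere_def)
qed

instantiation rsphere :: metric_space
begin

definition dist_rsphere :: "rsphere \<Rightarrow> rsphere \<Rightarrow> real" where
  "dist_rsphere x y = enn2real (spherical_edist x y)"

definition uniformity_rsphere :: "(rsphere \<times> rsphere) filter" where
  "uniformity_rsphere = (INF e\<in>{0<..}. principal {(x, y). dist x y < e})"

instance
proof
  have ennreal_dist: "ennreal (dist x y) = spherical_edist x y" for x y :: rsphere
    using spherical_edist_finite[of x y] by (simp add: dist_rsphere_def)
  have dist_less: "dist x y < e \<longleftrightarrow> spherical_edist x y < ennreal e" for x y :: rsphere and e
    unfolding ennreal_dist[symmetric] by (simp add: ennreal_less_iff dist_rsphere_def)
  show "uniformity = (INF e\<in>{0<..}. principal {(x, y :: rsphere). dist x y < e})"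
    by (rule uniformity_rsphere_def)
  show "open U \<longleftrightarrow> (\<forall>x\<in>U. \<forall>\<^sub>F (x', y) in uniformity. x' = x \<longrightarrow> y \<in> U)" for U :: "rsphere set"
  proof -
    have ev: "eventually P uniformity \<longleftrightarrow> (\<exists>e>0. \<forall>x y. dist x y < e \<longrightarrow> P (x, y))"
      for P :: "rsphere \<times> rsphere \<Rightarrow> bool"
      unfolding uniformity_rsphere_def
      by (subst eventually_INF_base)
         (auto simp: eventually_principal subset_eq intro: bexI[of _ "min _ _"])
    show ?thesis
      unfolding open_rsphere_iff_spherical_edist ev dist_less by auto
  qed
  show "dist x y = 0 \<longleftrightarrow> x = y" for x y :: rsphere
  proof
    assume "dist x y = 0"
    then have "spherical_edist x y = 0"
      using ennreal_dist[of x y] by simp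
    then have "stereo_height y = stereo_height x" "stereo_plane y = stereo_plane x"
      using stereo_height_edist[of y x] stereo_plane_edist[of y x] by auto
    then show "x = y" by (metis stereo_inj)
  next
    assume xy: "x = y"
    have "spherical_edist x x = 0"
    proof (cases x)
      case (Fin z)
      then show ?thesis using spherical_edist_Fin_le[of z z] by simp
    next
      case Infty
      have "spherical_edist Infty Infty \<le> 0"
      proof (rule ennreal_le_epsilon)
        fix e :: real assume e: "0 < e"
        define w where "w = complex_of_real (4 / e)"
        have w: "w \<noteq> 0" "2 / norm w = e / 2"
          using e by (auto simp: w_def norm_divide)
        have le: "spherical_edist (Fin w) Infty \<le> ennreal (e / 2)"
          using spherical_edist_Infty_le[OF w(1)] w(2) by simp
        have "spherical_edist Infty Infty \<le> spherical_edist Infty (Fin w) + spherical_edist (Fin w) Infty"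
          by (rule spherical_edist_triangle)
        also have "\<dots> \<le> ennreal (e / 2) + ennreal (e / 2)"
          using le by (intro add_mono) (simp_all add: spherical_edist_commute[of Infty])
        also have "\<dots> = 0 + ennreal e"
          using e by (simp flip: ennreal_plus)
        finally show "spherical_edist Infty Infty \<le> 0 + ennreal e" .
      qed
      then show ?thesis using Infty by simp
    qed
    then show "dist x y = 0"
      using xy by (simp add: dist_rsphere_def)
  qed
  show "dist x y \<le> dist x z + dist y z" for x y z :: rsphere
  proof -
    have "spherical_edist x y \<le> spherical_edist x z + spherical_edist y z"
      using spherical_edist_triangle[of x y z] by (simp add: spherical_edist_commute)
    then have "ennreal (dist x y) \<le> ennreal (dist x z) + ennreal (dist y z)"
      unfolding ennreal_dist .
    also have "\<dots> = ennreal (dist x z + dist y z)"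
      by (simp add: dist_rsphere_def)
    finally have "ennreal (dist x y) \<le> ennreal (dist x z + dist y z)" .
    moreover have "0 \<le> dist x z + dist y z" by (simp add: dist_rsphere_def)
    ultimately show ?thesis by (simp add: ennreal_le_iff)
  qed
qed

end

section \<open>Rational maps\<close>

text \<open>The extension of \<open>p / q\<close> to the sphere, for coprime \<open>p\<close> and \<open>q\<close> with \<open>q \<noteq> 0\<close>. If
  \<open>degree p < degree q\<close>, the coefficient of \<open>p\<close> in the last line is 0.\<close>

primrec quotient_map :: "complex poly \<Rightarrow> complex poly \<Rightarrow> rsphere \<Rightarrow> rsphere" where
  "quotient_map p q (Fin z) = (if poly q z = 0 then Infty else Fin (poly p z / poly q z))"
| "quotient_map p q Infty =
     (if degree p > degree q then Infty else Fin (coeff p (degree q) / lead_coeff q))"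

definition rational_map_of_degree :: "(rsphere \<Rightarrow> rsphere) \<Rightarrow> nat \<Rightarrow> bool" where
  "rational_map_of_degree g d \<longleftrightarrow>
     (\<exists>p q. coprime p q \<and> q \<noteq> 0 \<and> g = quotient_map p q \<and> d = max (degree p) (degree q))"

definition normal_family_on :: "rsphere set \<Rightarrow> (rsphere \<Rightarrow> rsphere) set \<Rightarrow> bool" where
  "normal_family_on U \<F> \<longleftrightarrow>
     (\<forall>f. range f \<subseteq> \<F> \<longrightarrow>
        (\<exists>(r :: nat \<Rightarrow> nat) h. strict_mono r \<and>
           (\<forall>K. compact K \<and> K \<subseteq> U \<longrightarrow> uniform_limit K (f \<circ> r) h sequentially)))"

definition fatou_set :: "(rsphere \<Rightarrow> rsphere) \<Rightarrow> rsphere set" where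
  "fatou_set g = {x. \<exists>U. open U \<and> x \<in> U \<and> normal_family_on U (range (\<lambda>n. g ^^ n))}"

definition julia_set :: "(rsphere \<Rightarrow> rsphere) \<Rightarrow> rsphere set" where
  "julia_set g = - fatou_set g"

definition critical_point :: "(rsphere \<Rightarrow> rsphere) \<Rightarrow> rsphere \<Rightarrow> bool" where
  "critical_point g c \<longleftrightarrow>
     \<not> (\<exists>U V h. open U \<and> c \<in> U \<and> open V \<and> homeomorphism U V g h)"

definition periodic_point :: "(rsphere \<Rightarrow> rsphere) \<Rightarrow> nat \<Rightarrow> rsphere \<Rightarrow> bool" where
  "periodic_point g k x \<longleftrightarrow>
     1 \<le> k \<and> (g ^^ k) x = x \<and> (\<forall>j. 1 \<le> j \<and> j < k \<longrightarrow> (g ^^ j) x \<noteq> x)"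

text \<open>The derivative of \<open>f\<close> at a fixed point, taken in the coordinate \<open>1 / z\<close> if that point
  is \<open>Infty\<close>.\<close>

definition fixed_point_derivative :: "(rsphere \<Rightarrow> rsphere) \<Rightarrow> rsphere \<Rightarrow> complex" where
  "fixed_point_derivative f x =
     (case x of
        Fin a \<Rightarrow> deriv (\<lambda>z. to_complex (f (Fin z))) a
      | Infty \<Rightarrow> deriv (\<lambda>z. to_complex (sphere_inversion (f (sphere_inversion (Fin z))))) 0)"

text \<open>All points of a cycle of period \<open>k\<close> have the same multiplier, so a cycle can be
  represented by any one of its points.\<close>

definition parabolic_point :: "(rsphere \<Rightarrow> rsphere) \<Rightarrow> rsphere \<Rightarrow> bool" where
  "parabolic_point g x \<longleftrightarrow>
     (\<exists>k. periodic_point g k x \<and> (\<exists>m\<ge>1. fixed_point_derivative (g ^^ k) x ^ m = 1))"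

definition semi_hyperbolic :: "(rsphere \<Rightarrow> rsphere) \<Rightarrow> bool" where
  "semi_hyperbolic g \<longleftrightarrow>
     (\<exists>d\<ge>2. rational_map_of_degree g d) \<and>
     (\<nexists>x. parabolic_point g x) \<and>
     (\<forall>c. critical_point g c \<and> c \<in> julia_set g \<longrightarrow> c \<notin> closure {(g ^^ n) c |n. n \<ge> 1})"

section \<open>Quasi-visual approximations\<close>

definition tile_neighborhood :: "'a set set \<Rightarrow> nat \<Rightarrow> 'a set \<Rightarrow> 'a set" where
  "tile_neighborhood \<X> w X =
     \<Union>{Y \<in> \<X>. \<exists>k\<le>w. \<exists>Z. Z 0 = X \<and> Z k = Y \<and> (\<forall>j\<le>k. Z j \<in> \<X>) \<and>
                (\<forall>j<k. Z j \<inter> Z (Suc j) \<noteq> {})}"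

text \<open>Covers may contain the empty set, and the infimum over the empty set is infinite. This
  is why the library's \<^const>\<open>setdist\<close>, which is 0 there, is not used.\<close>

definition tile_dist :: "'a::metric_space set \<Rightarrow> 'a set \<Rightarrow> ereal" where
  "tile_dist X Y = (INF x\<in>X. INF y\<in>Y. ereal (dist x y))"

definition comparable_diameters :: "real \<Rightarrow> 'a::metric_space set \<Rightarrow> 'a set \<Rightarrow> bool" where
  "comparable_diameters C X Y \<longleftrightarrow>
     diameter Y / C \<le> diameter X \<and> diameter X \<le> C * diameter Y"

text \<open>The metric on \<open>S\<close> is the restriction of the ambient one.\<close>

definition quasi_visual_approximation ::
    "'a::metric_space set \<Rightarrow> nat \<Rightarrow> (nat \<Rightarrow> 'a set set) \<Rightarrow> bool" where
  "quasi_visual_approximation S w \<X> \<longleftrightarrow>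
     bounded S \<and> (\<exists>x\<in>S. \<exists>y\<in>S. x \<noteq> y) \<and>
     (\<forall>n. \<Union>(\<X> n) = S) \<and> \<X> 0 = {S} \<and>
     (\<exists>(C::real) (l::nat) (r::real). C \<ge> 1 \<and> l \<ge> 1 \<and> 0 < r \<and> r < 1 \<and>
       (\<forall>n.
         (\<forall>X\<in>\<X> n. \<forall>Y\<in>\<X> n. X \<inter> Y \<noteq> {} \<longrightarrow> comparable_diameters C X Y) \<and>
         (\<forall>X\<in>\<X> n. \<forall>Y\<in>\<X> n.
            tile_neighborhood (\<X> n) w X \<inter> tile_neighborhood (\<X> n) w Y = {} \<longrightarrow>
            tile_dist X Y \<ge> ereal (diameter X / C)) \<and>
         (\<forall>X\<in>\<X> n. \<forall>Y\<in>\<X> (n + 1). X \<inter> Y \<noteq> {} \<longrightarrow> comparable_diameters C X Y) \<and>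
         (\<forall>X\<in>\<X> n. \<forall>Y\<in>\<X> (n + l). X \<inter> Y \<noteq> {} \<longrightarrow> diameter Y \<le> r * diameter X)))"

definition dynamical :: "(rsphere \<Rightarrow> rsphere) \<Rightarrow> (nat \<Rightarrow> rsphere set set) \<Rightarrow> bool" where
  "dynamical g \<X> \<longleftrightarrow> (\<forall>n\<ge>1. \<forall>X\<in>\<X> (n + 1). g ` X \<in> \<X> n)"

end

theory Submission
  imports Defs "HOL-Complex_Analysis.Complex_Analysis"
begin

text \<open>
  Let \<open>J\<close> be the Julia set and write \<open>r\<^sub>n(x)\<close> for the diameter of a tile of level \<open>n\<close> at \<open>x \<in> J\<close>.
  Tile diameters change by at most a bounded factor from one level to the next and decay
  geometrically. The iterate \<open>g\<^sup>k\<close> maps tiles of level \<open>n + k\<close> to tiles of level \<open>n \<ge> 1\<close>, and chains of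
  tiles to chains of tiles. Hence on \<open>J\<close> it maps points within about \<open>r\<^sub>n\<^sub>+\<^sub>k(x)\<close> of \<open>x\<close> to points within
  about \<open>r\<^sub>n(g\<^sup>k(x))\<close> of \<open>g\<^sup>k(x)\<close>.

  \<^bold>\<open>Parabolic cycles.\<close> Suppose that an iterate \<open>F\<close> of \<open>g\<close> fixes \<open>x\<close> with multiplier 1. Then
  \<open>x \<in> J\<close>: the first nonlinear coefficient of \<open>F\<^sup>n\<close> at \<open>x\<close> grows linearly in \<open>n\<close>, so the iterates are
  not equicontinuous there (\<open>multiplier_one_in_julia_set\<close>). On the other hand, \<open>F\<close> expands
  distances to \<open>x\<close> by a factor that is arbitrarily close to 1, while tiles at \<open>x\<close> shrink
  geometrically; so the images under \<open>F\<^sup>n\<close> of deep tiles at \<open>x\<close>, which are tiles of level 1, would be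
  arbitrarily small (\<open>no_fixed_point_with_multiplier_one\<close>).

  \<^bold>\<open>Critical points.\<close> Let \<open>c \<in> J\<close> be critical and let \<open>y = g\<^sup>k(c)\<close> be within about \<open>r\<^sub>n(c)\<close> of \<open>c\<close>. By total
  invariance of \<open>J\<close>, on the disc of radius comparable to \<open>r\<^sub>n\<^sub>+\<^sub>k(c)\<close> about \<open>c\<close>, the map \<open>g\<^sup>k\<close> omits all points
  of \<open>J\<close> whose distance from \<open>c\<close> is a large multiple of \<open>r\<^sub>n(c)\<close>. The tiles at \<open>c\<close> of a few levels before \<open>n\<close>
  supply three such points at mutual distances comparable to \<open>r\<^sub>n(c)\<close>. Schottky's theorem, applied after a
  Moebius map that sends these points to 0, 1 and infinity, and the Schwarz lemma for a function with a
  double zero give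
  \<open>|g\<^sup>k(z) - y| \<le> B r\<^sub>n(c) (|z - c| / r\<^sub>n\<^sub>+\<^sub>k(c))\<^sup>2\<close>
  in a chart, with \<open>B\<close> independent of \<open>n\<close> and \<open>k\<close> (\<open>omitting_three_values_bound\<close>,
  \<open>critical_return_estimate\<close>). For a tile at \<open>c\<close> of level \<open>n + m + k\<close> this yields, if \<open>y\<close> is also within
  about \<open>r\<^sub>n\<^sub>+\<^sub>m(c)\<close> of \<open>c\<close>,
  \<open>r\<^sub>n\<^sub>+\<^sub>m(c) / r\<^sub>n(c) \<le> A (r\<^sub>n\<^sub>+\<^sub>k\<^sub>+\<^sub>m(c) / r\<^sub>n\<^sub>+\<^sub>k(c))\<^sup>2\<close>
  (\<open>critical_diam_inequality\<close>). If \<open>c\<close> were recurrent, such a \<open>k\<close> would exist for every \<open>n\<close>. Fix \<open>m\<close> so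
  large that \<open>A r\<^sub>n\<^sub>+\<^sub>m(c) / r\<^sub>n(c) \<le> 1/2\<close> for all \<open>n\<close>; then iterating the inequality forces a positive number to
  be at most \<open>(1/2) ^ (2 ^ i)\<close> for all \<open>i\<close> (\<open>critical_point_not_recurrent\<close>).

  The point at infinity may lie in \<open>J\<close>, so everything local is done in one of the two charts \<open>z\<close> and
  \<open>1 / z\<close>. Iterates of \<open>g\<close> are handled globally in homogeneous coordinates, as quotients of two entire
  functions without common zeros.
\<close>

section \<open>Homogeneous coordinates and charts\<close>

text \<open>The point with homogeneous coordinates \<open>[u : v]\<close>. It is meaningful only for \<open>(u, v) \<noteq> (0, 0)\<close>.\<close>

definition proj :: "complex \<Rightarrow> complex \<Rightarrow> rsphere" where
  "proj u v = (if v = 0 then Infty else Fin (u / v))"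

primrec chart :: "bool \<Rightarrow> complex \<Rightarrow> rsphere" where
  "chart True z = Fin z"
| "chart False z = sphere_inversion (Fin z)"

primrec coord :: "bool \<Rightarrow> rsphere \<Rightarrow> complex" where
  "coord True x = to_complex x"
| "coord False x = to_complex (sphere_inversion x)"

text \<open>The point whose coordinate in the chart \<open>b\<close> is \<open>u / v\<close>; for \<open>v = 0\<close> it is the one point that this
  chart misses.\<close>

definition chart_proj :: "bool \<Rightarrow> complex \<Rightarrow> complex \<Rightarrow> rsphere" where
  "chart_proj b u v = (if b then proj u v else proj v u)"

lemma coord_chart [simp]: "coord b (chart b z) = z"
  by (cases b) auto

lemma chart_eq_iff [simp]: "chart b z = chart b w \<longleftrightarrow> z = w"
  by (metis coord_chart)

lemma chart_conv_proj: "chart b z = chart_proj b z 1"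
  by (cases b) (auto simp: chart_proj_def proj_def)

lemma chart_proj_eq_chart: "v \<noteq> 0 \<Longrightarrow> chart_proj b u v = chart b (u / v)"
  by (cases b) (auto simp: chart_proj_def proj_def)

lemma chart_proj_eq_chart_iff:
  assumes "u \<noteq> 0 \<or> v \<noteq> 0"
  shows "chart_proj b u v = chart b a \<longleftrightarrow> u = a * v"
  using assms by (cases b) (auto simp: chart_proj_def proj_def field_simps)

lemma chart_exists: obtains b z where "x = chart b z"
proof (cases x)
  case (Fin z)
  then show ?thesis using that[of True z] by simp
next
  case Infty
  then show ?thesis using that[of False 0] by simp
qed

lemma ennreal_dist_rsphere: "ennreal (dist x y) = spherical_edist x y"
  using spherical_edist_finite[of x y] by (simp add: dist_rsphere_def)

lemma continuous_on_chart_False: "continuous_on UNIV (chart False)"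
proof -
  have "isCont (chart False) z" for z
  proof (cases "z = 0")
    case True
    have "((\<lambda>z. Fin (inverse z)) \<longlongrightarrow> Infty) (at 0)"
      by (intro tendsto_Infty filterlim_inverse_at_infinity)
    moreover have "eventually (\<lambda>z. Fin (inverse z) = chart False z) (at 0)"
      by (auto simp: eventually_at_filter divide_inverse)
    ultimately have "(chart False \<longlongrightarrow> Infty) (at 0)"
      by (rule Lim_transform_eventually)
    then show ?thesis using True by (simp add: isCont_def)
  next
    case False
    have "continuous_on (- {0}) (\<lambda>z. Fin (1 / z))"
      by (intro continuous_intros) auto
    then have "continuous_on (- {0}) (chart False)"
      by (rule continuous_on_eq) auto
    then show ?thesis
      using False by (auto intro: continuous_on_interior simp: interior_open open_Compl)
  qed
  then show ?thesis by (metis continuous_at_imp_continuous_on)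
qed

declare chart.simps [simp del]

text \<open>The inversion preserves the spherical length element, so the image of a segment is at most twice as
  long as the segment. It is an admissible path: the segment meets 0, that is, its image meets
  \<^const>\<open>Infty\<close>, at no more than one parameter.\<close>

lemma spherical_edist_chart_False_le:
  "spherical_edist (chart False z) (chart False w) \<le> ennreal (2 * norm (w - z))"
proof (cases "z = w")
  case True
  then show ?thesis
    using ennreal_dist_rsphere[of "chart False w" "chart False w"] by simp
next
  case zw: False
  let ?\<gamma> = "\<lambda>t. chart False (linepath z w t)"
  define S where "S = {t. linepath z w t = 0}"
  have "s = t" if "linepath z w s = 0" "linepath z w t = 0" for s t
  proof -
    have "linepath z w s - linepath z w t = (s - t) *\<^sub>R (w - z)"
      by (simp add: linepath_def algebra_simps)
    then show ?thesis using that zw by simp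
  qed
  then have "S \<subseteq> {SOME t. linepath z w t = 0}"
    unfolding S_def by (auto intro: someI2)
  then have fin: "finite S" by (rule finite_subset) simp
  have opS: "open (- S)" using fin by (simp add: finite_imp_closed open_Compl)
  have lder: "(linepath z w has_vector_derivative (w - z)) (at t)" for t
    by (rule has_vector_derivative_linepath_within)
  have der: "((\<lambda>t. to_complex (?\<gamma> t)) has_vector_derivative (z - w) / (linepath z w t)\<^sup>2) (at t)"
    if t: "t \<in> - S" for t
  proof (rule has_vector_derivative_transform_within_open[OF _ opS t])
    have "((\<lambda>x. inverse x) has_field_derivative - (inverse (linepath z w t) ^ Suc (Suc 0))) (at (linepath z w t))"
      using t by (intro DERIV_inverse) (auto simp: S_def)
    note 1 = field_vector_diff_chain_at[OF lder this]
    have 2: "(w - z) * - (inverse (linepath z w t) ^ Suc (Suc 0)) = (z - w) / (linepath z w t)\<^sup>2"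
      by (simp add: power2_eq_square divide_inverse algebra_simps)
    show "((\<lambda>t. inverse (linepath z w t)) has_vector_derivative (z - w) / (linepath z w t)\<^sup>2) (at t)"
      using 1 unfolding 2 o_def .
  qed (auto simp: S_def divide_inverse chart.simps)
  have "(\<lambda>t. to_complex (?\<gamma> t)) C1_differentiable_on ({0..1} - S)"
    unfolding C1_differentiable_on_def
  proof (intro exI conjI ballI)
    show "continuous_on ({0..1} - S) (\<lambda>t. (z - w) / (linepath z w t)\<^sup>2)"
      by (intro continuous_intros) (auto simp: S_def)
    show "((\<lambda>t. to_complex (?\<gamma> t)) has_vector_derivative (z - w) / (linepath z w t)\<^sup>2) (at t)"
      if "t \<in> {0..1} - S" for t
      using that by (intro der) auto
  qed
  moreover have "continuous_on {0..1} ?\<gamma>"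
    by (rule continuous_on_compose2[OF continuous_on_chart_False]) (auto intro: continuous_intros)
  moreover have "Infty \<notin> ?\<gamma> ` ({0..1} - S)"
    by (auto simp: S_def chart.simps)
  ultimately have \<gamma>: "spherical_path (chart False z) (chart False w) ?\<gamma>"
    using fin unfolding spherical_path_def path_def pathstart_def pathfinish_def
    by (intro conjI exI[of _ S]) (auto simp: linepath_def)
  have speed: "spherical_speed ?\<gamma> t \<le> 2 * norm (w - z)" if t: "t \<in> - S" for t
  proof -
    define a where "a = norm (linepath z w t)"
    have a: "0 < a" using t by (auto simp: a_def S_def)
    have "spherical_speed ?\<gamma> t = 2 * (norm (w - z) / a\<^sup>2) / (1 + (1 / a)\<^sup>2)"
      unfolding spherical_speed_def vector_derivative_at[OF der[OF t]]
      using t by (auto simp: a_def S_def norm_divide norm_power norm_minus_commute chart.simps)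
    also have "\<dots> = 2 * norm (w - z) / (a\<^sup>2 + 1)"
      using a by (simp add: field_simps)
    also have "\<dots> \<le> 2 * norm (w - z) / 1"
      using a by (intro divide_left_mono) (auto simp: add_pos_pos)
    finally show ?thesis by simp
  qed
  have "spherical_length ?\<gamma> \<le> (\<integral>\<^sup>+t\<in>{0..1::real}. ennreal (2 * norm (w - z)) \<partial>lborel)"
    unfolding spherical_length_def
  proof (intro nn_integral_mono_AE AE_I'[where N = S])
    show "S \<in> null_sets (lborel :: real measure)" using fin by (simp add: finite_imp_null_set_lborel)
    show "{t \<in> space lborel. \<not> ennreal (spherical_speed ?\<gamma> t) * indicator {0..1} t \<le>
        ennreal (2 * norm (w - z)) * indicator {0..1} t} \<subseteq> S"
      using speed by (auto intro!: mult_right_mono ennreal_leI)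
  qed
  also have "\<dots> = ennreal (2 * norm (w - z))"
    by (simp add: nn_integral_cmult_indicator)
  finally show ?thesis
    unfolding spherical_edist_def using \<gamma> by (intro INF_lower2[of ?\<gamma>]) auto
qed

lemma dist_chart_le: "dist (chart b z) (chart b w) \<le> 2 * norm (z - w)"
proof -
  have "spherical_edist (chart b z) (chart b w) \<le> ennreal (2 * norm (z - w))"
    using spherical_edist_Fin_le[of z w] spherical_edist_chart_False_le[of z w]
    by (cases b) (simp_all only: chart.simps norm_minus_commute)
  then show ?thesis
    unfolding ennreal_dist_rsphere[symmetric] by (simp add: ennreal_le_iff)
qed

lemma continuous_on_chart [continuous_intros]:
  "continuous_on A f \<Longrightarrow> continuous_on A (\<lambda>x. chart b (f x))"
proof -
  have "continuous_on UNIV (chart b)"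
    unfolding continuous_on_iff
  proof (intro ballI allI impI)
    fix z :: complex and e :: real assume "e > 0"
    then show "\<exists>d>0. \<forall>w\<in>UNIV. dist w z < d \<longrightarrow> dist (chart b w) (chart b z) < e"
      by (intro exI[of _ "e / 2"]) (auto simp: dist_norm intro!: le_less_trans[OF dist_chart_le])
  qed
  then show "continuous_on A f \<Longrightarrow> continuous_on A (\<lambda>x. chart b (f x))"
    by (rule continuous_on_compose2) auto
qed

text \<open>The stereographic coordinates are Lipschitz for the spherical metric, and the coordinate of a point
  in a chart is a quotient of them whose denominator stays away from 0 near the base point.\<close>

lemma chart_local_inverse:
  obtains \<delta> K where "0 < \<delta>" "1 \<le> K"
    "\<And>v. dist v (chart b z0) < \<delta> \<Longrightarrow> \<exists>z. v = chart b z \<and> norm (z - z0) \<le> K * dist v (chart b z0)"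
proof -
  (* Adapted to the chart b: hgt is 1 / (1 + |z|^2) and pl is z / (1 + |z|^2) at the point with coordinate z. *)
  define hgt where "hgt = (\<lambda>v. if b then stereo_height v else 1 - stereo_height v)"
  define pl where "pl = (\<lambda>v. if b then stereo_plane v else cnj (stereo_plane v))"
  have inv: "1 / (1 + (norm (1 / z))\<^sup>2) = (norm z)\<^sup>2 / (1 + (norm z)\<^sup>2)" if "z \<noteq> 0" for z :: complex
  proof -
    have pos: "0 < (norm z)\<^sup>2" using that by simp
    have "1 + (norm (1 / z))\<^sup>2 = (1 + (norm z)\<^sup>2) / (norm z)\<^sup>2"
      using pos by (simp add: norm_divide power_divide add_divide_distrib)
    then show ?thesis by simp
  qed
  have hc: "hgt (chart b z) = 1 / (1 + (norm z)\<^sup>2)" for z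
  proof (cases "b \<or> z = 0")
    case False
    have "1 - (norm z)\<^sup>2 / (1 + (norm z)\<^sup>2) = 1 / (1 + (norm z)\<^sup>2)"
      using one_plus_norm_sq_pos[of z] by (metis add_diff_cancel_right' diff_divide_distrib divide_self less_irrefl)
    then show ?thesis using False inv[of z] by (simp add: hgt_def chart.simps)
  qed (auto simp: hgt_def chart.simps)
  have pc: "pl (chart b z) = hgt (chart b z) *\<^sub>R z" for z
  proof (cases "b \<or> z = 0")
    case False
    have pos: "0 < (norm z)\<^sup>2" using False by simp
    have "z * cnj z = of_real ((norm z)\<^sup>2)"
      by (rule complex_norm_square[symmetric])
    then have "cnj (1 / z) = (1 / (norm z)\<^sup>2) *\<^sub>R z"
      using False pos by (simp add: scaleR_conv_of_real field_simps)
    then have "(1 / (1 + (norm (1 / z))\<^sup>2)) *\<^sub>R cnj (1 / z) = (1 / (1 + (norm z)\<^sup>2)) *\<^sub>R z"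
      using False pos inv[of z] by simp
    then show ?thesis
      using False unfolding hc by (simp add: pl_def chart.simps)
  qed (auto simp: pl_def hgt_def chart.simps)
  have dh: "\<bar>hgt v - hgt x\<bar> \<le> dist v x" for v x
    using stereo_height_edist[of v x] unfolding ennreal_dist_rsphere[symmetric]
    by (auto simp: hgt_def dist_commute abs_minus_commute)
  have dp: "norm (pl v - pl x) \<le> 2 * dist v x" for v x
  proof -
    have "ennreal (norm (stereo_plane v - stereo_plane x)) \<le> ennreal (2 * dist v x)"
      using stereo_plane_edist[of v x] unfolding ennreal_dist_rsphere[symmetric]
      by (simp add: dist_commute ennreal_mult')
    then have "norm (stereo_plane v - stereo_plane x) \<le> 2 * dist v x"
      by (simp add: ennreal_le_iff)
    moreover have "norm (cnj (stereo_plane v) - cnj (stereo_plane x)) = norm (stereo_plane v - stereo_plane x)"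
      by (metis complex_cnj_diff complex_mod_cnj)
    ultimately show ?thesis by (simp add: pl_def)
  qed
  define h0 where "h0 = hgt (chart b z0)"
  have h0: "0 < h0" "h0 \<le> 1"
    using one_plus_norm_sq_pos[of z0] by (auto simp: h0_def hc divide_simps)
  show ?thesis
  proof (rule that[of "h0 / 2" "2 * (2 + norm z0) / h0"])
    show "0 < h0 / 2" using h0 by simp
    show "1 \<le> 2 * (2 + norm z0) / h0" using h0 order.trans[OF h0(2), of "2 * (2 + norm z0)"] by (simp add: add_increasing2)
  next
    fix v assume v: "dist v (chart b z0) < h0 / 2"
    have hv: "hgt v > h0 / 2"
      using dh[of v "chart b z0"] v h0 unfolding h0_def by linarith
    have "\<exists>z. v = chart b z"
    proof (cases b)
      case True
      then show ?thesis using hv h0 by (cases v) (auto simp: hgt_def chart.simps)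
    next
      case b: False
      show ?thesis
      proof (cases v)
        case (Fin u)
        then have "u \<noteq> 0" using hv h0 b by (auto simp: hgt_def)
        then show ?thesis using Fin b by (intro exI[of _ "1 / u"]) (simp add: chart.simps)
      next
        case Infty
        then show ?thesis using b by (intro exI[of _ 0]) (simp add: chart.simps)
      qed
    qed
    then obtain z where z: "v = chart b z" by blast
    let ?d = "dist v (chart b z0)"
    have "hgt v *\<^sub>R (z - z0) = (pl v - pl (chart b z0)) - (hgt v - h0) *\<^sub>R z0"
      unfolding z pc h0_def by (simp add: algebra_simps)
    then have "norm (hgt v *\<^sub>R (z - z0)) \<le> norm (pl v - pl (chart b z0)) + norm ((hgt v - h0) *\<^sub>R z0)"
      by (metis norm_triangle_ineq4)
    also have "\<dots> \<le> 2 * ?d + ?d * norm z0"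
      using dp[of v "chart b z0"] dh[of v "chart b z0"] unfolding h0_def
      by (auto intro!: add_mono mult_right_mono)
    finally have "hgt v * norm (z - z0) \<le> (2 + norm z0) * ?d"
      unfolding norm_scaleR using hv h0 by (simp add: algebra_simps)
    moreover have "h0 / 2 * norm (z - z0) \<le> hgt v * norm (z - z0)"
      using hv by (intro mult_right_mono) auto
    ultimately have "norm (z - z0) \<le> 2 * (2 + norm z0) / h0 * ?d"
      using h0 by (simp add: field_simps)
    with z show "\<exists>z. v = chart b z \<and> norm (z - z0) \<le> 2 * (2 + norm z0) / h0 * ?d"
      by blast
  qed
qed

lemma open_chart_image:
  assumes "open A"
  shows "open (chart b ` A)"
  unfolding open_dist
proof
  fix x assume "x \<in> chart b ` A"
  then obtain z0 where z0: "z0 \<in> A" "x = chart b z0" by blast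
  obtain e where e: "e > 0" "\<And>z. dist z z0 < e \<Longrightarrow> z \<in> A"
    using assms z0(1) unfolding open_dist by blast
  obtain \<delta> K where dK: "0 < \<delta>" "1 \<le> K"
    "\<And>v. dist v x < \<delta> \<Longrightarrow> \<exists>z. v = chart b z \<and> norm (z - z0) \<le> K * dist v x"
    using chart_local_inverse[of b z0] z0(2) by metis
  show "\<exists>e>0. \<forall>y. dist y x < e \<longrightarrow> y \<in> chart b ` A"
  proof (intro exI conjI allI impI)
    show "0 < min \<delta> (e / K)" using dK e by simp
    fix y assume y: "dist y x < min \<delta> (e / K)"
    then obtain z where z: "y = chart b z" "norm (z - z0) \<le> K * dist y x"
      using dK(3) by auto
    have "K * dist y x < e" using y dK(2) by (simp add: field_simps)
    then show "y \<in> chart b ` A" using z e(2) by (auto simp: dist_norm)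
  qed
qed

lemma continuous_on_proj:
  assumes "continuous_on A P" "continuous_on A Q" "\<And>z. z \<in> A \<Longrightarrow> P z \<noteq> 0 \<or> Q z \<noteq> 0"
  shows "continuous_on (A :: complex set) (\<lambda>z. proj (P z) (Q z))"
  unfolding continuous_on_def
proof
  fix z assume z: "z \<in> A"
  have PQ: "(P \<longlongrightarrow> P z) (at z within A)" "(Q \<longlongrightarrow> Q z) (at z within A)"
    using assms(1,2) z by (auto simp: continuous_on_def)
  have ch: "((\<lambda>w. chart b (f w)) \<longlongrightarrow> chart b l) (at z within A)" if "(f \<longlongrightarrow> l) (at z within A)" for b f l
  proof -
    have "isCont (chart b) l"
      using continuous_on_chart[OF continuous_on_id, of UNIV b] by (simp add: continuous_on_eq_continuous_at)
    then show ?thesis using that by (rule isCont_tendsto_compose)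
  qed
  have *: "((\<lambda>w. chart_proj b (f w) (g w)) \<longlongrightarrow> chart_proj b (f z) (g z)) (at z within A)"
    if f: "(f \<longlongrightarrow> f z) (at z within A)" and g: "(g \<longlongrightarrow> g z) (at z within A)" and n: "g z \<noteq> 0" for b f g
  proof -
    have "((\<lambda>w. chart b (f w / g w)) \<longlongrightarrow> chart b (f z / g z)) (at z within A)"
      by (intro ch tendsto_divide f g n)
    moreover have "eventually (\<lambda>w. chart b (f w / g w) = chart_proj b (f w) (g w)) (at z within A)"
      using tendsto_imp_eventually_ne[OF g n] by eventually_elim (simp add: chart_proj_eq_chart)
    ultimately show ?thesis
      unfolding chart_proj_eq_chart[OF n] by (rule Lim_transform_eventually)
  qed
  show "((\<lambda>z. proj (P z) (Q z)) \<longlongrightarrow> proj (P z) (Q z)) (at z within A)"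
    using assms(3)[OF z] *[OF PQ, of True] *[OF PQ(2,1), of False] unfolding chart_proj_def by auto
qed

section \<open>Rational maps in homogeneous coordinates\<close>

definition homogenize :: "nat \<Rightarrow> complex poly \<Rightarrow> complex \<Rightarrow> complex \<Rightarrow> complex" where
  "homogenize d p u v = (\<Sum>i\<le>d. coeff p i * u ^ i * v ^ (d - i))"

lemma homogenize_eq:
  assumes "degree p \<le> d" "v \<noteq> 0"
  shows "homogenize d p u v = v ^ d * poly p (u / v)"
proof -
  have "poly p (u / v) = (\<Sum>i\<le>d. coeff p i * (u / v) ^ i)"
    unfolding poly_altdef using assms(1)
    by (intro sum.mono_neutral_left) (auto simp: coeff_eq_0)
  moreover have *: "coeff p i * u ^ i * v ^ (d - i) = v ^ d * (coeff p i * (u / v) ^ i)" if "i \<le> d" for i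
    using that assms(2) power_add[of v i "d - i"] by (simp add: field_simps)
  moreover have "homogenize d p u v = (\<Sum>i\<le>d. v ^ d * (coeff p i * (u / v) ^ i))"
    unfolding homogenize_def by (rule sum.cong[OF refl]) (simp only: * atMost_iff)
  ultimately show ?thesis by (simp only: sum_distrib_left)
qed

lemma homogenize_0: "homogenize d p u 0 = coeff p d * u ^ d"
proof -
  have "homogenize d p u 0 = (\<Sum>i\<in>{d}. coeff p i * u ^ i * 0 ^ (d - i))"
    unfolding homogenize_def by (intro sum.mono_neutral_right) auto
  then show ?thesis by simp
qed

lemma quotient_map_proj:
  assumes "coprime p q" "q \<noteq> 0" "d = max (degree p) (degree q)" "u \<noteq> 0 \<or> v \<noteq> 0"
  shows "quotient_map p q (proj u v) = proj (homogenize d p u v) (homogenize d q u v)"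
    "homogenize d p u v \<noteq> 0 \<or> homogenize d q u v \<noteq> 0"
proof -
  have "quotient_map p q (proj u v) = proj (homogenize d p u v) (homogenize d q u v) \<and>
    (homogenize d p u v \<noteq> 0 \<or> homogenize d q u v \<noteq> 0)"
  proof (cases "v = 0")
    case False
    have "poly p (u / v) \<noteq> 0 \<or> poly q (u / v) \<noteq> 0"
      using coprime_poly_0[OF assms(1)] by blast
    then show ?thesis
      using False assms(3) by (auto simp: homogenize_eq proj_def)
  next
    case True
    then have u: "u \<noteq> 0" using assms(4) by simp
    show ?thesis
    proof (cases "degree p > degree q")
      case True
      then have "coeff q d = 0" "coeff p d \<noteq> 0"
        using assms(3) by (auto simp: coeff_eq_0)
      then show ?thesis using True \<open>v = 0\<close> u by (simp add: homogenize_0 proj_def)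
    next
      case False
      then have "d = degree q" using assms(3) by simp
      then show ?thesis using False \<open>v = 0\<close> u assms(2) by (simp add: homogenize_0 proj_def)
    qed
  qed
  then show "quotient_map p q (proj u v) = proj (homogenize d p u v) (homogenize d q u v)"
    "homogenize d p u v \<noteq> 0 \<or> homogenize d q u v \<noteq> 0" by auto
qed

text \<open>Homogenised numerator and denominator have no common zero apart from the origin, so they can be
  composed without ever dividing. This makes iterates accessible that pass through \<^const>\<open>Infty\<close>.\<close>

lemma rational_map_iterate_chart:
  assumes g: "rational_map_of_degree g d"
  obtains P Q where "P holomorphic_on UNIV" "Q holomorphic_on UNIV"
    "\<And>z. P z \<noteq> 0 \<or> Q z \<noteq> 0" "\<And>z. (g ^^ k) (chart b z) = chart_proj b' (P z) (Q z)"
proof -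
  obtain p q where pq: "coprime p q" "q \<noteq> 0" "g = quotient_map p q" "d = max (degree p) (degree q)"
    using g unfolding rational_map_of_degree_def by blast
  have "\<exists>P Q. P holomorphic_on UNIV \<and> Q holomorphic_on UNIV \<and>
    (\<forall>z. P z \<noteq> 0 \<or> Q z \<noteq> 0) \<and> (\<forall>z. (g ^^ k) (chart b z) = proj (P z) (Q z))"
  proof (induction k)
    case 0
    show ?case
    proof (cases b)
      case True
      then show ?thesis
        by (intro exI[of _ "\<lambda>z. z"] exI[of _ "\<lambda>_. 1"])
           (auto simp: chart_conv_proj chart_proj_def intro!: holomorphic_intros)
    next
      case False
      then show ?thesis
        by (intro exI[where x = "\<lambda>_. 1"] exI[where x = "\<lambda>z. z"])
           (auto simp: chart_conv_proj chart_proj_def intro!: holomorphic_intros)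
    qed
  next
    case (Suc k)
    then obtain P Q where PQ: "P holomorphic_on UNIV" "Q holomorphic_on UNIV"
      "\<And>z. P z \<noteq> 0 \<or> Q z \<noteq> 0" "\<And>z. (g ^^ k) (chart b z) = proj (P z) (Q z)" by blast
    have hol: "(\<lambda>z. homogenize d r (P z) (Q z)) holomorphic_on UNIV" for r
      unfolding homogenize_def by (intro holomorphic_intros PQ)
    show ?case
    proof (intro exI conjI allI)
      show "(\<lambda>z. homogenize d p (P z) (Q z)) holomorphic_on UNIV"
        "(\<lambda>z. homogenize d q (P z) (Q z)) holomorphic_on UNIV" by (rule hol)+
      fix z
      show "homogenize d p (P z) (Q z) \<noteq> 0 \<or> homogenize d q (P z) (Q z) \<noteq> 0"
        by (rule quotient_map_proj(2)[OF pq(1,2,4) PQ(3)])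
      show "(g ^^ Suc k) (chart b z) = proj (homogenize d p (P z) (Q z)) (homogenize d q (P z) (Q z))"
        using quotient_map_proj(1)[OF pq(1,2,4) PQ(3)] PQ(4) by (simp add: pq(3))
    qed
  qed
  then obtain P Q where "P holomorphic_on UNIV" "Q holomorphic_on UNIV"
    "\<And>z. P z \<noteq> 0 \<or> Q z \<noteq> 0" "\<And>z. (g ^^ k) (chart b z) = proj (P z) (Q z)" by blast
  then show ?thesis
    using that[of P Q] that[of Q P] by (cases b') (auto simp: chart_proj_def)
qed

lemma rational_map_iterate_continuous:
  assumes g: "rational_map_of_degree g d"
  shows "continuous_on UNIV (g ^^ k)"
proof -
  have "isCont (g ^^ k) x" for x
  proof -
    obtain b z0 where x: "x = chart b z0" by (rule chart_exists)
    obtain P Q where PQ: "P holomorphic_on UNIV" "Q holomorphic_on UNIV"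
      "\<And>z. P z \<noteq> 0 \<or> Q z \<noteq> 0" "\<And>z. (g ^^ k) (chart b z) = chart_proj True (P z) (Q z)"
      using rational_map_iterate_chart[OF g] by metis
    have c: "continuous_on UNIV (\<lambda>z. (g ^^ k) (chart b z))"
      unfolding PQ(4) chart_proj_def
      using PQ by (auto intro!: continuous_on_proj holomorphic_on_imp_continuous_on)
    obtain \<delta> K where dK: "0 < \<delta>" "1 \<le> K"
      "\<And>v. dist v x < \<delta> \<Longrightarrow> \<exists>z. v = chart b z \<and> norm (z - z0) \<le> K * dist v x"
      using chart_local_inverse[of b z0] x by metis
    show ?thesis
      unfolding continuous_at_eps_delta
    proof (intro allI impI)
      fix e :: real assume "e > 0"
      then obtain s where s: "s > 0" "\<And>z. dist z z0 < s \<Longrightarrow> dist ((g ^^ k) (chart b z)) ((g ^^ k) x) < e"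
        using c x unfolding continuous_on_iff by (metis UNIV_I)
      show "\<exists>d>0. \<forall>v. dist v x < d \<longrightarrow> dist ((g ^^ k) v) ((g ^^ k) x) < e"
      proof (intro exI conjI allI impI)
        show "0 < min \<delta> (s / K)" using dK s by simp
        fix v assume v: "dist v x < min \<delta> (s / K)"
        then obtain z where z: "v = chart b z" "norm (z - z0) \<le> K * dist v x"
          using dK(3) by auto
        have "K * dist v x < s" using v dK(2) by (simp add: field_simps)
        then show "dist ((g ^^ k) v) ((g ^^ k) x) < e" using z s(2) by (auto simp: dist_norm)
      qed
    qed
  qed
  then show ?thesis by (metis continuous_at_imp_continuous_on)
qed

lemma rational_map_continuous:
  assumes g: "rational_map_of_degree g d"
  shows "continuous_on UNIV g"
  using rational_map_iterate_continuous[OF g, of 1] by simp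

lemma rational_map_local_holomorphic:
  assumes g: "rational_map_of_degree g d" and x: "(g ^^ k) (chart b z0) = chart b' w0"
  obtains s where "s > 0" "(\<lambda>z. coord b' ((g ^^ k) (chart b z))) holomorphic_on ball z0 s"
    "\<And>z. z \<in> ball z0 s \<Longrightarrow> (g ^^ k) (chart b z) = chart b' (coord b' ((g ^^ k) (chart b z)))"
proof -
  obtain P Q where PQ: "P holomorphic_on UNIV" "Q holomorphic_on UNIV"
    "\<And>z. P z \<noteq> 0 \<or> Q z \<noteq> 0" "\<And>z. (g ^^ k) (chart b z) = chart_proj b' (P z) (Q z)"
    using rational_map_iterate_chart[OF g] by metis
  have "Q z0 \<noteq> 0"
    using x chart_proj_eq_chart_iff[OF PQ(3)] PQ(3) unfolding PQ(4) by (metis mult_zero_right)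
  moreover have "continuous_on UNIV Q" using PQ(2) by (rule holomorphic_on_imp_continuous_on)
  ultimately obtain s where s: "s > 0" "\<And>z. z \<in> ball z0 s \<Longrightarrow> Q z \<noteq> 0"
    using continuous_on_open_avoid[of UNIV Q z0 0] by (auto simp: dist_commute)
  have eq: "(g ^^ k) (chart b z) = chart b' (P z / Q z)" if "z \<in> ball z0 s" for z
    unfolding PQ(4) using s(2)[OF that] by (rule chart_proj_eq_chart)
  have "(\<lambda>z. P z / Q z) holomorphic_on ball z0 s"
    using PQ(1,2) s(2) by (intro holomorphic_intros) (auto intro: holomorphic_on_subset)
  then have "(\<lambda>z. coord b' ((g ^^ k) (chart b z))) holomorphic_on ball z0 s"
    by (rule holomorphic_transform) (simp add: eq)
  then show ?thesis using that[of s] s(1) eq by simp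
qed

text \<open>Infinitely many solutions of \<open>p = w * q\<close> make it an identity of polynomials, and coprimality then forces
  \<open>p\<close> and \<open>q\<close> to be constant.\<close>

lemma rational_map_not_locally_constant:
  assumes g: "rational_map_of_degree g d" and d: "d \<ge> 1" and s: "s > 0"
  shows "\<exists>z\<in>ball z0 s. g (chart b z) \<noteq> y"
proof (rule ccontr)
  assume "\<not> ?thesis"
  then have const: "\<And>z. z \<in> ball z0 s \<Longrightarrow> g (chart b z) = y" by blast
  obtain p q where pq: "coprime p q" "q \<noteq> 0" "g = quotient_map p q" "d = max (degree p) (degree q)"
    using g unfolding rational_map_of_degree_def by blast
  have inf: "infinite (ball z0 s - {0})"
    using s uncountable_ball[of s z0] countable_finite by auto
  (* An infinite set of finite points on which p / q is constant. *)
  define Z where "Z = (if b then ball z0 s - {0} else inverse ` (ball z0 s - {0}))"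
  have "infinite Z"
    unfolding Z_def using inf finite_imageD[of inverse "ball z0 s - {0}"] by (auto simp: inj_on_def)
  have Z: "quotient_map p q (Fin z) = y" if z: "z \<in> Z" for z
  proof (cases b)
    case True
    then show ?thesis using z const[of z] by (auto simp: Z_def pq(3) chart.simps)
  next
    case False
    then obtain x where x: "z = inverse x" "x \<in> ball z0 s" "x \<noteq> 0"
      using z unfolding Z_def by (metis (no_types, lifting) DiffE imageE singletonI)
    then show ?thesis using False const[of x] by (simp add: pq(3) chart.simps divide_inverse)
  qed
  have zero: "r = 0" if "\<And>z. z \<in> Z \<Longrightarrow> poly r z = 0" for r :: "complex poly"
    using that \<open>infinite Z\<close> poly_roots_finite[of r] by (metis (mono_tags, lifting) finite_subset mem_Collect_eq subsetI)
  have "d = 0"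
  proof (cases y)
    case Infty
    then have "q = 0" by (intro zero) (use Z in \<open>fastforce split: if_splits\<close>)
    then show ?thesis using pq(2) by simp
  next
    case (Fin w)
    have "poly (p - smult w q) z = 0" if "z \<in> Z" for z
      using Z[OF that] Fin by (auto split: if_splits simp: field_simps)
    then have "p - smult w q = 0" by (rule zero)
    then have p: "p = smult w q" by simp
    then have "q dvd p" by (simp add: dvd_smult)
    then have "is_unit q" using pq(1) by (metis coprime_common_divisor dvd_refl)
    then have "degree q = 0" using is_unit_iff_degree[OF pq(2)] by simp
    then show ?thesis using p pq(4) by (simp add: degree_smult_le)
  qed
  then show False using d by simp
qed

lemma rational_map_open:
  assumes g: "rational_map_of_degree g d" and d: "d \<ge> 1" and U: "open U"
  shows "open (g ` U)"
  unfolding open_subopen[of "g ` U"]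
proof
  fix y assume "y \<in> g ` U"
  then obtain x where x: "x \<in> U" "y = g x" by blast
  obtain b z0 where z0: "x = chart b z0" by (rule chart_exists)
  obtain b' w0 where w0: "y = chart b' w0" by (rule chart_exists)
  define L where "L = (\<lambda>z. coord b' (g (chart b z)))"
  obtain s where s: "s > 0" "L holomorphic_on ball z0 s"
    "\<And>z. z \<in> ball z0 s \<Longrightarrow> g (chart b z) = chart b' (L z)"
    using rational_map_local_holomorphic[OF g, of 1 b z0 b' w0] x z0 w0 unfolding L_def by auto
  have "open (chart b -` U)"
    using continuous_on_chart[OF continuous_on_id, of UNIV b] U by (simp add: continuous_on_open_vimage)
  then obtain t where t: "t > 0" "ball z0 t \<subseteq> chart b -` U"
    using x z0 open_contains_ball by (metis vimageI)
  define r where "r = min s t"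
  have r: "r > 0" "ball z0 r \<subseteq> ball z0 s" "ball z0 r \<subseteq> chart b -` U"
    using s t by (auto simp: r_def)
  have "\<not> L constant_on ball z0 r"
  proof
    assume "L constant_on ball z0 r"
    then obtain a where "\<And>z. z \<in> ball z0 r \<Longrightarrow> L z = a" unfolding constant_on_def by blast
    then have "\<And>z. z \<in> ball z0 r \<Longrightarrow> g (chart b z) = chart b' a" using s(3) r(2) by auto
    then show False using rational_map_not_locally_constant[OF g d r(1)] by blast
  qed
  then have "open (L ` ball z0 r)"
    by (intro open_mapping_thm[of L "ball z0 r"]) (use s r in \<open>auto intro: holomorphic_on_subset\<close>)
  then have "open (chart b' ` L ` ball z0 r)" by (rule open_chart_image)
  moreover have "chart b' ` L ` ball z0 r = (\<lambda>z. g (chart b z)) ` ball z0 r"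
    unfolding image_image by (rule image_cong) (use s(3) r(2) in auto)
  ultimately show "\<exists>T. open T \<and> y \<in> T \<and> T \<subseteq> g ` U"
    using r x z0 by (intro exI[of _ "(\<lambda>z. g (chart b z)) ` ball z0 r"]) auto
qed

section \<open>Two estimates from complex analysis\<close>

text \<open>The Schwarz lemma for a zero of order \<open>m\<close>: the quotient \<open>D z / (z - z0) ^ m\<close> has a removable
  singularity, and the maximum principle on discs that exhaust the ball bounds it.\<close>

lemma Schwarz_bound_of_order:
  fixes D :: "complex \<Rightarrow> complex"
  assumes hol: "D holomorphic_on ball z0 \<delta>" and bd: "\<And>z. z \<in> ball z0 \<delta> \<Longrightarrow> norm (D z) \<le> B"
    and lim: "((\<lambda>z. D z / (z - z0) ^ m) \<longlongrightarrow> L) (at z0)" and \<delta>: "\<delta> > 0"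
  shows "norm L \<le> B / \<delta> ^ m"
    and "\<And>z. z \<in> ball z0 \<delta> \<Longrightarrow> z \<noteq> z0 \<Longrightarrow> norm (D z) \<le> B * (norm (z - z0) / \<delta>) ^ m"
proof -
  define E where "E = (\<lambda>z. if z = z0 then L else D z / (z - z0) ^ m)"
  have E: "E holomorphic_on ball z0 \<delta>"
  proof (rule no_isolated_singularity'[where K = "{z0}"])
    show "E holomorphic_on ball z0 \<delta> - {z0}"
    proof (rule holomorphic_transform)
      show "(\<lambda>z. D z / (z - z0) ^ m) holomorphic_on ball z0 \<delta> - {z0}"
        by (intro holomorphic_intros holomorphic_on_subset[OF hol]) auto
    qed (auto simp: E_def)
    fix z assume "z \<in> {z0}"
    moreover have "(E \<longlongrightarrow> L) (at z0)"
      by (rule Lim_transform_eventually[OF lim]) (auto simp: eventually_at_filter E_def)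
    ultimately show "(E \<longlongrightarrow> E z) (at z within ball z0 \<delta>)"
      by (auto simp: E_def intro: tendsto_within_subset)
  qed auto
  have Ebd: "norm (E z) \<le> B / \<delta> ^ m" if z: "z \<in> ball z0 \<delta>" for z
  proof (rule tendsto_lowerbound)
    show "((\<lambda>t. B / t ^ m) \<longlongrightarrow> B / \<delta> ^ m) (at_left \<delta>)"
      using \<delta> by (intro tendsto_intros) auto
    have "max 0 (dist z0 z) < \<delta>" using z \<delta> by auto
    then have "eventually (\<lambda>t. t \<in> {max 0 (dist z0 z)<..<\<delta>}) (at_left \<delta>)"
      by (intro eventually_at_leftI[of "max 0 (dist z0 z)"]) auto
    then show "eventually (\<lambda>t. norm (E z) \<le> B / t ^ m) (at_left \<delta>)"
    proof eventually_elim
      case (elim t)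
      then have t: "0 < t" "t < \<delta>" "dist z0 z < t" using zero_le_dist[of z0 z] by (auto simp del: zero_le_dist)
      show ?case
      proof (rule maximum_modulus_frontier[of E "cball z0 t"])
        show "E holomorphic_on interior (cball z0 t)"
          using t by (intro holomorphic_on_subset[OF E]) auto
        show "continuous_on (closure (cball z0 t)) E"
          using t by (intro continuous_on_subset[OF holomorphic_on_imp_continuous_on[OF E]]) auto
        show "norm (E w) \<le> B / t ^ m" if "w \<in> frontier (cball z0 t)" for w
        proof -
          have w: "norm (w - z0) = t" "w \<in> ball z0 \<delta>"
            using that t by (auto simp: dist_norm norm_minus_commute)
          then show ?thesis
            using t bd[OF w(2)] by (auto simp: E_def norm_divide norm_power intro: divide_right_mono)
        qed
      qed (use t in auto)
    qed
  qed auto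
  from Ebd[of z0] show "norm L \<le> B / \<delta> ^ m" using \<delta> by (simp add: E_def)
  show "norm (D z) \<le> B * (norm (z - z0) / \<delta>) ^ m" if z: "z \<in> ball z0 \<delta>" "z \<noteq> z0" for z
    using Ebd[OF z(1)] z(2) by (simp add: E_def norm_divide norm_power power_divide field_simps)
qed

lemma double_zero_limit:
  assumes "G holomorphic_on ball z0 \<delta>" "\<delta> > 0" "G z0 = 0" "deriv G z0 = 0"
  obtains L where "((\<lambda>z. G z / (z - z0) ^ 2) \<longlongrightarrow> L) (at z0)"
proof -
  define G1 where "G1 = (\<lambda>z. if z = z0 then deriv G z0 else (G z - G z0) / (z - z0))"
  have "G1 holomorphic_on ball z0 \<delta>"
    unfolding G1_def by (rule pole_lemma_open) (use assms in auto)
  then have "G1 field_differentiable at z0"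
    using assms(2) holomorphic_on_imp_differentiable_at[of G1 "ball z0 \<delta>" z0] by simp
  then have "((\<lambda>z. (G1 z - G1 z0) / (z - z0)) \<longlongrightarrow> deriv G1 z0) (at z0)"
    using has_field_derivative_iff DERIV_deriv_iff_field_differentiable by blast
  moreover have "eventually (\<lambda>z. (G1 z - G1 z0) / (z - z0) = G z / (z - z0) ^ 2) (at z0)"
    using assms by (auto simp: eventually_at_filter G1_def power2_eq_square)
  ultimately show ?thesis using that by (blast intro: Lim_transform_eventually)
qed

lemma moebius_difference:
  fixes a e u u0 \<tau> :: complex
  assumes "u \<noteq> e" "u0 \<noteq> e"
  shows "\<tau> * (u - a) / (u - e) - \<tau> * (u0 - a) / (u0 - e) = \<tau> * (u - u0) * (a - e) / ((u - e) * (u0 - e))"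
proof -
  have "u - e \<noteq> 0" "u0 - e \<noteq> 0" using assms by auto
  then have "\<tau> * (u - a) / (u - e) - \<tau> * (u0 - a) / (u0 - e)
    = (\<tau> * (u - a) * (u0 - e) - \<tau> * (u0 - a) * (u - e)) / ((u - e) * (u0 - e))"
    by (simp add: diff_frac_eq)
  also have "\<tau> * (u - a) * (u0 - e) - \<tau> * (u0 - a) * (u - e) = \<tau> * (u - u0) * (a - e)"
    by (simp add: algebra_simps)
  finally show ?thesis .
qed

text \<open>The first summand is the bound that Schottky's theorem gives on the disc of half the radius for
  functions that omit 0 and 1 and have modulus at most \<open>D\<^sup>2\<close> at the centre.\<close>

definition omitting_const :: "real \<Rightarrow> real" where
  "omitting_const D = exp (pi * exp (pi * (2 + 2 * D\<^sup>2 + 12))) + D\<^sup>2"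

text \<open>If a meromorphic function \<open>P / Q\<close> omits three values at mutual distances comparable to \<open>r\<close> that are
  not much farther than \<open>r\<close> from its value \<open>u0\<close> at the centre, then the Moebius map that sends them to 0, infinity and 1 turns it into a holomorphic function \<open>H\<close> to which
  Schottky's theorem applies. A critical point at the centre makes \<open>H - H z0\<close> vanish to second order, and
  undoing the Moebius map gives a quadratic estimate in which only the ratio \<open>D\<close> matters. In particular
  poles are excluded near the centre.\<close>

lemma omitting_three_values_bound:
  fixes P Q :: "complex \<Rightarrow> complex" and D s r :: real
  assumes D: "D \<ge> 1" and s: "s > 0" and r: "r > 0"
    and hol: "P holomorphic_on ball z0 s" "Q holomorphic_on ball z0 s"
    and omit: "\<And>z. z \<in> ball z0 s \<Longrightarrow> P z \<noteq> a * Q z"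
      "\<And>z. z \<in> ball z0 s \<Longrightarrow> P z \<noteq> b * Q z" "\<And>z. z \<in> ball z0 s \<Longrightarrow> P z \<noteq> e * Q z"
    and Q0: "Q z0 \<noteq> 0" and u0: "u0 = P z0 / Q z0"
    and upper: "norm (b - e) \<le> D * r" "norm (u0 - a) \<le> D * r" "norm (b - a) \<le> D * r" "norm (u0 - e) \<le> D * r"
    and lower: "r \<le> norm (b - e)" "r \<le> norm (b - a)" "r \<le> norm (u0 - e)" "r \<le> norm (a - e)"
    and crit: "deriv (\<lambda>z. P z / Q z) z0 = 0"
    and z: "norm (z - z0) < s / (8 * (omitting_const D * D\<^sup>2))"
  shows "Q z \<noteq> 0" "norm (P z / Q z - u0) \<le> 32 * (omitting_const D * D ^ 3) * r * (norm (z - z0) / s)\<^sup>2"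
proof -
  define M where "M = exp (pi * exp (pi * (2 + 2 * D\<^sup>2 + 12)))"
  define W where "W = omitting_const D * D\<^sup>2"
  have M1: "1 \<le> M" by (simp add: M_def)
  have oc: "omitting_const D = M + D\<^sup>2" by (simp add: omitting_const_def M_def)
  have oc0: "0 \<le> omitting_const D" unfolding oc using M1 by auto
  have D1: "1 \<le> D\<^sup>2" using D by (simp add: one_le_power)
  have W1: "1 \<le> W" unfolding W_def oc using mult_mono[of 1 "M + D\<^sup>2" 1 "D\<^sup>2"] M1 D1 by simp
  (* The Moebius map sends a to 0, b to 1 and e to infinity. *)
  define \<tau> where "\<tau> = (b - e) / (b - a)"
  define H where "H = (\<lambda>z. \<tau> * (P z - a * Q z) / (P z - e * Q z))"
  have ne: "b \<noteq> e" "b \<noteq> a" "u0 \<noteq> e" "a \<noteq> e" using lower r by auto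
  have \<tau>0: "\<tau> \<noteq> 0" using ne by (simp add: \<tau>_def)
  have Hhol: "H holomorphic_on ball z0 s"
    unfolding H_def using omit(3) by (intro holomorphic_intros hol) auto
  have H01: "H z \<noteq> 0 \<and> H z \<noteq> 1" if "z \<in> ball z0 s" for z
  proof
    show "H z \<noteq> 0" using omit[OF that] \<tau>0 by (simp add: H_def)
    show "H z \<noteq> 1"
    proof
      assume "H z = 1"
      then have "(b - e) * (P z - a * Q z) = (b - a) * (P z - e * Q z)"
        using omit(3)[OF that] ne by (simp add: H_def \<tau>_def field_simps)
      then have "(a - e) * (P z - b * Q z) = 0" by (simp add: algebra_simps)
      then show False using ne omit(2)[OF that] by simp
    qed
  qed
  have H_eq: "H z = \<tau> * (P z / Q z - a) / (P z / Q z - e)" if "Q z \<noteq> 0" for z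
  proof -
    have "P z - a * Q z = Q z * (P z / Q z - a)" "P z - e * Q z = Q z * (P z / Q z - e)"
      using that by (simp_all add: algebra_simps)
    then have "H z = Q z * (\<tau> * (P z / Q z - a)) / (Q z * (P z / Q z - e))"
      unfolding H_def by (simp only: mult.left_commute)
    then show ?thesis using that by (simp only: mult_divide_mult_cancel_left_if if_False)
  qed
  have H0: "H z0 = \<tau> * (u0 - a) / (u0 - e)" using H_eq[OF Q0] u0 by simp
  have H0b: "norm (H z0) \<le> D\<^sup>2"
  proof -
    have "norm (H z0) = (norm (b - e) * norm (u0 - a)) / (norm (b - a) * norm (u0 - e))"
      unfolding H0 \<tau>_def by (simp add: norm_mult norm_divide)
    also have "\<dots> \<le> ((D * r) * (D * r)) / (r * r)"
      using upper lower r D by (intro frac_le mult_mono mult_pos_pos) auto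
    also have "\<dots> = D\<^sup>2" using r by (simp add: power2_eq_square)
    finally show ?thesis .
  qed
  have HM: "norm (H z) \<le> M" if z: "z \<in> ball z0 (s / 4)" for z
  proof -
    define f where "f = (\<lambda>\<zeta>. H (z0 + of_real (s / 2) * \<zeta>))"
    have in_ball: "z0 + of_real (s / 2) * \<zeta> \<in> ball z0 s" if "\<zeta> \<in> cball 0 1" for \<zeta>
      using that s by (auto simp: dist_norm norm_mult intro!: le_less_trans[of _ "s / 2"] mult_left_le)
    have "f holomorphic_on cball 0 1"
      unfolding f_def using in_ball
      by (intro holomorphic_on_compose_gen[OF _ Hhol, unfolded o_def]) (auto intro!: holomorphic_intros)
    moreover have "norm (f 0) \<le> D\<^sup>2" using H0b by (simp add: f_def)
    moreover have "\<not> (f \<zeta> = 0 \<or> f \<zeta> = 1)" if "\<zeta> \<in> cball 0 1" for \<zeta>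
      using H01[OF in_ball[OF that]] by (simp add: f_def)
    moreover have "norm ((z - z0) / of_real (s / 2)) \<le> 1 / 2"
    proof -
      have "norm (z - z0) < s / 4" using z by (simp add: dist_norm norm_minus_commute)
      then have "norm (z - z0) / (s / 2) \<le> 1 / 2" using s by (simp add: divide_simps)
      moreover have "norm ((z - z0) / of_real (s / 2)) = norm (z - z0) / (s / 2)"
        using s by (simp only: norm_divide norm_of_real)
      ultimately show ?thesis by (simp only:)
    qed
    ultimately have "norm (f ((z - z0) / of_real (s / 2))) \<le>
        exp (pi * exp (pi * (2 + 2 * D\<^sup>2 + 12 * (1/2) / (1 - 1/2))))"
      by (intro Schottky) auto
    moreover have "f ((z - z0) / of_real (s / 2)) = H z"
    proof -
      have "complex_of_real (s / 2) \<noteq> 0" using s by simp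
      then have "of_real (s / 2) * ((z - z0) / of_real (s / 2)) = z - z0"
        by (metis nonzero_mult_div_cancel_left times_divide_eq_right)
      then show ?thesis unfolding f_def by (simp only: add_diff_cancel_left' add_diff_eq)
    qed
    ultimately show ?thesis by (simp add: M_def)
  qed
  define G where "G = (\<lambda>z. H z - H z0)"
  have Ghol: "G holomorphic_on ball z0 (s / 4)"
    unfolding G_def using s by (intro holomorphic_intros holomorphic_on_subset[OF Hhol]) auto
  have Gb: "norm (G z) \<le> omitting_const D" if "z \<in> ball z0 (s / 4)" for z
    unfolding G_def oc using HM[OF that] H0b norm_triangle_ineq4[of "H z" "H z0"] by linarith
  have "deriv G z0 = 0"
  proof (rule DERIV_imp_deriv)
    have cQ: "continuous_on (ball z0 s) Q" using hol(2) by (rule holomorphic_on_imp_continuous_on)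
    have "P field_differentiable at z0" "Q field_differentiable at z0"
      using hol s by (auto intro: holomorphic_on_imp_differentiable_at[of _ "ball z0 s"])
    then have "(\<lambda>z. P z / Q z) field_differentiable at z0"
      using Q0 by (intro field_differentiable_divide)
    then have 1: "((\<lambda>z. P z / Q z) has_field_derivative 0) (at z0)"
      using crit DERIV_deriv_iff_field_differentiable by metis
    have "((\<lambda>u. \<tau> * (u - a) / (u - e) - H z0) has_field_derivative
        (\<tau> * (u0 - e) - \<tau> * (u0 - a)) / (u0 - e)\<^sup>2) (at u0)"
      using ne by (auto intro!: derivative_eq_intros simp: power2_eq_square)
    from DERIV_chain2[OF this[unfolded u0] 1]
    have 2: "((\<lambda>z. \<tau> * (P z / Q z - a) / (P z / Q z - e) - H z0) has_field_derivative 0) (at z0)"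
      by simp
    have "eventually (\<lambda>z. Q z \<noteq> 0) (nhds z0)"
      using continuous_on_open_avoid[OF cQ, of z0 0] s Q0
      by (auto simp: eventually_nhds_metric dist_commute)
    then have 3: "eventually (\<lambda>z. \<tau> * (P z / Q z - a) / (P z / Q z - e) - H z0 = G z) (nhds z0)"
      by eventually_elim (simp add: G_def H_eq)
    show "(G has_field_derivative 0) (at z0)"
      using 2 DERIV_cong_ev[OF refl 3 refl] by (rule rev_iffD1)
  qed
  moreover have G0: "G z0 = 0" by (simp add: G_def)
  ultimately obtain L where "((\<lambda>z. G z / (z - z0) ^ 2) \<longlongrightarrow> L) (at z0)"
    using double_zero_limit[OF Ghol] s by auto
  from Schwarz_bound_of_order(2)[OF Ghol Gb this]
  have Gz: "norm (G z) \<le> omitting_const D * (norm (z - z0) / (s / 4))\<^sup>2" if "z \<in> ball z0 (s / 4)" for z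
    using that s G0 by (cases "z = z0") auto
  have zin: "z \<in> ball z0 (s / 4)" "norm (z - z0) / s \<le> 1 / (8 * W)"
  proof -
    have "s / (8 * W) \<le> s / 4" using W1 s by (intro divide_left_mono) auto
    then show "z \<in> ball z0 (s / 4)" using z unfolding W_def[symmetric] by (simp add: dist_norm norm_minus_commute)
    show "norm (z - z0) / s \<le> 1 / (8 * W)" using z W1 s unfolding W_def[symmetric] by (simp add: field_simps)
  qed
  define q where "q = norm (z - z0) / s"
  have G_q: "norm (G z) \<le> 16 * omitting_const D * q\<^sup>2"
    using Gz[OF zin(1)] s by (simp add: q_def power_divide power_mult_distrib mult_ac)
  (* Inverting the Moebius map: x * (u - e) = u - u0 for the value u at z, and x = 1 at a pole. *)
  define x where "x = G z * (u0 - e) / (\<tau> * (a - e))"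
  have x: "norm x \<le> norm (G z) * D\<^sup>2"
  proof -
    have "norm x = norm (G z) * ((norm (u0 - e) * norm (b - a)) / (norm (b - e) * norm (a - e)))"
      unfolding x_def \<tau>_def by (simp add: norm_mult norm_divide)
    also have "\<dots> \<le> norm (G z) * (((D * r) * (D * r)) / (r * r))"
      using upper lower r D by (intro mult_left_mono frac_le mult_mono mult_pos_pos) auto
    also have "((D * r) * (D * r)) / (r * r) = D\<^sup>2" using r by (simp add: power2_eq_square)
    finally show ?thesis .
  qed
  have "norm (G z) * D\<^sup>2 \<le> (16 * omitting_const D * q\<^sup>2) * D\<^sup>2"
    using G_q by (intro mult_right_mono) auto
  also have "\<dots> = 16 * W * q\<^sup>2" by (simp add: W_def)
  also have "\<dots> \<le> 16 * W * (1 / (8 * W))\<^sup>2"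
    using zin(2) W1 s by (intro mult_left_mono power_mono) (auto simp: q_def)
  also have "\<dots> = 1 / (4 * W)" using W1 by (simp add: power2_eq_square)
  also have "\<dots> \<le> 1 / 2" using W1 by (simp add: field_simps)
  finally have x2: "norm x \<le> 1 / 2" using x by linarith
  have zs: "z \<in> ball z0 s" using zin(1) s by auto
  show Qz: "Q z \<noteq> 0"
  proof
    assume "Q z = 0"
    then have "H z = \<tau>" using omit(1)[OF zs] by (simp add: H_def)
    then have "G z = \<tau> * (a - e) / (u0 - e)"
      unfolding G_def H0 using ne by (simp add: field_simps)
    then have "x = 1" using \<tau>0 ne by (simp add: x_def)
    then show False using x2 by simp
  qed
  define u where "u = P z / Q z"
  have ue: "u \<noteq> e" using omit(3)[OF zs] Qz by (auto simp: u_def)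
  have "G z = \<tau> * (u - u0) * (a - e) / ((u - e) * (u0 - e))"
    using moebius_difference[OF ue ne(3), of \<tau> a] H_eq[OF Qz] unfolding G_def H0 u_def by simp
  then have "x * (u - e) = u - u0"
    using \<tau>0 ne ue by (simp add: x_def)
  then have "u - u0 = x * (u - u0) + x * (u0 - e)" by (simp add: algebra_simps)
  then have "norm (u - u0) \<le> norm x * norm (u - u0) + norm x * norm (u0 - e)"
    by (metis norm_mult norm_triangle_ineq)
  also have "norm x * norm (u - u0) \<le> 1 / 2 * norm (u - u0)"
    using x2 by (intro mult_right_mono) auto
  finally have "norm (u - u0) \<le> 2 * norm x * norm (u0 - e)" by simp
  also have "\<dots> \<le> 2 * (norm (G z) * D\<^sup>2) * (D * r)"
    using x upper(4) by (intro mult_mono) auto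
  also have "\<dots> \<le> 2 * ((16 * omitting_const D * q\<^sup>2) * D\<^sup>2) * (D * r)"
    using G_q D r oc0 by (intro mult_mono) auto
  also have "\<dots> = 32 * (omitting_const D * D ^ 3) * r * q\<^sup>2"
    by (simp add: power2_eq_square power3_eq_cube)
  finally show "norm (P z / Q z - u0) \<le> 32 * (omitting_const D * D ^ 3) * r * (norm (z - z0) / s)\<^sup>2"
    by (simp add: u_def q_def)
qed

section \<open>Fatou and Julia sets\<close>

text \<open>Normality of the iterates near \<open>v\<close> passes to the image of a compact neighbourhood, which is a
  neighbourhood of \<open>g v\<close> because \<open>g\<close> is open.\<close>

lemma fatou_set_forward:
  assumes g: "rational_map_of_degree g d" and d: "d \<ge> 1" and v: "v \<in> fatou_set g"
  shows "g v \<in> fatou_set g"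
proof -
  obtain U where U: "open U" "v \<in> U" "normal_family_on U (range (\<lambda>n. g ^^ n))"
    using v unfolding fatou_set_def by blast
  obtain e where e: "e > 0" "cball v e \<subseteq> U"
    using U open_contains_cball by blast
  define W where "W = g ` ball v e"
  have K: "compact (cball v e)"
    using compact_Int_closed[OF compact_UNIV_rsphere closed_cball[of v e]] by simp
  have "normal_family_on W (range (\<lambda>n. g ^^ n))"
    unfolding normal_family_on_def
  proof (intro allI impI)
    fix f :: "nat \<Rightarrow> rsphere \<Rightarrow> rsphere" assume f: "range f \<subseteq> range (\<lambda>n. g ^^ n)"
    have "range (\<lambda>j. f j \<circ> g) \<subseteq> range (\<lambda>n. g ^^ n)"
    proof
      fix h assume "h \<in> range (\<lambda>j. f j \<circ> g)"
      then obtain j where j: "h = f j \<circ> g" by blast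
      obtain n where "f j = g ^^ n" using f by blast
      then have "h = g ^^ (Suc n)" using j by (simp only: funpow_Suc_right)
      then show "h \<in> range (\<lambda>n. g ^^ n)" by blast
    qed
    then obtain r h where rh: "strict_mono r"
      "\<And>K. compact K \<Longrightarrow> K \<subseteq> U \<Longrightarrow> uniform_limit K ((\<lambda>j. f j \<circ> g) \<circ> r) h sequentially"
      using U(3) unfolding normal_family_on_def by metis
    (* The limit on W is the limit on U read through arbitrary preimages. *)
    define \<phi> where "\<phi> = (\<lambda>w. SOME u. u \<in> ball v e \<and> g u = w)"
    have \<phi>: "\<phi> w \<in> ball v e \<and> g (\<phi> w) = w" if "w \<in> W" for w
      unfolding \<phi>_def by (rule someI_ex) (use that in \<open>auto simp: W_def\<close>)
    have ul: "uniform_limit (cball v e) ((\<lambda>j. f j \<circ> g) \<circ> r) h sequentially"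
      using rh(2)[OF K e(2)] .
    have "uniform_limit W (f \<circ> r) (h \<circ> \<phi>) sequentially"
    proof (rule uniform_limitI)
      fix \<epsilon> :: real assume "\<epsilon> > 0"
      then have "\<forall>\<^sub>F n in sequentially. \<forall>x\<in>cball v e. dist (((\<lambda>j. f j \<circ> g) \<circ> r) n x) (h x) < \<epsilon>"
        using ul unfolding uniform_limit_iff by blast
      then show "\<forall>\<^sub>F n in sequentially. \<forall>w\<in>W. dist ((f \<circ> r) n w) ((h \<circ> \<phi>) w) < \<epsilon>"
      proof eventually_elim
        case (elim n)
        show ?case
        proof
          fix w assume "w \<in> W"
          with \<phi> have "\<phi> w \<in> cball v e" "g (\<phi> w) = w" by (auto simp: less_imp_le)
          then show "dist ((f \<circ> r) n w) ((h \<circ> \<phi>) w) < \<epsilon>" using elim by fastforce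
        qed
      qed
    qed
    then show "\<exists>r h. strict_mono r \<and> (\<forall>K. compact K \<and> K \<subseteq> W \<longrightarrow> uniform_limit K (f \<circ> r) h sequentially)"
      using rh(1) uniform_limit_on_subset by blast
  qed
  moreover have "open W" unfolding W_def by (rule rational_map_open[OF g d open_ball])
  moreover have "g v \<in> W" using e by (auto simp: W_def)
  ultimately show ?thesis unfolding fatou_set_def by blast
qed

lemma julia_set_backward:
  assumes g: "rational_map_of_degree g d" and d: "d \<ge> 1" and v: "(g ^^ k) v \<in> julia_set g"
  shows "v \<in> julia_set g"
proof (rule ccontr)
  assume "v \<notin> julia_set g"
  then have "v \<in> fatou_set g" by (simp add: julia_set_def)
  then have "(g ^^ k) v \<in> fatou_set g"
    by (induction k) (auto intro: fatou_set_forward[OF g d])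
  then show False using v by (simp add: julia_set_def)
qed

lemma iterate_fixed: "(f ^^ n) x = x" if "f x = x"
  by (induction n) (auto simp: that)

text \<open>Otherwise iterates would move points \<open>v j \<longlonglongrightarrow> x\<close> away from \<open>x\<close>; but a subsequence converges
  uniformly near \<open>x\<close> to a continuous function that fixes \<open>x\<close>.\<close>

lemma fatou_set_equicontinuous_at_fixed_point:
  assumes g: "rational_map_of_degree g d" and x: "x \<in> fatou_set g" "(g ^^ N) x = x" and e: "e > 0"
  shows "\<exists>\<delta>>0. \<forall>n v. dist v x < \<delta> \<longrightarrow> dist ((g ^^ (N * n)) v) x < e"
proof (rule ccontr)
  assume "\<not> ?thesis"
  then have "\<exists>n v. dist v x < \<delta> \<and> e \<le> dist ((g ^^ (N * n)) v) x" if "\<delta> > 0" for \<delta>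
    using that by (meson not_le)
  then have "\<forall>j. \<exists>n v. dist v x < inverse (real (Suc j)) \<and> e \<le> dist ((g ^^ (N * n)) v) x"
    by simp
  then obtain n v where nv: "\<And>j. dist (v j) x < inverse (real (Suc j))"
    "\<And>j. e \<le> dist ((g ^^ (N * n j)) (v j)) x" by metis
  obtain U where U: "open U" "x \<in> U" "normal_family_on U (range (\<lambda>n. g ^^ n))"
    using x unfolding fatou_set_def by blast
  obtain s where s: "s > 0" "cball x s \<subseteq> U"
    using U open_contains_cball by blast
  have K: "compact (cball x s)"
    using compact_Int_closed[OF compact_UNIV_rsphere closed_cball[of x s]] by simp
  define f where "f = (\<lambda>j. g ^^ (N * n j))"
  have "range f \<subseteq> range (\<lambda>n. g ^^ n)" by (auto simp: f_def)
  then obtain r h where rh: "strict_mono r" "uniform_limit (cball x s) (f \<circ> r) h sequentially"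
    using U(3) K s(2) unfolding normal_family_on_def by metis
  have fx: "f j x = x" for j
    unfolding f_def funpow_mult[symmetric] by (rule iterate_fixed[of "g ^^ N" x, OF x(2)])
  have "continuous_on (cball x s) (f j)" for j
    unfolding f_def by (rule continuous_on_subset[OF rational_map_iterate_continuous[OF g]]) simp
  then have hc: "continuous_on (cball x s) h"
    by (intro uniform_limit_theorem[OF _ rh(2)]) auto
  have "((\<lambda>j. (f \<circ> r) j x) \<longlongrightarrow> h x) sequentially"
    using tendsto_uniform_limitI[OF rh(2), of x] s by simp
  then have hx: "h x = x" by (simp add: fx LIMSEQ_const_iff)
  obtain t where t: "t > 0" "\<And>u. u \<in> cball x s \<Longrightarrow> dist u x < t \<Longrightarrow> dist (h u) x < e / 2"
    using hc[unfolded continuous_on_iff, rule_format, of x "e / 2"] e s unfolding hx by auto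
  have "eventually (\<lambda>i. \<forall>u\<in>cball x s. dist ((f \<circ> r) i u) (h u) < e / 2) sequentially"
    using rh(2)[unfolded uniform_limit_iff, rule_format, of "e / 2"] e by simp
  moreover have "eventually (\<lambda>i. inverse (real (Suc i)) < min s t) sequentially"
    using s t by (intro order_tendstoD[OF LIMSEQ_inverse_real_of_nat]) auto
  ultimately have "eventually (\<lambda>i. False) sequentially"
  proof eventually_elim
    case (elim i)
    have "inverse (real (Suc (r i))) \<le> inverse (real (Suc i))"
      using seq_suble[OF rh(1), of i] by (intro le_imp_inverse_le) auto
    then have "dist (v (r i)) x < min s t"
      using elim(2) nv(1)[of "r i"] by linarith
    then have "v (r i) \<in> cball x s" "dist (v (r i)) x < t" by (auto simp: dist_commute)
    then have "dist (f (r i) (v (r i))) (h (v (r i))) < e / 2" "dist (h (v (r i))) x < e / 2"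
      using elim(1) t(2) by auto
    then have "dist (f (r i) (v (r i))) x < e"
      using dist_triangle[of "f (r i) (v (r i))" x "h (v (r i))"] by linarith
    then show False using nv(2)[of "r i"] by (simp add: f_def)
  qed
  then show False by simp
qed

lemma chart_change: "w \<noteq> 0 \<Longrightarrow> chart (\<not> b) w = chart b (1 / w)"
  by (cases b) (auto simp: chart.simps)

lemma chart_misses_one_point: "(\<exists>z. x = chart b z) \<or> x = chart (\<not> b) 0"
proof -
  obtain c z where x: "x = chart c z" by (rule chart_exists)
  show ?thesis
  proof (cases "c = b \<or> z = 0")
    case False
    then have "c = (\<not> b)" by blast
    then show ?thesis using x False chart_change[of z b] by blast
  next
    case True
    then show ?thesis using x by (cases "c = b") auto
  qed
qed

text \<open>By the identity theorem for \<open>P z = z * Q z\<close> the conclusion holds in the whole chart \<open>b\<close>. The ball of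
  radius 1 about 1 in the other chart lies in the overlap, so the argument can be repeated there.\<close>

lemma rational_map_iterate_identity:
  assumes g: "rational_map_of_degree g d" and s: "s > 0"
    and id: "\<And>z. z \<in> ball z0 s \<Longrightarrow> (g ^^ N) (chart b z) = chart b z"
  shows "(g ^^ N) x = x"
proof -
  have *: "(g ^^ N) (chart b z) = chart b z"
    if s: "s > 0" and id: "\<And>z. z \<in> ball z0 s \<Longrightarrow> (g ^^ N) (chart b z) = chart b z" for b z z0 s
  proof -
    obtain P Q where PQ: "P holomorphic_on UNIV" "Q holomorphic_on UNIV"
      "\<And>z. P z \<noteq> 0 \<or> Q z \<noteq> 0" "\<And>z. (g ^^ N) (chart b z) = chart_proj b (P z) (Q z)"
      using rational_map_iterate_chart[OF g] by metis
    have iff: "(g ^^ N) (chart b z) = chart b z \<longleftrightarrow> P z = z * Q z" for z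
      unfolding PQ(4) by (rule chart_proj_eq_chart_iff[OF PQ(3)])
    have "P z = z * Q z" if "z \<in> ball z0 s" for z
      using id[OF that] iff by simp
    moreover have "(\<lambda>z. z * Q z) holomorphic_on UNIV" by (intro holomorphic_intros PQ)
    moreover have "ball z0 s \<noteq> {}" using s by simp
    ultimately have "P z = z * Q z"
      using analytic_continuation_open[of "ball z0 s" UNIV P "\<lambda>z. z * Q z" z] PQ(1)
        connected_UNIV by blast
    then show ?thesis using iff by simp
  qed
  have b: "(g ^^ N) (chart b z) = chart b z" for z using *[OF s id] .
  have "(g ^^ N) (chart (\<not> b) z) = chart (\<not> b) z" if "z \<in> ball 1 1" for z
  proof -
    have "z \<noteq> 0" using that by auto
    then show ?thesis using b by (simp add: chart_change)
  qed
  then have "(g ^^ N) (chart (\<not> b) z) = chart (\<not> b) z" for z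
    using *[of 1 1 "\<not> b" z] by simp
  with b show ?thesis by (metis chart_misses_one_point)
qed

text \<open>There are only finitely many iterates, so every sequence of them has a constant subsequence.\<close>

lemma fatou_set_of_periodic_map:
  assumes N: "N \<ge> 1" and id: "\<And>x. (g ^^ N) x = x"
  shows "fatou_set g = UNIV"
proof -
  have "normal_family_on UNIV (range (\<lambda>n. g ^^ n))"
    unfolding normal_family_on_def
  proof (intro allI impI)
    fix f :: "nat \<Rightarrow> rsphere \<Rightarrow> rsphere" assume f: "range f \<subseteq> range (\<lambda>n. g ^^ n)"
    have "g ^^ n \<in> (\<lambda>n. g ^^ n) ` {..<N}" for n
    proof -
      have "g ^^ n = g ^^ (n mod N)"
        by (rule ext) (rule funpow_mod_eq[OF id, symmetric])
      then show ?thesis using N by (intro image_eqI[of _ _ "n mod N"]) auto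
    qed
    then have "range (\<lambda>n. g ^^ n) \<subseteq> (\<lambda>n. g ^^ n) ` {..<N}" by (intro image_subsetI)
    then have "finite (range f)"
      using f by (meson finite_imageI finite_lessThan finite_subset)
    then obtain j where "infinite {i \<in> UNIV. f i = f j}"
      using pigeonhole_infinite[of "UNIV :: nat set" f] by auto
    then obtain r :: "nat \<Rightarrow> nat" where r: "strict_mono r" "\<And>i. r i \<in> {i. f i = f j}"
      using infinite_enumerate[of "{i. f i = f j}"] by auto
    have "f \<circ> r = (\<lambda>_. f j)" using r(2) by auto
    then show "\<exists>r h. strict_mono r \<and> (\<forall>K. compact K \<and> K \<subseteq> UNIV \<longrightarrow> uniform_limit K (f \<circ> r) h sequentially)"
      using r(1) by (intro exI[of _ r] exI[of _ "f j"]) (simp add: uniform_limit_iff)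
  qed
  then show ?thesis unfolding fatou_set_def by blast
qed

text \<open>Write \<open>L n\<close> for the \<open>n\<close>-th iterate of \<open>g ^^ N\<close> in a chart and \<open>L 1 z = z + a (z - z0) ^ m + \<dots>\<close>
  with \<open>a \<noteq> 0\<close> and \<open>m \<ge> 2\<close>. Then \<open>L n z = z + n a (z - z0) ^ m + \<dots>\<close>, whereas equicontinuity would bound the
  coefficients \<open>n a\<close> by the Schwarz lemma. If there is no such \<open>a\<close>, then \<open>g ^^ N\<close> is the identity and
  the Julia set is empty.\<close>

lemma multiplier_one_in_julia_set:
  assumes g: "rational_map_of_degree g d" and J: "julia_set g \<noteq> {}" and N: "N \<ge> 1"
    and fp: "(g ^^ N) (chart b z0) = chart b z0"
    and der: "((\<lambda>z. coord b ((g ^^ N) (chart b z))) has_field_derivative 1) (at z0)"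
  shows "chart b z0 \<in> julia_set g"
proof (rule ccontr)
  assume "chart b z0 \<notin> julia_set g"
  then have fat: "chart b z0 \<in> fatou_set g" by (simp add: julia_set_def)
  obtain \<delta>1 K where dK: "0 < \<delta>1" "1 \<le> K"
    "\<And>v. dist v (chart b z0) < \<delta>1 \<Longrightarrow> \<exists>z. v = chart b z \<and> norm (z - z0) \<le> K * dist v (chart b z0)"
    using chart_local_inverse[of b z0] by metis
  define e where "e = min \<delta>1 (1 / K)"
  have e: "e > 0" using dK by (simp add: e_def)
  obtain \<delta>2 where \<delta>2: "\<delta>2 > 0"
    "\<And>n v. dist v (chart b z0) < \<delta>2 \<Longrightarrow> dist ((g ^^ (N * n)) v) (chart b z0) < e"
    using fatou_set_equicontinuous_at_fixed_point[OF g fat fp e] by blast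
  define \<delta> where "\<delta> = min (\<delta>2 / 2) 1"
  have \<delta>: "0 < \<delta>" "\<delta> \<le> 1" using \<delta>2 by (auto simp: \<delta>_def)
  define L where "L = (\<lambda>n z. coord b ((g ^^ (N * n)) (chart b z)))"
  have L: "(g ^^ (N * n)) (chart b z) = chart b (L n z) \<and> norm (L n z - z0) \<le> 1" if "z \<in> ball z0 \<delta>" for n z
  proof -
    have "norm (z - z0) < \<delta>2 / 2" using that by (simp add: \<delta>_def dist_norm norm_minus_commute)
    then have "dist (chart b z) (chart b z0) < \<delta>2"
      using dist_chart_le[of b z z0] by linarith
    from \<delta>2(2)[OF this] have d: "dist ((g ^^ (N * n)) (chart b z)) (chart b z0) < e" .
    then obtain u where u: "(g ^^ (N * n)) (chart b z) = chart b u"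
      "norm (u - z0) \<le> K * dist ((g ^^ (N * n)) (chart b z)) (chart b z0)"
      using dK(3)[of "(g ^^ (N * n)) (chart b z)"] by (auto simp: e_def)
    have "K * dist ((g ^^ (N * n)) (chart b z)) (chart b z0) \<le> K * (1 / K)"
      using d dK(2) by (intro mult_left_mono) (auto simp: e_def)
    then show ?thesis using u dK(2) by (simp add: L_def)
  qed
  have Lhol: "L n holomorphic_on ball z0 \<delta>" for n
  proof -
    obtain P Q where PQ: "P holomorphic_on UNIV" "Q holomorphic_on UNIV"
      "\<And>z. P z \<noteq> 0 \<or> Q z \<noteq> 0" "\<And>z. (g ^^ (N * n)) (chart b z) = chart_proj b (P z) (Q z)"
      using rational_map_iterate_chart[OF g] by metis
    have Q: "Q z \<noteq> 0" if "z \<in> ball z0 \<delta>" for z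
      using L[OF that, of n] PQ(3)[of z] chart_proj_eq_chart_iff[OF PQ(3), of b z] unfolding PQ(4) by auto
    have "(\<lambda>z. P z / Q z) holomorphic_on ball z0 \<delta>"
      using Q by (intro holomorphic_intros holomorphic_on_subset[OF PQ(1)] holomorphic_on_subset[OF PQ(2)]) auto
    then show ?thesis
      by (rule holomorphic_transform) (simp add: L_def PQ(4) Q chart_proj_eq_chart)
  qed
  have Lz0: "L n z0 = z0" for n
    unfolding L_def funpow_mult[symmetric] using iterate_fixed[of "g ^^ N" "chart b z0", OF fp] by simp
  have LSuc: "L (Suc n) z = L 1 (L n z)" if "z \<in> ball z0 \<delta>" for n z
    using L[OF that, of n] by (simp add: L_def funpow_add)
  define D where "D = (\<lambda>z. L 1 z - z)"
  have Dhol: "D holomorphic_on ball z0 \<delta>" unfolding D_def by (intro holomorphic_intros Lhol)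
  have Dz0: "D z0 = 0" by (simp add: D_def Lz0)
  have nconst: "\<not> D constant_on ball z0 \<delta>"
  proof
    assume "D constant_on ball z0 \<delta>"
    then have "D z = 0" if "z \<in> ball z0 \<delta>" for z
      using Dz0 \<delta> that unfolding constant_on_def by (metis centre_in_ball)
    then have "(g ^^ N) (chart b z) = chart b z" if "z \<in> ball z0 \<delta>" for z
      using L[OF that, of 1] that by (simp add: D_def)
    then have "(g ^^ N) x = x" for x by (rule rational_map_iterate_identity[OF g \<delta>(1)])
    then show False using fatou_set_of_periodic_map[OF N, of g] J by (simp add: julia_set_def)
  qed
  obtain h r m where h: "0 < m" "0 < r" "ball z0 r \<subseteq> ball z0 \<delta>" "h holomorphic_on ball z0 r"
      "\<And>w. w \<in> ball z0 r \<Longrightarrow> D w = (w - z0) ^ m * h w" "\<And>w. w \<in> ball z0 r \<Longrightarrow> h w \<noteq> 0"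
    by (rule holomorphic_factor_zero_nonconstant[OF Dhol open_ball connected_ball _ Dz0 nconst]) (use \<delta> in auto)
  have h0: "h z0 \<noteq> 0" using h(2,6) by simp
  have inr: "eventually (\<lambda>z. z \<in> ball z0 r) (at z0)"
    using h(2) eventually_at_in_open'[of "ball z0 r" z0] by simp
  have hlim: "(h \<longlongrightarrow> h z0) (at z0)"
    using holomorphic_on_imp_continuous_on[OF h(4)] h(2)
    by (metis centre_in_ball continuous_on_eq_continuous_at isCont_def open_ball)
  have m2: "m \<noteq> 1"
  proof
    assume m: "m = 1"
    have "((\<lambda>z. L 1 z - z) has_field_derivative 1 - 1) (at z0)"
      using der by (intro DERIV_diff DERIV_ident) (simp add: L_def)
    then have "((\<lambda>z. (D z - D z0) / (z - z0)) \<longlongrightarrow> 0) (at z0)"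
      unfolding D_def has_field_derivative_iff by simp
    moreover have "eventually (\<lambda>z. h z = (D z - D z0) / (z - z0)) (at z0)"
      using inr eventually_neq_at_within[of z0 z0 UNIV] by eventually_elim (simp add: Dz0 h(5) m)
    ultimately have "(h \<longlongrightarrow> 0) (at z0)"
      using Lim_transform_eventually eventually_mono by (smt (verit, best))
    then show False using hlim h0 tendsto_unique by (metis at_neq_bot)
  qed
  (* L (n + 1) z - z is the sum of L n z - z and D (L n z), and L n z - z0 is asymptotic to z - z0. *)
  have main: "((\<lambda>z. (L n z - z) / (z - z0) ^ m) \<longlongrightarrow> of_nat n * h z0) (at z0)" for n
  proof (induction n)
    case 0
    then show ?case by (simp add: L_def)
  next
    case (Suc n)
    have lin: "((\<lambda>z. z - z0) \<longlongrightarrow> 0) (at z0)" by (auto intro!: tendsto_eq_intros)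
    have "((\<lambda>z. 1 + (L n z - z) / (z - z0) ^ m * (z - z0) ^ (m - 1)) \<longlongrightarrow> 1 + of_nat n * h z0 * 0 ^ (m - 1)) (at z0)"
      by (intro tendsto_intros Suc lin)
    moreover have "eventually (\<lambda>z. 1 + (L n z - z) / (z - z0) ^ m * (z - z0) ^ (m - 1) = (L n z - z0) / (z - z0)) (at z0)"
      using eventually_neq_at_within[of z0 z0 UNIV]
    proof eventually_elim
      case (elim z)
      have "(z - z0) ^ m = (z - z0) * (z - z0) ^ (m - 1)"
        using h(1) by (metis power_eq_if less_numeral_extra(3))
      then have "(L n z - z) / (z - z0) ^ m * (z - z0) ^ (m - 1) = (L n z - z) / (z - z0)"
        using elim by simp
      then show ?case using elim by (simp add: field_simps)
    qed
    ultimately have "((\<lambda>z. (L n z - z0) / (z - z0)) \<longlongrightarrow> 1 + of_nat n * h z0 * 0 ^ (m - 1)) (at z0)"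
      by (rule Lim_transform_eventually)
    moreover have "(0::complex) ^ (m - 1) = 0" using m2 h(1) by simp
    ultimately have ratio: "((\<lambda>z. (L n z - z0) / (z - z0)) \<longlongrightarrow> 1) (at z0)" by (simp only: mult_zero_right add_0_right)
    have Lt: "(L n \<longlongrightarrow> z0) (at z0)"
      using holomorphic_on_imp_continuous_on[OF Lhol] \<delta>(1) Lz0
      by (metis centre_in_ball continuous_on_eq_continuous_at isCont_def open_ball)
    have hL: "((\<lambda>z. h (L n z)) \<longlongrightarrow> h z0) (at z0)"
      using hlim Lt by (intro isCont_tendsto_compose[of z0 h]) (auto simp: isCont_def)
    have "((\<lambda>z. ((L n z - z0) / (z - z0)) ^ m * h (L n z) + (L n z - z) / (z - z0) ^ m) \<longlongrightarrow>
        1 ^ m * h z0 + of_nat n * h z0) (at z0)"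
      by (intro tendsto_intros ratio hL Suc)
    moreover have "eventually (\<lambda>z. L n z \<in> ball z0 r) (at z0)"
      using Lt h(2) by (auto dest: tendstoD simp: dist_commute)
    with inr have "eventually (\<lambda>z. ((L n z - z0) / (z - z0)) ^ m * h (L n z) + (L n z - z) / (z - z0) ^ m
       = (L (Suc n) z - z) / (z - z0) ^ m) (at z0)"
    proof eventually_elim
      case (elim z)
      have *: "L (Suc n) z - z = D (L n z) + (L n z - z)"
        using LSuc[of z n] h(3) elim(1) by (auto simp: D_def)
      show ?case unfolding * h(5)[OF elim(2)]
        by (simp only: power_divide add_divide_distrib times_divide_eq_left)
    qed
    ultimately have "((\<lambda>z. (L (Suc n) z - z) / (z - z0) ^ m) \<longlongrightarrow> 1 ^ m * h z0 + of_nat n * h z0) (at z0)"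
      by (rule Lim_transform_eventually)
    moreover have "1 ^ m * h z0 + of_nat n * h z0 = of_nat (Suc n) * h z0" by (simp add: algebra_simps)
    ultimately show ?case by (simp only:)
  qed
  have bound: "norm (of_nat n * h z0) \<le> 2 / \<delta> ^ m" for n
  proof (rule Schwarz_bound_of_order(1)[OF _ _ main \<delta>(1)])
    show "(\<lambda>z. L n z - z) holomorphic_on ball z0 \<delta>" by (intro holomorphic_intros Lhol)
    fix z assume z: "z \<in> ball z0 \<delta>"
    then have "norm (z - z0) \<le> 1" using \<delta> by (simp add: dist_norm norm_minus_commute)
    then show "norm (L n z - z) \<le> 2"
      using L[OF z, of n] norm_triangle_ineq4[of "L n z - z0" "z - z0"] by simp
  qed
  obtain n :: nat where "real n > (2 / \<delta> ^ m) / norm (h z0)"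
    using reals_Archimedean2 by blast
  then have "real n * norm (h z0) > 2 / \<delta> ^ m" using h0 by (simp add: pos_divide_less_eq del: divide_divide_eq_left)
  then show False using bound[of n] by (simp add: norm_mult)
qed

section \<open>Dynamical quasi-visual approximations\<close>

lemma diameter_le_of_dist:
  fixes S :: "'a::metric_space set"
  assumes "y \<in> S" "\<And>v. v \<in> S \<Longrightarrow> dist v y \<le> t"
  shows "diameter S \<le> 2 * t"
proof -
  have "dist u v \<le> 2 * t" if "u \<in> S" "v \<in> S" for u v
    using assms(2)[OF that(1)] assms(2)[OF that(2)] dist_triangle2[of u v y] by linarith
  then show ?thesis unfolding diameter_def using assms(1) by (auto intro!: cSUP_least)
qed

text \<open>A dynamical quasi-visual approximation of the Julia set with its constants fixed and each axiom
  as a separate rule.\<close>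

locale dynamical_tiling =
  fixes g :: "rsphere \<Rightarrow> rsphere" and d w :: nat and \<X> :: "nat \<Rightarrow> rsphere set set"
    and C :: real and l :: nat and \<rho> :: real
  assumes rat: "rational_map_of_degree g d" and d1: "d \<ge> 1"
    and bdd: "bounded (julia_set g)" and two: "\<exists>x\<in>julia_set g. \<exists>y\<in>julia_set g. x \<noteq> y"
    and cover: "\<And>n. \<Union>(\<X> n) = julia_set g" and level0: "\<X> 0 = {julia_set g}"
    and C1: "C \<ge> 1" and l1: "l \<ge> 1" and \<rho>0: "0 < \<rho>" and \<rho>1: "\<rho> < 1"
    and same: "\<And>n X Y. X \<in> \<X> n \<Longrightarrow> Y \<in> \<X> n \<Longrightarrow> X \<inter> Y \<noteq> {} \<Longrightarrow> diameter Y \<le> C * diameter X"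
    and sep: "\<And>n X Y. X \<in> \<X> n \<Longrightarrow> Y \<in> \<X> n \<Longrightarrow>
      tile_neighborhood (\<X> n) w X \<inter> tile_neighborhood (\<X> n) w Y = {} \<Longrightarrow>
      ereal (diameter X / C) \<le> tile_dist X Y"
    and succ: "\<And>n X Y. X \<in> \<X> n \<Longrightarrow> Y \<in> \<X> (n + 1) \<Longrightarrow> X \<inter> Y \<noteq> {} \<Longrightarrow>
      diameter Y \<le> C * diameter X \<and> diameter X \<le> C * diameter Y"
    and decay: "\<And>n X Y. X \<in> \<X> n \<Longrightarrow> Y \<in> \<X> (n + l) \<Longrightarrow> X \<inter> Y \<noteq> {} \<Longrightarrow> diameter Y \<le> \<rho> * diameter X"
    and dyn: "\<And>n X. n \<ge> 1 \<Longrightarrow> X \<in> \<X> (n + 1) \<Longrightarrow> g ` X \<in> \<X> n"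
begin

abbreviation J :: "rsphere set" where "J \<equiv> julia_set g"

lemma tile_subset: "X \<in> \<X> n \<Longrightarrow> X \<subseteq> J"
  using cover[of n] by auto

lemma tile_bounded: "X \<in> \<X> n \<Longrightarrow> bounded X"
  by (rule bounded_subset[OF bdd tile_subset])

lemma dist_le_diameter: "X \<in> \<X> n \<Longrightarrow> x \<in> X \<Longrightarrow> y \<in> X \<Longrightarrow> dist x y \<le> diameter X"
  by (rule diameter_bounded_bound[OF tile_bounded])

lemma diameter_J_pos: "0 < diameter J"
proof -
  obtain x y where "x \<in> J" "y \<in> J" "x \<noteq> y" using two by blast
  then have "0 < dist x y" "dist x y \<le> diameter J"
    using diameter_bounded_bound[OF bdd] by auto
  then show ?thesis by linarith
qed

text \<open>Comparability of consecutive levels transports positivity down from the single tile of level 0, the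
  Julia set itself.\<close>

lemma tile_diameter_pos: "X \<in> \<X> n \<Longrightarrow> X \<noteq> {} \<Longrightarrow> 0 < diameter X"
proof (induction n arbitrary: X)
  case 0
  then show ?case using level0 diameter_J_pos by simp
next
  case (Suc n)
  then obtain x where x: "x \<in> X" "x \<in> J" using tile_subset[of X "Suc n"] by auto
  then obtain Y where Y: "Y \<in> \<X> n" "x \<in> Y" using cover[of n] by blast
  have "0 < diameter Y" using Suc.IH[OF Y(1)] Y(2) by blast
  also have "diameter Y \<le> C * diameter X" using succ[of Y n X] Y Suc.prems x by auto
  finally show ?case using C1 by (simp add: zero_less_mult_iff)
qed

lemma tile_image: "n \<ge> 1 \<Longrightarrow> X \<in> \<X> (n + k) \<Longrightarrow> (g ^^ k) ` X \<in> \<X> n"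
proof (induction k arbitrary: X)
  case (Suc k)
  have "g ` X \<in> \<X> (n + k)" using dyn[of "n + k" X] Suc.prems by simp
  then have "(g ^^ k) ` g ` X \<in> \<X> n" using Suc by blast
  then show ?case by (simp only: funpow_Suc_right image_comp)
qed simp

definition adjacent :: "nat \<Rightarrow> (rsphere set \<times> rsphere set) set" where
  "adjacent n = {(X, Y). X \<in> \<X> n \<and> Y \<in> \<X> n \<and> X \<inter> Y \<noteq> {}}"

lemma chain_bounds:
  assumes "(X, Y) \<in> adjacent n ^^ k" "X \<in> \<X> n"
  shows "Y \<in> \<X> n" "diameter Y \<le> C ^ k * diameter X" "diameter X \<le> C ^ k * diameter Y"
    "\<And>x y. x \<in> X \<Longrightarrow> y \<in> Y \<Longrightarrow> dist x y \<le> real (k + 1) * C ^ k * diameter X"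
proof -
  have "Y \<in> \<X> n \<and> diameter Y \<le> C ^ k * diameter X \<and> diameter X \<le> C ^ k * diameter Y \<and>
    (\<forall>x\<in>X. \<forall>y\<in>Y. dist x y \<le> real (k + 1) * C ^ k * diameter X)"
    using assms(1)
  proof (induction k arbitrary: Y)
    case 0
    then show ?case using assms(2) dist_le_diameter by auto
  next
    case (Suc k)
    then obtain Z where Z: "(X, Z) \<in> adjacent n ^^ k" "(Z, Y) \<in> adjacent n" by auto
    note IH = Suc.IH[OF Z(1)]
    have ZY: "Z \<in> \<X> n" "Y \<in> \<X> n" "Z \<inter> Y \<noteq> {}" using Z(2) by (auto simp: adjacent_def)
    have dY: "diameter Y \<le> C * diameter Z" "diameter Z \<le> C * diameter Y"
      using same ZY by (auto simp: Int_commute)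
    have "C * diameter Z \<le> C * (C ^ k * diameter X)"
      by (rule mult_left_mono) (use IH C1 in auto)
    then have 1: "diameter Y \<le> C ^ Suc k * diameter X"
      using dY(1) by (simp add: mult.assoc)
    have "C ^ k * diameter Z \<le> C ^ k * (C * diameter Y)"
      by (rule mult_left_mono) (use dY C1 in auto)
    moreover have "diameter X \<le> C ^ k * diameter Z" using IH by blast
    ultimately have 2: "diameter X \<le> C ^ Suc k * diameter Y"
      by (simp add: mult_ac)
    have "dist x y \<le> real (Suc k + 1) * C ^ Suc k * diameter X" if "x \<in> X" "y \<in> Y" for x y
    proof -
      obtain z where z: "z \<in> Z" "z \<in> Y" using ZY by blast
      have X0: "0 \<le> diameter X" using assms(2) tile_bounded diameter_ge_0 by blast
      have "dist x y \<le> dist x z + dist z y" by (rule dist_triangle)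
      also have "dist z y \<le> C ^ Suc k * diameter X"
        using dist_le_diameter[OF ZY(2) z(2) that(2)] 1 by linarith
      also have "dist x z \<le> real (k + 1) * C ^ k * diameter X" using IH that z by blast
      also have "real (k + 1) * C ^ k * diameter X \<le> real (k + 1) * C ^ Suc k * diameter X"
        using C1 X0 by (intro mult_right_mono mult_left_mono power_increasing) auto
      finally show ?thesis by (simp add: algebra_simps)
    qed
    with 1 2 ZY show ?case by blast
  qed
  then show "Y \<in> \<X> n" "diameter Y \<le> C ^ k * diameter X" "diameter X \<le> C ^ k * diameter Y"
    "\<And>x y. x \<in> X \<Longrightarrow> y \<in> Y \<Longrightarrow> dist x y \<le> real (k + 1) * C ^ k * diameter X"
    by auto
qed

lemma adjacent_sym: "(X, Y) \<in> adjacent n ^^ k \<Longrightarrow> (Y, X) \<in> adjacent n ^^ k"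
proof (induction k arbitrary: Y)
  case (Suc k)
  then obtain Z where Z: "(X, Z) \<in> adjacent n ^^ k" "(Z, Y) \<in> adjacent n" by auto
  have "(Y, Z) \<in> adjacent n" using Z(2) by (auto simp: adjacent_def)
  then show ?case using Suc.IH[OF Z(1)] by (rule relpow_Suc_I2)
qed auto

lemma tile_neighborhood_chain:
  assumes "y \<in> tile_neighborhood (\<X> n) w X"
  obtains Y k where "y \<in> Y" "Y \<in> \<X> n" "k \<le> w" "(X, Y) \<in> adjacent n ^^ k"
proof -
  obtain Y k Z where Y: "y \<in> Y" "Y \<in> \<X> n" "k \<le> w" "Z 0 = X" "Z k = Y" "\<forall>j\<le>k. Z j \<in> \<X> n"
      "\<forall>j<k. Z j \<inter> Z (Suc j) \<noteq> {}"
    using assms unfolding tile_neighborhood_def by blast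
  have "(X, Y) \<in> adjacent n ^^ k"
    unfolding relpow_fun_conv by (intro exI[of _ Z]) (use Y in \<open>auto simp: adjacent_def\<close>)
  then show ?thesis using that Y by blast
qed

text \<open>The contrapositive of the separation axiom: the two neighbourhoods of width \<open>w\<close> share a point \<open>p\<close>, and
  the chains to tiles at \<open>p\<close> are joined there by one more step.\<close>

lemma near_tiles_chain:
  assumes X: "X \<in> \<X> n" "x \<in> X" and Y: "Y \<in> \<X> n" "y \<in> Y" and xy: "dist x y < diameter X / C"
  obtains k where "k \<le> 2 * w + 1" "(X, Y) \<in> adjacent n ^^ k"
proof -
  have "tile_dist X Y \<le> ereal (dist x y)"
    unfolding tile_dist_def using X Y by (intro INF_lower2[of x] INF_lower2[of y]) auto
  then have "\<not> ereal (diameter X / C) \<le> tile_dist X Y"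
    using xy by (meson ereal_less_eq(3) less_le_not_le order_trans)
  then obtain p where p: "p \<in> tile_neighborhood (\<X> n) w X" "p \<in> tile_neighborhood (\<X> n) w Y"
    using sep X Y by blast
  obtain V j where V: "p \<in> V" "V \<in> \<X> n" "j \<le> w" "(X, V) \<in> adjacent n ^^ j"
    using tile_neighborhood_chain[OF p(1)] .
  obtain U i where U: "p \<in> U" "U \<in> \<X> n" "i \<le> w" "(Y, U) \<in> adjacent n ^^ i"
    using tile_neighborhood_chain[OF p(2)] .
  have "(V, U) \<in> adjacent n" using V U by (auto simp: adjacent_def)
  then have "(X, U) \<in> adjacent n ^^ Suc j" using V by auto
  moreover have "(U, Y) \<in> adjacent n ^^ i" using adjacent_sym U by blast
  ultimately have "(X, Y) \<in> adjacent n ^^ (Suc j + i)"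
    unfolding relpow_add by blast
  then show ?thesis using that[of "Suc j + i"] V U by simp
qed

lemma chain_image:
  assumes "n \<ge> 1" "(X, Y) \<in> adjacent (n + k) ^^ j"
  shows "((g ^^ k) ` X, (g ^^ k) ` Y) \<in> adjacent n ^^ j"
  using assms(2)
proof (induction j arbitrary: Y)
  case (Suc j)
  then obtain Z where Z: "(X, Z) \<in> adjacent (n + k) ^^ j" "(Z, Y) \<in> adjacent (n + k)" by auto
  have "((g ^^ k) ` Z, (g ^^ k) ` Y) \<in> adjacent n"
    using Z(2) tile_image[OF assms(1)] by (auto simp: adjacent_def)
  then show ?case using Suc.IH[OF Z(1)] by auto
qed auto

definition tile_at :: "nat \<Rightarrow> rsphere \<Rightarrow> rsphere set" where
  "tile_at n x = (SOME X. X \<in> \<X> n \<and> x \<in> X)"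

text \<open>The scale of level \<open>n\<close> at \<open>x\<close>. The choice of the tile matters only up to the factor \<open>C\<close>.\<close>

definition tile_diam :: "nat \<Rightarrow> rsphere \<Rightarrow> real" where
  "tile_diam n x = diameter (tile_at n x)"

lemma tile_at:
  assumes "x \<in> J" shows "tile_at n x \<in> \<X> n" "x \<in> tile_at n x"
  using someI_ex[of "\<lambda>X. X \<in> \<X> n \<and> x \<in> X"] assms cover[of n] unfolding tile_at_def by blast+

lemma tile_diam_pos: "x \<in> J \<Longrightarrow> 0 < tile_diam n x"
  using tile_at[of x n] tile_diameter_pos[of "tile_at n x" n] by (auto simp: tile_diam_def)

lemma tile_diam_Suc: "x \<in> J \<Longrightarrow> tile_diam (Suc n) x \<le> C * tile_diam n x \<and> tile_diam n x \<le> C * tile_diam (Suc n) x"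
  using succ[of "tile_at n x" n "tile_at (Suc n) x"] tile_at[of x] unfolding tile_diam_def by auto

lemma tile_diam_add_le: "x \<in> J \<Longrightarrow> tile_diam n x \<le> C ^ k * tile_diam (n + k) x"
proof (induction k)
  case (Suc k)
  have "C ^ k * tile_diam (n + k) x \<le> C ^ k * (C * tile_diam (Suc (n + k)) x)"
    using tile_diam_Suc[of x "n + k"] Suc.prems C1 by (intro mult_left_mono) auto
  then show ?case using Suc by (simp add: mult_ac)
qed simp

lemma tile_diam_decay: "x \<in> J \<Longrightarrow> tile_diam (n + l * k) x \<le> \<rho> ^ k * tile_diam n x"
proof (induction k)
  case (Suc k)
  have "tile_diam (n + l * k + l) x \<le> \<rho> * tile_diam (n + l * k) x"
    using decay[of "tile_at (n + l * k) x" "n + l * k" "tile_at (n + l * k + l) x"] tile_at[of x] Suc.prems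
    unfolding tile_diam_def by blast
  also have "\<dots> \<le> \<rho> * (\<rho> ^ k * tile_diam n x)" using Suc \<rho>0 by (intro mult_left_mono) auto
  finally show ?case by (simp add: mult_ac add_ac)
qed simp

text \<open>Over multiples of \<open>l\<close> levels the diameter decreases, and the remaining levels, fewer than \<open>l\<close>, cost a factor
  \<open>C\<close> each.\<close>

lemma tile_diam_le_earlier:
  assumes "x \<in> J" shows "tile_diam (n + k) x \<le> C ^ l * tile_diam n x"
proof -
  have up: "tile_diam (m + i) x \<le> C ^ i * tile_diam m x" for m i
  proof (induction i)
    case (Suc i)
    have "tile_diam (Suc (m + i)) x \<le> C * tile_diam (m + i) x" using tile_diam_Suc assms by blast
    also have "\<dots> \<le> C * (C ^ i * tile_diam m x)" using Suc C1 by (intro mult_left_mono) auto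
    finally show ?case by (simp add: mult_ac)
  qed simp
  have "tile_diam (n + k) x = tile_diam (n + l * (k div l) + k mod l) x" by (simp add: add.assoc)
  also have "\<dots> \<le> C ^ (k mod l) * tile_diam (n + l * (k div l)) x" by (rule up)
  also have "\<dots> \<le> C ^ l * tile_diam n x"
  proof (rule mult_mono)
    show "C ^ (k mod l) \<le> C ^ l" using C1 l1 by (intro power_increasing) (auto simp: less_imp_le)
    have "\<rho> ^ (k div l) * tile_diam n x \<le> 1 * tile_diam n x"
      using \<rho>0 \<rho>1 tile_diam_pos[OF assms, of n] by (intro mult_right_mono power_le_one) auto
    then show "tile_diam (n + l * (k div l)) x \<le> tile_diam n x"
      using tile_diam_decay[OF assms, of n "k div l"] by linarith
  qed (use C1 tile_diam_pos[OF assms] in \<open>auto simp: less_imp_le\<close>)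
  finally show ?thesis .
qed

lemma tile_diam_tendsto_0:
  assumes x: "x \<in> J" and e: "e > 0"
  obtains n0 where "\<And>n. n \<ge> n0 \<Longrightarrow> tile_diam n x < e"
proof -
  have "((\<lambda>k. C ^ l * (\<rho> ^ k * tile_diam 0 x)) \<longlongrightarrow> C ^ l * (0 * tile_diam 0 x)) sequentially"
    using \<rho>0 \<rho>1 by (intro tendsto_intros LIMSEQ_power_zero) auto
  then have "eventually (\<lambda>k. C ^ l * (\<rho> ^ k * tile_diam 0 x) < e) sequentially"
    using e by (intro order_tendstoD(2)) auto
  then obtain k where k: "C ^ l * (\<rho> ^ k * tile_diam 0 x) < e"
    by (auto simp: eventually_sequentially)
  show ?thesis
  proof (rule that[of "l * k"])
    fix n assume "n \<ge> l * k"
    then have "tile_diam n x \<le> C ^ l * tile_diam (l * k) x"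
      using tile_diam_le_earlier[OF x, of "l * k" "n - l * k"] by simp
    also have "\<dots> \<le> C ^ l * (\<rho> ^ k * tile_diam 0 x)"
      using tile_diam_decay[OF x, of 0 k] C1 by (intro mult_left_mono) auto
    finally show "tile_diam n x < e" using k by linarith
  qed
qed

text \<open>For a chain of up to \<open>2 * w + 2\<close> tiles, it bounds the distance from a point of the first tile to a
  point of the last one, relative to the diameter of the first.\<close>

definition chain_const :: real where
  "chain_const = real (2 * w + 2) * C ^ (2 * w + 1)"

lemma chain_const_bounds:
  assumes "k \<le> 2 * w + 1"
  shows "real (k + 1) * C ^ k \<le> chain_const" "C ^ k \<le> chain_const" "1 \<le> chain_const"
proof -
  have *: "C ^ k \<le> C ^ (2 * w + 1)" using C1 assms by (intro power_increasing) auto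
  show "real (k + 1) * C ^ k \<le> chain_const"
    unfolding chain_const_def using assms C1 * by (intro mult_mono) auto
  have "1 * C ^ (2 * w + 1) \<le> chain_const"
    unfolding chain_const_def using C1 by (intro mult_right_mono) auto
  moreover have "1 \<le> C ^ (2 * w + 1)" using C1 by (rule one_le_power)
  ultimately show "C ^ k \<le> chain_const" "1 \<le> chain_const" using * by linarith+
qed

text \<open>Nearby points of the Julia set are joined by a short chain of tiles, and \<open>g ^^ k\<close> maps it to a short
  chain of tiles of level \<open>n\<close>.\<close>

lemma near_points_image:
  assumes n: "n \<ge> 1" and c: "c \<in> J" and v: "v \<in> J" and near: "dist v c < tile_diam (n + k) c / C"
  shows "dist ((g ^^ k) v) ((g ^^ k) c) \<le> chain_const * diameter ((g ^^ k) ` tile_at (n + k) c)"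
proof -
  let ?T = "tile_at (n + k) c"
  obtain j where j: "j \<le> 2 * w + 1" "(?T, tile_at (n + k) v) \<in> adjacent (n + k) ^^ j"
    using near_tiles_chain[OF tile_at[OF c] tile_at[OF v]] near
    by (metis dist_commute tile_diam_def)
  have im: "(g ^^ k) ` ?T \<in> \<X> n" using tile_image[OF n] tile_at[OF c] by blast
  have "dist ((g ^^ k) c) ((g ^^ k) v) \<le> real (j + 1) * C ^ j * diameter ((g ^^ k) ` ?T)"
    using chain_bounds(4)[OF chain_image[OF n j(2)] im] tile_at[OF c] tile_at[OF v] by blast
  also have "\<dots> \<le> chain_const * diameter ((g ^^ k) ` ?T)"
    using chain_const_bounds[OF j(1)] diameter_ge_0[OF tile_bounded[OF im]] by (intro mult_right_mono) auto
  finally show ?thesis by (simp add: dist_commute)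
qed

lemma near_tile_diam:
  assumes X: "X \<in> \<X> n" "y \<in> X" and c: "c \<in> J" and near: "dist y c < tile_diam n c / C"
  shows "diameter X \<le> chain_const * tile_diam n c" "tile_diam n c \<le> chain_const * diameter X"
proof -
  obtain j where j: "j \<le> 2 * w + 1" "(tile_at n c, X) \<in> adjacent n ^^ j"
    using near_tiles_chain[OF tile_at[OF c] X] near by (metis dist_commute tile_diam_def)
  note b = chain_bounds(2,3)[OF j(2) tile_at(1)[OF c]]
  have "C ^ j * diameter (tile_at n c) \<le> chain_const * diameter (tile_at n c)"
    "C ^ j * diameter X \<le> chain_const * diameter X"
    using chain_const_bounds[OF j(1)] diameter_ge_0[OF tile_bounded[OF X(1)]]
      diameter_ge_0[OF tile_bounded[OF tile_at(1)[OF c]]] by (auto intro!: mult_right_mono)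
  then show "diameter X \<le> chain_const * tile_diam n c" "tile_diam n c \<le> chain_const * diameter X"
    using b unfolding tile_diam_def by linarith+
qed

subsection \<open>Fixed points with multiplier one\<close>

text \<open>The tile of level \<open>1 + N * j\<close> at the fixed point has diameter of order \<open>\<rho> ^ j\<close>. Its image under \<open>j\<close>
  applications of \<open>g ^^ N\<close>, each of which expands by at most \<open>1 + \<epsilon>\<close>, is a tile of level 1 and hence has
  diameter bounded below. This is absurd for large \<open>j\<close>, since \<open>(1 + \<epsilon>) * \<rho> < 1\<close>.\<close>

lemma no_fixed_point_with_multiplier_one:
  assumes x: "chart b z0 \<in> J" and N: "N \<ge> 1" "l dvd N"
    and fp: "(g ^^ N) (chart b z0) = chart b z0"
    and der: "((\<lambda>z. coord b ((g ^^ N) (chart b z))) has_field_derivative 1) (at z0)"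
  shows False
proof -
  obtain q where q: "N = l * q" "q \<ge> 1" using N by (metis One_nat_def Suc_leI dvdE gr0I mult_0_right not_one_le_zero)
  define L where "L = (\<lambda>z. coord b ((g ^^ N) (chart b z)))"
  obtain s where s: "s > 0" "\<And>z. z \<in> ball z0 s \<Longrightarrow> (g ^^ N) (chart b z) = chart b (L z)"
    using rational_map_local_holomorphic[OF rat fp] unfolding L_def by metis
  have Lz0: "L z0 = z0" by (simp add: L_def fp)
  define \<epsilon> where "\<epsilon> = (1 - \<rho>) / 2"
  define \<theta> where "\<theta> = (1 + \<epsilon>) * \<rho>"
  have \<epsilon>: "\<epsilon> > 0" using \<rho>1 by (simp add: \<epsilon>_def)
  have \<theta>: "0 \<le> \<theta>" "\<theta> < 1"
  proof -
    show "0 \<le> \<theta>" using \<epsilon> \<rho>0 by (simp add: \<theta>_def)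
    have "\<epsilon> * \<rho> < \<epsilon> * 2" using \<epsilon> \<rho>1 by (intro mult_strict_left_mono) auto
    moreover have "\<rho> + 2 * \<epsilon> = 1" by (simp add: \<epsilon>_def field_simps)
    moreover have "\<theta> = \<rho> + \<epsilon> * \<rho>" by (simp add: \<theta>_def distrib_right)
    ultimately show "\<theta> < 1" by linarith
  qed
  have "((\<lambda>z. norm ((L z - L z0) / (z - z0))) \<longlongrightarrow> norm (1::complex)) (at z0)"
    using der unfolding has_field_derivative_iff L_def by (rule tendsto_norm)
  then have "eventually (\<lambda>z. norm ((L z - L z0) / (z - z0)) < 1 + \<epsilon>) (at z0)"
    using \<epsilon> by (intro order_tendstoD(2)) auto
  then obtain t where t: "t > 0" "\<And>z. z \<noteq> z0 \<Longrightarrow> dist z z0 < t \<Longrightarrow> norm ((L z - L z0) / (z - z0)) < 1 + \<epsilon>"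
    unfolding eventually_at by auto
  have Lbd: "norm (L z - z0) \<le> (1 + \<epsilon>) * norm (z - z0)" if "norm (z - z0) < t" for z
    using t(2)[of z] that Lz0 by (cases "z = z0") (auto simp: dist_norm norm_divide field_simps)
  define \<delta> where "\<delta> = min s t"
  have \<delta>: "\<delta> > 0" using s t by (simp add: \<delta>_def)
  obtain \<delta>1 K where dK: "0 < \<delta>1" "1 \<le> K"
    "\<And>v. dist v (chart b z0) < \<delta>1 \<Longrightarrow> \<exists>z. v = chart b z \<and> norm (z - z0) \<le> K * dist v (chart b z0)"
    using chart_local_inverse[of b z0] by metis
  define x where "x = chart b z0"
  define r1 where "r1 = tile_diam 1 x"
  have r1: "r1 > 0" using tile_diam_pos assms(1) by (simp add: r1_def x_def)
  have "((\<lambda>j. \<theta> ^ j * (K * r1)) \<longlongrightarrow> 0 * (K * r1)) sequentially"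
    using \<theta> by (intro tendsto_intros LIMSEQ_power_zero) auto
  then have "eventually (\<lambda>j. \<theta> ^ j * (K * r1) < min \<delta> (diameter J / (5 * C))) sequentially"
    using \<delta> diameter_J_pos C1 by (intro order_tendstoD(2)) auto
  moreover have "((\<lambda>j. \<rho> ^ j * r1) \<longlongrightarrow> 0 * r1) sequentially"
    using \<rho>0 \<rho>1 by (intro tendsto_intros LIMSEQ_power_zero) auto
  then have "eventually (\<lambda>j. \<rho> ^ j * r1 < \<delta>1) sequentially"
    using dK by (intro order_tendstoD(2)) auto
  ultimately have "eventually (\<lambda>j. \<theta> ^ j * (K * r1) < min \<delta> (diameter J / (5 * C)) \<and> \<rho> ^ j * r1 < \<delta>1) sequentially"
    by (rule eventually_conj)
  then obtain j where j: "\<theta> ^ j * (K * r1) < min \<delta> (diameter J / (5 * C))" "\<rho> ^ j * r1 < \<delta>1"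
    by (auto simp: eventually_sequentially)
  let ?T = "tile_at (1 + N * j) x"
  note T = tile_at[OF assms(1)[folded x_def], of "1 + N * j"]
  have sc: "tile_diam (1 + N * j) x \<le> \<rho> ^ j * r1"
  proof -
    have "tile_diam (1 + l * (q * j)) x \<le> \<rho> ^ (q * j) * r1"
      using tile_diam_decay[of x 1 "q * j"] assms(1) by (simp add: x_def r1_def)
    also have "\<dots> \<le> \<rho> ^ j * r1"
      using \<rho>0 \<rho>1 r1 q by (intro mult_right_mono power_decreasing) auto
    finally show ?thesis using q by (simp add: mult.assoc)
  qed
  have close: "dist ((g ^^ (N * j)) v) x \<le> 2 * (\<theta> ^ j * (K * r1))" if v: "v \<in> ?T" for v
  proof -
    have "dist v x \<le> tile_diam (1 + N * j) x"
      unfolding tile_diam_def by (rule dist_le_diameter[OF T(1) v T(2)])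
    then have dv: "dist v x \<le> \<rho> ^ j * r1" using sc by linarith
    then obtain z where z: "v = chart b z" "norm (z - z0) \<le> K * dist v x"
      using dK(3)[of v] j(2) by (auto simp: x_def)
    have nz: "norm (z - z0) \<le> K * (\<rho> ^ j * r1)"
      using z(2) mult_left_mono[OF dv, of K] dK(2) by linarith
    have "\<exists>z'. (g ^^ (N * i)) v = chart b z' \<and> norm (z' - z0) \<le> (1 + \<epsilon>) ^ i * norm (z - z0)" if "i \<le> j" for i
      using that
    proof (induction i)
      case 0
      then show ?case using z by (intro exI[of _ z]) simp
    next
      case (Suc i)
      then obtain z' where z': "(g ^^ (N * i)) v = chart b z'" "norm (z' - z0) \<le> (1 + \<epsilon>) ^ i * norm (z - z0)" by auto
      have "(1 + \<epsilon>) ^ i * norm (z - z0) \<le> (1 + \<epsilon>) ^ j * (K * (\<rho> ^ j * r1))"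
        using nz Suc.prems \<epsilon> by (intro mult_mono power_increasing) auto
      also have "\<dots> = \<theta> ^ j * (K * r1)" by (simp add: \<theta>_def power_mult_distrib)
      finally have small: "norm (z' - z0) < \<delta>" using z'(2) j(1) by linarith
      have "(g ^^ (N * Suc i)) v = (g ^^ N) (chart b z')"
        using z'(1) by (simp add: funpow_add)
      also have "\<dots> = chart b (L z')"
        using small by (intro s(2)) (simp add: \<delta>_def dist_norm norm_minus_commute)
      finally have "(g ^^ (N * Suc i)) v = chart b (L z')" .
      moreover have "norm (L z' - z0) \<le> (1 + \<epsilon>) * norm (z' - z0)"
        using small by (intro Lbd) (simp add: \<delta>_def)
      moreover have "(1 + \<epsilon>) * norm (z' - z0) \<le> (1 + \<epsilon>) * ((1 + \<epsilon>) ^ i * norm (z - z0))"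
        using z'(2) \<epsilon> by (intro mult_left_mono) auto
      ultimately show ?case by (intro exI[of _ "L z'"]) (simp add: mult.assoc)
    qed
    from this[of j] obtain z' where z': "(g ^^ (N * j)) v = chart b z'" "norm (z' - z0) \<le> (1 + \<epsilon>) ^ j * norm (z - z0)" by auto
    have "(1 + \<epsilon>) ^ j * norm (z - z0) \<le> (1 + \<epsilon>) ^ j * (K * (\<rho> ^ j * r1))"
      using nz \<epsilon> by (intro mult_left_mono) auto
    also have "\<dots> = \<theta> ^ j * (K * r1)" by (simp add: \<theta>_def power_mult_distrib)
    finally show ?thesis
      using z' dist_chart_le[of b z' z0] by (simp add: x_def)
  qed
  have Timg: "(g ^^ (N * j)) ` ?T \<in> \<X> 1" using tile_image[of 1 ?T "N * j"] T(1) by simp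
  have fx: "(g ^^ (N * j)) x = x"
    unfolding funpow_mult[symmetric] x_def by (rule iterate_fixed[of "g ^^ N", OF fp])
  have xin: "x \<in> (g ^^ (N * j)) ` ?T" using fx T(2) by (metis image_eqI)
  define E where "E = \<theta> ^ j * (K * r1)"
  have "diameter ((g ^^ (N * j)) ` ?T) \<le> 2 * (2 * E)"
    unfolding E_def by (rule diameter_le_of_dist[OF xin]) (use close in auto)
  then have "C * diameter ((g ^^ (N * j)) ` ?T) \<le> C * (2 * (2 * E))"
    using C1 by (intro mult_left_mono) auto
  also have "\<dots> = 4 * (C * E)" by simp
  finally have "C * diameter ((g ^^ (N * j)) ` ?T) \<le> 4 * (C * E)" .
  moreover have "diameter J \<le> C * diameter ((g ^^ (N * j)) ` ?T)"
    using succ[of J 0 "(g ^^ (N * j)) ` ?T"] level0 Timg xin assms(1) by (auto simp: x_def)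
  moreover have "5 * (C * E) < diameter J"
    using j(1) C1 by (simp add: E_def field_simps)
  ultimately show False using diameter_J_pos by linarith
qed

end

section \<open>Critical points\<close>

text \<open>An open continuous injection is a homeomorphism onto its image.\<close>

lemma locally_injective_not_critical:
  assumes g: "rational_map_of_degree g d" and d: "d \<ge> 1" and r: "r > 0"
    and inj: "inj_on (\<lambda>z. g (chart b z)) (ball z0 r)"
  shows "\<not> critical_point g (chart b z0)"
proof -
  define U where "U = chart b ` ball z0 r"
  have opU: "open U" unfolding U_def by (rule open_chart_image) simp
  have injU: "inj_on g U" using inj unfolding U_def by (auto simp: inj_on_def)
  have op: "open (g ` W)" if "open W" for W using rational_map_open[OF g d that] .
  obtain h where "homeomorphism U (g ` U) g h"
  proof (rule homeomorphism_injective_open_map[of U g "g ` U"])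
    show "continuous_on U g"
      using rational_map_continuous[OF g] continuous_on_subset by blast
    show "openin (top_of_set (g ` U)) (g ` W)" if "openin (top_of_set U) W" for W
      using that op[of W] opU op[OF opU] by (simp add: openin_open_eq image_mono)
  qed (use injU in auto)
  then show ?thesis
    using opU op[OF opU] r unfolding critical_point_def U_def by (metis centre_in_ball imageI)
qed

text \<open>A nonzero derivative would make \<open>g ^^ k\<close>, and therefore \<open>g\<close>, injective near the point.\<close>

lemma critical_point_derivative_zero:
  assumes g: "rational_map_of_degree g d" and d: "d \<ge> 1" and k: "k \<ge> 1"
    and crit: "critical_point g (chart b z0)"
    and P: "P holomorphic_on UNIV" and Q: "Q holomorphic_on UNIV" and Q0: "Q z0 \<noteq> 0"
    and eq: "\<And>z. (g ^^ k) (chart b z) = chart_proj b' (P z) (Q z)"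
  shows "deriv (\<lambda>z. P z / Q z) z0 = 0"
proof (rule ccontr)
  assume nz: "deriv (\<lambda>z. P z / Q z) z0 \<noteq> 0"
  have cQ: "continuous_on UNIV Q" using Q by (rule holomorphic_on_imp_continuous_on)
  then obtain s where s: "s > 0" "\<And>z. z \<in> ball z0 s \<Longrightarrow> Q z \<noteq> 0"
    using continuous_on_open_avoid[of UNIV Q z0 0] Q0 by (auto simp: dist_commute)
  have "(\<lambda>z. P z / Q z) holomorphic_on ball z0 s"
    using s(2) by (intro holomorphic_intros holomorphic_on_subset[OF P] holomorphic_on_subset[OF Q]) auto
  then obtain r where r: "r > 0" "ball z0 r \<subseteq> ball z0 s" "inj_on (\<lambda>z. P z / Q z) (ball z0 r)"
    using has_complex_derivative_locally_injective[OF _ _ open_ball nz] s(1) by (metis centre_in_ball)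
  have "inj_on (\<lambda>z. g (chart b z)) (ball z0 r)"
  proof (rule inj_onI)
    fix z z' assume z: "z \<in> ball z0 r" "z' \<in> ball z0 r" "g (chart b z) = g (chart b z')"
    obtain j where j: "k = Suc j" using k by (cases k) auto
    have "(g ^^ k) (chart b z) = (g ^^ k) (chart b z')"
      using z(3) by (simp add: j funpow_Suc_right del: funpow.simps)
    then have "chart b' (P z / Q z) = chart b' (P z' / Q z')"
      unfolding eq using s(2) z r(2) by (simp add: chart_proj_eq_chart subset_eq)
    then show "z = z'" using r(3) z by (auto dest: inj_onD)
  qed
  then show False using locally_injective_not_critical[OF g d r(1)] crit by blast
qed

context dynamical_tiling
begin

text \<open>A kind of uniform perfectness. The tile at the base point that lies \<open>l * q\<close> levels before \<open>n\<close> is larger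
  than the one of level \<open>n\<close> by a factor between \<open>\<rho> ^ -q\<close> and \<open>C ^ (l * q)\<close>, and it contains a point whose
  distance from the base point exceeds a third of its diameter.\<close>

lemma far_point:
  assumes c: "chart b z0 \<in> J" and B: "B \<ge> 1"
  obtains D n1 where "D \<ge> 1" "\<And>n. n \<ge> n1 \<Longrightarrow> \<exists>u. chart b u \<in> J \<and>
    B * tile_diam n (chart b z0) \<le> norm (u - z0) \<and> norm (u - z0) \<le> D * tile_diam n (chart b z0) \<and>
    B * tile_diam n (chart b z0) < dist (chart b u) (chart b z0)"
proof -
  let ?c = "chart b z0"
  obtain \<delta> K where dK: "0 < \<delta>" "1 \<le> K"
    "\<And>v. dist v ?c < \<delta> \<Longrightarrow> \<exists>z. v = chart b z \<and> norm (z - z0) \<le> K * dist v ?c"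
    using chart_local_inverse[of b z0] by metis
  obtain n0 where n0: "\<And>n. n \<ge> n0 \<Longrightarrow> tile_diam n ?c < \<delta>"
    using tile_diam_tendsto_0[OF c dK(1)] by metis
  obtain q where q: "\<rho> ^ q < 1 / (6 * B)"
    using real_arch_pow_inv[of "1 / (6 * B)" \<rho>] \<rho>1 B by auto
  show ?thesis
  proof (rule that[of "K * C ^ (l * q)" "n0 + l * q"])
    show "1 \<le> K * C ^ (l * q)" using mult_mono[of 1 K 1 "C ^ (l * q)"] dK(2) C1 by simp
    fix n assume n: "n \<ge> n0 + l * q"
    define p where "p = n - l * q"
    have p: "n = p + l * q" "p \<ge> n0" using n by (auto simp: p_def)
    let ?T = "tile_at p ?c"
    note T = tile_at[OF c, of p]
    have Rp: "0 < tile_diam p ?c" using tile_diam_pos[OF c] .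
    have "\<exists>v\<in>?T. tile_diam p ?c / 3 < dist v ?c"
    proof (rule ccontr)
      assume "\<not> ?thesis"
      then have "diameter ?T \<le> 2 * (tile_diam p ?c / 3)"
        by (intro diameter_le_of_dist[OF T(2)]) (auto simp: not_less)
      then show False using Rp by (simp add: tile_diam_def)
    qed
    then obtain v where v: "v \<in> ?T" "tile_diam p ?c / 3 < dist v ?c" by blast
    have up: "dist v ?c \<le> tile_diam p ?c"
      unfolding tile_diam_def by (rule dist_le_diameter[OF T(1) v(1) T(2)])
    then obtain u where u: "v = chart b u" "norm (u - z0) \<le> K * dist v ?c"
      using dK(3)[of v] n0[OF p(2)] by auto
    have "tile_diam n ?c \<le> \<rho> ^ q * tile_diam p ?c" unfolding p(1) by (rule tile_diam_decay[OF c])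
    also have "\<dots> \<le> 1 / (6 * B) * tile_diam p ?c" using q Rp by (intro mult_right_mono) auto
    finally have "2 * (B * tile_diam n ?c) \<le> tile_diam p ?c / 3" using B by (simp add: field_simps)
    then have far: "2 * (B * tile_diam n ?c) < dist v ?c" using v(2) by linarith
    moreover have "dist v ?c \<le> 2 * norm (u - z0)" unfolding u(1) by (rule dist_chart_le)
    ultimately have "B * tile_diam n ?c \<le> norm (u - z0)" by linarith
    moreover have "B * tile_diam n ?c < dist (chart b u) ?c"
    proof -
      have "0 < B * tile_diam n ?c" using B tile_diam_pos[OF c, of n] by simp
      then show ?thesis using far unfolding u(1) by linarith
    qed
    moreover have "norm (u - z0) \<le> K * C ^ (l * q) * tile_diam n ?c"
    proof -
      have "tile_diam p ?c \<le> C ^ (l * q) * tile_diam n ?c" unfolding p(1) by (rule tile_diam_add_le[OF c])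
      then have "K * dist v ?c \<le> K * (C ^ (l * q) * tile_diam n ?c)"
        using up dK(2) by (intro mult_left_mono) auto
      then show ?thesis using u(2) by (simp add: mult.assoc)
    qed
    moreover have "chart b u \<in> J" using v(1) u(1) tile_subset[OF T(1)] by auto
    ultimately show "\<exists>u. chart b u \<in> J \<and> B * tile_diam n ?c \<le> norm (u - z0) \<and>
        norm (u - z0) \<le> K * C ^ (l * q) * tile_diam n ?c \<and> B * tile_diam n ?c < dist (chart b u) ?c"
      by blast
  qed
qed

text \<open>Read as a statement about omitted values: on the disc in question, \<open>g ^^ k\<close> takes no value in the
  Julia set at a large distance from \<open>c\<close>, because preimages of points of the Julia set lie in the Julia
  set, where the tiles control \<open>g ^^ k\<close>.\<close>

lemma J_point_near_image:
  assumes n: "n \<ge> 1" and c: "c \<in> J" and v: "(g ^^ k) v \<in> J" and near: "dist v c < tile_diam (n + k) c / C"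
    and ret: "dist ((g ^^ k) c) c < tile_diam n c / C"
  shows "dist ((g ^^ k) v) c \<le> (chain_const\<^sup>2 + 1) * tile_diam n c"
proof -
  have vJ: "v \<in> J" using julia_set_backward[OF rat d1 v] .
  have im: "(g ^^ k) ` tile_at (n + k) c \<in> \<X> n" "(g ^^ k) c \<in> (g ^^ k) ` tile_at (n + k) c"
    using tile_image[OF n] tile_at[OF c] by blast+
  have "1 \<le> chain_const" using chain_const_bounds(3)[of 0] by simp
  have "dist ((g ^^ k) v) ((g ^^ k) c) \<le> chain_const * diameter ((g ^^ k) ` tile_at (n + k) c)"
    by (rule near_points_image[OF n c vJ near])
  also have "\<dots> \<le> chain_const * (chain_const * tile_diam n c)"
    using near_tile_diam(1)[OF im c ret] \<open>1 \<le> chain_const\<close> by (intro mult_left_mono) auto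
  finally have "dist ((g ^^ k) v) ((g ^^ k) c) \<le> chain_const\<^sup>2 * tile_diam n c"
    by (simp add: power2_eq_square mult.assoc)
  moreover have "tile_diam n c / C \<le> tile_diam n c"
    using C1 tile_diam_pos[OF c, of n] by (simp add: divide_le_eq mult_le_cancel_left1)
  ultimately show ?thesis
    using dist_triangle[of "(g ^^ k) v" c "(g ^^ k) c"] ret by (simp add: distrib_right)
qed

text \<open>The constants are uniform in \<open>n\<close> and \<open>k\<close>. Three points of the Julia set at distances comparable to the tile
  diameter of level \<open>n\<close> are omitted by \<open>g ^^ k\<close> near the critical point, and the quadratic estimate for
  functions that omit three values applies at this scale.\<close>

lemma critical_return_estimate:
  assumes c: "chart b z0 \<in> J" and crit: "critical_point g (chart b z0)"
  obtains n1 B1 B2 where "n1 \<ge> 1" "B1 > 0" "B2 > 0"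
    "\<And>n k z. n \<ge> n1 \<Longrightarrow> k \<ge> 1 \<Longrightarrow> dist ((g ^^ k) (chart b z0)) (chart b z0) < tile_diam n (chart b z0) / C \<Longrightarrow>
      norm (z - z0) < B1 * tile_diam (n + k) (chart b z0) \<Longrightarrow>
      dist ((g ^^ k) (chart b z)) ((g ^^ k) (chart b z0)) \<le>
        B2 * tile_diam n (chart b z0) * (norm (z - z0) / tile_diam (n + k) (chart b z0))\<^sup>2"
proof -
  let ?c = "chart b z0"
  obtain \<delta> K where dK: "0 < \<delta>" "1 \<le> K"
    "\<And>v. dist v ?c < \<delta> \<Longrightarrow> \<exists>z. v = chart b z \<and> norm (z - z0) \<le> K * dist v ?c"
    using chart_local_inverse[of b z0] by metis
  obtain n0 where n0: "\<And>n. n \<ge> n0 \<Longrightarrow> tile_diam n ?c < \<delta>"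
    using tile_diam_tendsto_0[OF c dK(1)] by metis
  (* The omitted values a, e, b are chosen in this order, each far beyond the previous ones in units of
     r = tile_diam n c, so that their mutual distances and those from the centre value lie in [r, D r]. *)
  define Ba where "Ba = chain_const\<^sup>2 + 1 + K"
  have Ba: "chain_const\<^sup>2 + 1 \<le> Ba" "1 \<le> Ba" "K \<le> Ba" using dK by (auto simp: Ba_def add_nonneg_pos)
  obtain Da na where a: "Da \<ge> 1" "\<And>n. n \<ge> na \<Longrightarrow> \<exists>u. chart b u \<in> J \<and>
    Ba * tile_diam n ?c \<le> norm (u - z0) \<and> norm (u - z0) \<le> Da * tile_diam n ?c \<and> Ba * tile_diam n ?c < dist (chart b u) ?c"
    by (rule far_point[OF c Ba(2)]) blast
  define Be where "Be = Ba + Da + K + 1"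
  have Be: "1 \<le> Be" "Ba \<le> Be" using Ba a dK by (auto simp: Be_def)
  obtain De ne where e: "De \<ge> 1" "\<And>n. n \<ge> ne \<Longrightarrow> \<exists>u. chart b u \<in> J \<and>
    Be * tile_diam n ?c \<le> norm (u - z0) \<and> norm (u - z0) \<le> De * tile_diam n ?c \<and> Be * tile_diam n ?c < dist (chart b u) ?c"
    by (rule far_point[OF c Be(1)]) blast
  define Bb where "Bb = Ba + Da + De + 1"
  have Bb: "1 \<le> Bb" "Ba \<le> Bb" using Ba a e by (auto simp: Bb_def)
  obtain Db nb where bb: "Db \<ge> 1" "\<And>n. n \<ge> nb \<Longrightarrow> \<exists>u. chart b u \<in> J \<and>
    Bb * tile_diam n ?c \<le> norm (u - z0) \<and> norm (u - z0) \<le> Db * tile_diam n ?c \<and> Bb * tile_diam n ?c < dist (chart b u) ?c"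
    by (rule far_point[OF c Bb(1)]) blast
  define D where "D = Da + De + Db + K"
  have D: "D \<ge> 1" using a e bb dK by (simp add: D_def)
  define W where "W = omitting_const D * D\<^sup>2"
  define M where "M = omitting_const D * D ^ 3"
  have oc: "omitting_const D > 0" unfolding omitting_const_def by (simp add: add_pos_nonneg)
  have W: "W > 0" "M > 0" using oc D by (simp_all add: W_def M_def)
  show ?thesis
  proof (rule that[of "Suc (n0 + na + ne + nb)" "1 / (2 * C) / (8 * W)" "64 * M * (2 * C)\<^sup>2"])
    show "0 < 1 / (2 * C) / (8 * W)" "0 < 64 * M * (2 * C)\<^sup>2" using W C1 by simp_all
    fix n k z
    assume n: "n \<ge> Suc (n0 + na + ne + nb)" and k: "k \<ge> 1"
      and ret: "dist ((g ^^ k) ?c) ?c < tile_diam n ?c / C"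
      and z: "norm (z - z0) < 1 / (2 * C) / (8 * W) * tile_diam (n + k) ?c"
    define r where "r = tile_diam n ?c"
    define s where "s = tile_diam (n + k) ?c / (2 * C)"
    have r: "r > 0" and s: "s > 0" using tile_diam_pos[OF c] C1 by (simp_all add: r_def s_def)
    obtain ua where ua: "chart b ua \<in> J" "Ba * r \<le> norm (ua - z0)" "norm (ua - z0) \<le> Da * r" "Ba * r < dist (chart b ua) ?c"
      using a(2)[of n] n unfolding r_def by auto
    obtain ue where ue: "chart b ue \<in> J" "Be * r \<le> norm (ue - z0)" "norm (ue - z0) \<le> De * r" "Be * r < dist (chart b ue) ?c"
      using e(2)[of n] n unfolding r_def by auto
    obtain ub where ub: "chart b ub \<in> J" "Bb * r \<le> norm (ub - z0)" "norm (ub - z0) \<le> Db * r" "Bb * r < dist (chart b ub) ?c"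
      using bb(2)[of n] n unfolding r_def by auto
    obtain P Q where PQ: "P holomorphic_on UNIV" "Q holomorphic_on UNIV"
      "\<And>z. P z \<noteq> 0 \<or> Q z \<noteq> 0" "\<And>z. (g ^^ k) (chart b z) = chart_proj b (P z) (Q z)"
      using rational_map_iterate_chart[OF rat] by metis
    have iff: "(g ^^ k) (chart b z) = chart b u \<longleftrightarrow> P z = u * Q z" for z u
      unfolding PQ(4) by (rule chart_proj_eq_chart_iff[OF PQ(3)])
    have rC: "r / C \<le> r" using C1 r by (simp add: divide_le_eq mult_le_cancel_left1)
    have "dist ((g ^^ k) ?c) ?c < \<delta>" using ret rC n0[of n] n unfolding r_def by auto
    then obtain u0 where u0: "(g ^^ k) ?c = chart b u0" "norm (u0 - z0) \<le> K * dist ((g ^^ k) ?c) ?c"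
      using dK(3) by blast
    have Q0: "Q z0 \<noteq> 0" using u0(1) iff PQ(3)[of z0] by auto
    have u0': "u0 = P z0 / Q z0" using u0(1) iff Q0 by simp
    have "K * dist ((g ^^ k) ?c) ?c \<le> K * r"
      using ret rC dK(2) unfolding r_def by (intro mult_left_mono) auto
    then have u0r: "norm (u0 - z0) \<le> K * r" using u0(2) by linarith
    have omit: "P z \<noteq> u * Q z" if zs: "z \<in> ball z0 s" and u: "chart b u \<in> J" "Ba * r < dist (chart b u) ?c" for z u
    proof
      assume "P z = u * Q z"
      then have eq: "(g ^^ k) (chart b z) = chart b u" using iff by blast
      have "norm (z - z0) < s" using zs by (simp add: dist_norm norm_minus_commute)
      then have "dist (chart b z) ?c < tile_diam (n + k) ?c / C"
        using dist_chart_le[of b z z0] by (simp add: s_def field_simps)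
      then have "dist (chart b u) ?c \<le> (chain_const\<^sup>2 + 1) * r"
        using J_point_near_image[of n ?c k "chart b z"] n c u(1) ret unfolding eq r_def by simp
      also have "\<dots> \<le> Ba * r" using Ba(1) r by (intro mult_right_mono) auto
      finally show False using u(2) by linarith
    qed
    have Br: "Ba * r \<le> Be * r" "Ba * r \<le> Bb * r" using Be Bb r by (auto intro: mult_right_mono)
    have tri: "norm (x - y) \<le> norm (x - z0) + norm (y - z0)" "norm (x - z0) - norm (y - z0) \<le> norm (x - y)"
      "norm (y - z0) - norm (x - z0) \<le> norm (x - y)" for x y :: complex
      using norm_triangle_ineq4[of "x - z0" "y - z0"] norm_triangle_ineq2[of "x - z0" "y - z0"]
        norm_triangle_ineq2[of "y - z0" "x - z0"] by (auto simp: norm_minus_commute)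
    have Dr: "D * r = Da * r + De * r + Db * r + K * r" "Be * r = Ba * r + Da * r + K * r + r"
      "Bb * r = Ba * r + Da * r + De * r + r"
      by (simp_all add: D_def Be_def Bb_def distrib_right)
    have pos: "0 < Ba * r" "0 < Da * r" "0 < De * r" "0 < Db * r" "0 < K * r"
      using Ba a e bb dK r by simp_all
    have z': "norm (z - z0) < s / (8 * (omitting_const D * D\<^sup>2))"
      using z by (simp add: s_def W_def[symmetric])
    have oa: "P z \<noteq> ua * Q z" if "z \<in> ball z0 s" for z using omit[OF that ua(1,4)] .
    have ob: "P z \<noteq> ub * Q z" if "z \<in> ball z0 s" for z
      using omit[OF that ub(1)] ub(4) Br(2) by linarith
    have oe: "P z \<noteq> ue * Q z" if "z \<in> ball z0 s" for z
      using omit[OF that ue(1)] ue(4) Br(1) by linarith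
    have upper: "norm (ub - ue) \<le> D * r" "norm (u0 - ua) \<le> D * r" "norm (ub - ua) \<le> D * r"
        "norm (u0 - ue) \<le> D * r"
      using tri(1)[of ub ue] tri(1)[of u0 ua] tri(1)[of ub ua] tri(1)[of u0 ue] ua ub ue u0r Dr pos
      by linarith+
    have lower: "r \<le> norm (ub - ue)" "r \<le> norm (ub - ua)" "r \<le> norm (u0 - ue)" "r \<le> norm (ua - ue)"
      using tri(2)[of ub ue] tri(2)[of ub ua] tri(3)[of ue u0] tri(3)[of ue ua] ua ub ue u0r Dr pos
      by linarith+
    have d0: "deriv (\<lambda>z. P z / Q z) z0 = 0"
      by (rule critical_point_derivative_zero[OF rat d1 k crit PQ(1,2) Q0 PQ(4)])
    note est = omitting_three_values_bound[OF D s r holomorphic_on_subset[OF PQ(1) subset_UNIV]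
      holomorphic_on_subset[OF PQ(2) subset_UNIV] oa ob oe Q0 u0' upper lower d0 z']
    have est': "Q z \<noteq> 0" "norm (P z / Q z - u0) \<le> 32 * M * r * (norm (z - z0) / s)\<^sup>2"
      using est by (simp_all only: M_def not_False_eq_True)
    have "(g ^^ k) (chart b z) = chart b (P z / Q z)"
      unfolding PQ(4) using est'(1) by (rule chart_proj_eq_chart)
    then have "dist ((g ^^ k) (chart b z)) ((g ^^ k) ?c) \<le> 2 * norm (P z / Q z - u0)"
      unfolding u0(1) using dist_chart_le by simp
    also have "\<dots> \<le> 2 * (32 * M * r * (norm (z - z0) / s)\<^sup>2)" using est' by simp
    also have "\<dots> = 64 * M * (2 * C)\<^sup>2 * r * (norm (z - z0) / tile_diam (n + k) ?c)\<^sup>2"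
      by (simp add: s_def power_mult_distrib power_divide)
    finally show "dist ((g ^^ k) (chart b z)) ((g ^^ k) ?c) \<le>
        64 * M * (2 * C)\<^sup>2 * tile_diam n ?c * (norm (z - z0) / tile_diam (n + k) ?c)\<^sup>2"
      by (simp only: r_def)
  qed simp
qed

text \<open>A tile of level \<open>n + m + k\<close> at \<open>c\<close> is mapped by \<open>g ^^ k\<close> to a tile of level \<open>n + m\<close> near \<open>c\<close>, whose diameter is
  comparable to that of the chosen tile at \<open>c\<close>; the quadratic return estimate bounds it from above. The factor
  \<open>C ^ Suc l\<close> makes the return close to \<open>c\<close> at level \<open>n + m\<close> and at level \<open>n\<close>.\<close>

lemma critical_diam_inequality:
  assumes c: "c \<in> J" and crit: "critical_point g c"
  obtains n1 A where "A > 0"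
    "\<And>n m k. n \<ge> n1 \<Longrightarrow> k \<ge> 1 \<Longrightarrow> dist ((g ^^ k) c) c < tile_diam (n + m) c / C ^ Suc l \<Longrightarrow>
      tile_diam (n + m) c * (tile_diam (n + k) c)\<^sup>2 \<le> A * tile_diam n c * (tile_diam (n + m + k) c)\<^sup>2"
proof -
  obtain b z0 where cz: "c = chart b z0" by (rule chart_exists)
  obtain \<delta> K where dK: "0 < \<delta>" "1 \<le> K"
    "\<And>v. dist v c < \<delta> \<Longrightarrow> \<exists>z. v = chart b z \<and> norm (z - z0) \<le> K * dist v c"
    using chart_local_inverse[of b z0] cz by metis
  obtain n0 where n0: "\<And>n. n \<ge> n0 \<Longrightarrow> tile_diam n c < \<delta>"
    using tile_diam_tendsto_0[OF c dK(1)] by metis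
  obtain n1 B1 B2 where B: "n1 \<ge> 1" "B1 > 0" "B2 > 0"
    "\<And>n k z. n \<ge> n1 \<Longrightarrow> k \<ge> 1 \<Longrightarrow> dist ((g ^^ k) c) c < tile_diam n c / C \<Longrightarrow>
      norm (z - z0) < B1 * tile_diam (n + k) c \<Longrightarrow>
      dist ((g ^^ k) (chart b z)) ((g ^^ k) c) \<le>
        B2 * tile_diam n c * (norm (z - z0) / tile_diam (n + k) c)\<^sup>2"
    using critical_return_estimate[of b z0] c crit unfolding cz by blast
  have \<Lambda>: "1 \<le> chain_const" using chain_const_bounds(3)[of 0] by simp
  define A1 where "A1 = 2 * chain_const * B2 * K\<^sup>2"
  define A2 where "A2 = C ^ l * (K / B1)\<^sup>2"
  have A: "0 < A1" "0 < A2" using \<Lambda> B dK C1 by (simp_all add: A1_def A2_def)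
  show ?thesis
  proof (rule that[of "A1 + A2" "n0 + n1"])
    show "0 < A1 + A2" using A by simp
    fix n m k assume n: "n \<ge> n0 + n1" and k: "k \<ge> 1"
      and ret: "dist ((g ^^ k) c) c < tile_diam (n + m) c / C ^ Suc l"
    define r t \<sigma> where "r = tile_diam n c" and "t = tile_diam (n + m + k) c" and "\<sigma> = tile_diam (n + k) c"
    have pos: "0 < r" "0 < t" "0 < \<sigma>" using tile_diam_pos[OF c] by (simp_all add: r_def t_def \<sigma>_def)
    have "tile_diam (n + m) c / C ^ Suc l \<le> tile_diam (n + m) c / C"
      using C1 tile_diam_pos[OF c, of "n + m"] power_increasing[of 1 "Suc l" C]
      by (intro divide_left_mono) auto
    then have ret1: "dist ((g ^^ k) c) c < tile_diam (n + m) c / C" using ret by linarith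
    have le: "tile_diam (n + m) c \<le> C ^ l * r" unfolding r_def by (rule tile_diam_le_earlier[OF c])
    then have "tile_diam (n + m) c / C ^ Suc l \<le> C ^ l * r / C ^ Suc l"
      using C1 by (intro divide_right_mono) auto
    also have "\<dots> = r / C" using C1 by simp
    finally have ret2: "dist ((g ^^ k) c) c < tile_diam n c / C" using ret unfolding r_def by linarith
    (* If the tile of level n + m + k leaves the disc of the return estimate, then its diameter is at least a
       fixed fraction of that of level n + k, and the inequality holds for trivial reasons. *)
    have "tile_diam (n + m) c * \<sigma>\<^sup>2 \<le> A1 * r * t\<^sup>2 \<or> tile_diam (n + m) c * \<sigma>\<^sup>2 \<le> A2 * r * t\<^sup>2"
    proof (cases "K * t < B1 * \<sigma>")
      case True
      let ?T = "tile_at (n + m + k) c"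
      note T = tile_at[OF c, of "n + m + k"]
      have im: "(g ^^ k) ` ?T \<in> \<X> (n + m)" "(g ^^ k) c \<in> (g ^^ k) ` ?T"
        using tile_image[of "n + m" ?T k] T n B(1) by auto
      have "dist v ((g ^^ k) c) \<le> B2 * r * (K * t / \<sigma>)\<^sup>2" if "v \<in> (g ^^ k) ` ?T" for v
      proof -
        obtain x where x: "x \<in> ?T" "v = (g ^^ k) x" using \<open>v \<in> _\<close> by blast
        have xc: "dist x c \<le> t" unfolding t_def tile_diam_def by (rule dist_le_diameter[OF T(1) x(1) T(2)])
        then obtain z where z: "x = chart b z" "norm (z - z0) \<le> K * dist x c"
          using dK(3)[of x] n0[of "n + m + k"] n by (auto simp: t_def)
        have zt: "norm (z - z0) \<le> K * t" using z(2) mult_left_mono[OF xc, of K] dK(2) by linarith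
        then have "dist v ((g ^^ k) c) \<le> B2 * r * (norm (z - z0) / \<sigma>)\<^sup>2"
          using B(4)[of n k z] n k ret2 True unfolding x(2) z(1) r_def \<sigma>_def by simp
        also have "\<dots> \<le> B2 * r * (K * t / \<sigma>)\<^sup>2"
          using zt pos B(3) by (intro mult_left_mono power_mono divide_right_mono) auto
        finally show ?thesis .
      qed
      then have "diameter ((g ^^ k) ` ?T) \<le> 2 * (B2 * r * (K * t / \<sigma>)\<^sup>2)"
        by (rule diameter_le_of_dist[OF im(2)])
      moreover have "tile_diam (n + m) c \<le> chain_const * diameter ((g ^^ k) ` ?T)"
        by (rule near_tile_diam(2)[OF im c ret1])
      ultimately have "tile_diam (n + m) c \<le> chain_const * (2 * (B2 * r * (K * t / \<sigma>)\<^sup>2))"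
        using \<Lambda> mult_left_mono[of "diameter ((g ^^ k) ` ?T)" "2 * (B2 * r * (K * t / \<sigma>)\<^sup>2)" chain_const] by linarith
      then have "tile_diam (n + m) c * \<sigma>\<^sup>2 \<le> chain_const * (2 * (B2 * r * (K * t / \<sigma>)\<^sup>2)) * \<sigma>\<^sup>2"
        by (rule mult_right_mono) simp
      also have "\<dots> = A1 * r * t\<^sup>2"
        using pos by (simp add: A1_def power_divide power_mult_distrib)
      finally show ?thesis by blast
    next
      case False
      then have "\<sigma> \<le> K / B1 * t" using B(2) by (simp add: field_simps)
      then have "\<sigma>\<^sup>2 \<le> (K / B1 * t)\<^sup>2" using pos by (intro power_mono) auto
      then have "tile_diam (n + m) c * \<sigma>\<^sup>2 \<le> (C ^ l * r) * (K / B1 * t)\<^sup>2"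
        using le pos C1 tile_diam_pos[OF c, of "n + m"] by (intro mult_mono) auto
      also have "\<dots> = A2 * r * t\<^sup>2" by (simp add: A2_def power_mult_distrib power_divide)
      finally show ?thesis by blast
    qed
    moreover have "0 \<le> A1 * r * t\<^sup>2" "0 \<le> A2 * r * t\<^sup>2" using A pos by simp_all
    ultimately show "tile_diam (n + m) c * (tile_diam (n + k) c)\<^sup>2 \<le> (A1 + A2) * tile_diam n c * (tile_diam (n + m + k) c)\<^sup>2"
      unfolding r_def[symmetric] t_def[symmetric] \<sigma>_def[symmetric] by (auto simp: distrib_right)
  qed
qed

text \<open>With \<open>u n\<close> the normalised ratio of the tile diameters of levels \<open>n + l * j\<close> and \<open>n\<close>, recurrence yields
  for every large \<open>n\<close> a later \<open>n'\<close> with \<open>u n \<le> (u n')\<^sup>2\<close>, while all \<open>u n\<close> are positive and at most \<open>1 / 2\<close>.\<close>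

lemma critical_point_not_recurrent:
  assumes c: "c \<in> J" and crit: "critical_point g c"
  shows "c \<notin> closure {(g ^^ n) c |n. n \<ge> 1}"
proof
  assume rec: "c \<in> closure {(g ^^ n) c |n. n \<ge> 1}"
  have ret: "\<exists>k\<ge>1. dist ((g ^^ k) c) c < e" if "e > 0" for e
    using rec that unfolding closure_approachable by blast
  obtain n1 A where A: "A > 0"
    "\<And>n m k. n \<ge> n1 \<Longrightarrow> k \<ge> 1 \<Longrightarrow> dist ((g ^^ k) c) c < tile_diam (n + m) c / C ^ Suc l \<Longrightarrow>
      tile_diam (n + m) c * (tile_diam (n + k) c)\<^sup>2 \<le> A * tile_diam n c * (tile_diam (n + m + k) c)\<^sup>2"
    using critical_diam_inequality[OF c crit] by metis
  obtain j where j: "\<rho> ^ j < 1 / (2 * A)"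
    using real_arch_pow_inv[of "1 / (2 * A)" \<rho>] \<rho>1 A(1) by auto
  define u where "u = (\<lambda>n. A * tile_diam (n + l * j) c / tile_diam n c)"
  have pos: "0 < tile_diam n c" for n using tile_diam_pos[OF c] .
  have u_pos: "0 < u n" for n using A(1) pos by (simp add: u_def)
  have u_half: "u n \<le> 1 / 2" for n
  proof -
    have "A * tile_diam (n + l * j) c \<le> A * (\<rho> ^ j * tile_diam n c)"
      using tile_diam_decay[OF c, of n j] A(1) by (intro mult_left_mono) auto
    also have "\<dots> \<le> A * (1 / (2 * A) * tile_diam n c)"
      using j A(1) pos[of n] by (intro mult_left_mono mult_right_mono) auto
    also have "\<dots> = tile_diam n c / 2" using A(1) by simp
    finally show ?thesis using pos[of n] by (simp add: u_def field_simps)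
  qed
  have step: "\<exists>n'\<ge>n. u n \<le> (u n')\<^sup>2" if n: "n \<ge> n1" for n
  proof -
    have "0 < tile_diam (n + l * j) c / C ^ Suc l" using pos C1 by simp
    then obtain k where k: "k \<ge> 1" "dist ((g ^^ k) c) c < tile_diam (n + l * j) c / C ^ Suc l"
      using ret by blast
    have ineq: "tile_diam (n + l * j) c * (tile_diam (n + k) c)\<^sup>2 \<le> A * tile_diam n c * (tile_diam (n + k + l * j) c)\<^sup>2"
      using A(2)[OF n k] by (simp add: add_ac)
    have "u n = A * (tile_diam (n + l * j) c * (tile_diam (n + k) c)\<^sup>2) / (tile_diam n c * (tile_diam (n + k) c)\<^sup>2)"
      using pos[of "n + k"] by (simp add: u_def)
    also have "\<dots> \<le> A * (A * tile_diam n c * (tile_diam (n + k + l * j) c)\<^sup>2) / (tile_diam n c * (tile_diam (n + k) c)\<^sup>2)"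
      using ineq A(1) pos[of n] by (intro divide_right_mono mult_left_mono) auto
    also have "\<dots> = (u (n + k))\<^sup>2"
      using pos[of n] by (simp add: u_def power2_eq_square)
    finally show ?thesis by (intro exI[of _ "n + k"]) simp
  qed
  have iter: "u n \<le> (1 / 2) ^ (2 ^ i)" if "n \<ge> n1" for n i
    using that
  proof (induction i arbitrary: n)
    case (Suc i)
    obtain n' where n': "n' \<ge> n" "u n \<le> (u n')\<^sup>2" using step[OF Suc.prems] by blast
    have "(u n')\<^sup>2 \<le> ((1 / 2) ^ (2 ^ i))\<^sup>2"
      using Suc.IH[of n'] n'(1) Suc.prems u_pos[of n'] by (intro power_mono) auto
    also have "\<dots> = (1 / 2) ^ (2 ^ Suc i)" by (simp only: power_mult[symmetric] power_Suc mult.commute)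
    finally show ?case using n'(2) by linarith
  qed (use u_half in auto)
  obtain i where i: "(1 / 2) ^ i < u n1"
    using real_arch_pow_inv[OF u_pos, of "1 / 2"] by auto
  have "(1 / 2 :: real) ^ (2 ^ i) \<le> (1 / 2) ^ i"
    by (intro power_decreasing) (auto simp: less_imp_le)
  then show False using iter[of n1 i] i by linarith
qed

end

section \<open>Semi-hyperbolicity\<close>

text \<open>The chain rule at a fixed point, for maps expressed in one chart.\<close>

lemma iterate_multiplier:
  assumes g: "rational_map_of_degree g d" and fp: "(g ^^ k) (chart b z0) = chart b z0"
  shows "((\<lambda>z. coord b ((g ^^ (k * m)) (chart b z))) has_field_derivative
    deriv (\<lambda>z. coord b ((g ^^ k) (chart b z))) z0 ^ m) (at z0)"
proof (induction m)
  case 0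
  show ?case by simp
next
  case (Suc m)
  define L where "L = (\<lambda>z. coord b ((g ^^ k) (chart b z)))"
  obtain s where s: "s > 0" "L holomorphic_on ball z0 s"
    "\<And>z. z \<in> ball z0 s \<Longrightarrow> (g ^^ k) (chart b z) = chart b (L z)"
    using rational_map_local_holomorphic[OF g fp] unfolding L_def by metis
  have L: "(L has_field_derivative deriv L z0) (at z0)"
    using s by (intro holomorphic_derivI[of L "ball z0 s"]) auto
  have "((\<lambda>z. coord b ((g ^^ (k * m)) (chart b z))) has_field_derivative deriv L z0 ^ m) (at (L z0))"
    using Suc fp by (simp add: L_def)
  from DERIV_chain2[OF this L]
  have "((\<lambda>z. coord b ((g ^^ (k * m)) (chart b (L z)))) has_field_derivative deriv L z0 ^ Suc m) (at z0)"
    by (simp add: mult.commute)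
  then show ?case unfolding L_def[symmetric]
  proof (rule has_field_derivative_transform_within_open[where S = "ball z0 s"])
    fix z assume "z \<in> ball z0 s"
    then have "(g ^^ (k * Suc m)) (chart b z) = (g ^^ (k * m)) (chart b (L z))"
      using s(3) funpow_add[of "k * m" k g] by (simp add: add.commute)
    then show "coord b ((g ^^ (k * m)) (chart b (L z))) = coord b ((g ^^ (k * Suc m)) (chart b z))" by simp
  qed (use s in auto)
qed

lemma fixed_point_derivative_chart:
  obtains b z0 where "x = chart b z0"
    "fixed_point_derivative f x = deriv (\<lambda>z. coord b (f (chart b z))) z0"
proof (cases x)
  case (Fin a)
  then show ?thesis
    using that[of True a] by (simp add: fixed_point_derivative_def chart.simps)
next
  case Infty
  then show ?thesis
    using that[of False 0] by (simp add: fixed_point_derivative_def chart.simps del: sphere_inversion.simps(1))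
       (simp add: chart.simps)
qed

lemma (in dynamical_tiling) no_parabolic_point: "\<not> parabolic_point g x"
proof
  assume "parabolic_point g x"
  then obtain k m where km: "k \<ge> 1" "(g ^^ k) x = x" "m \<ge> 1" "fixed_point_derivative (g ^^ k) x ^ m = 1"
    unfolding parabolic_point_def periodic_point_def by blast
  obtain b z0 where x: "x = chart b z0"
    "fixed_point_derivative (g ^^ k) x = deriv (\<lambda>z. coord b ((g ^^ k) (chart b z))) z0"
    using fixed_point_derivative_chart .
  (* The factor l makes N a multiple of the number of levels over which tiles shrink. *)
  define N where "N = k * (m * l)"
  have N: "N \<ge> 1" "l dvd N" using km l1 by (simp_all add: N_def)
  have fp: "(g ^^ N) (chart b z0) = chart b z0"
    using iterate_fixed[of "g ^^ k" x "m * l", OF km(2)] unfolding N_def x(1) funpow_mult .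
  have der: "((\<lambda>z. coord b ((g ^^ N) (chart b z))) has_field_derivative 1) (at z0)"
    using iterate_multiplier[OF rat, of k b z0 "m * l"] km(2,4) x unfolding N_def by (simp add: power_mult)
  have "J \<noteq> {}" using two by blast
  from multiplier_one_in_julia_set[OF rat this N(1) fp der]
  show False using no_fixed_point_with_multiplier_one N fp der by blast
qed

theorem theorem12p4:
  fixes g :: "rsphere \<Rightarrow> rsphere" and d :: nat
  assumes "rational_map_of_degree g d" and "d \<ge> 2"
    and "\<exists>w \<X>. quasi_visual_approximation (julia_set g) w \<X> \<and> dynamical g \<X>"
  shows "semi_hyperbolic g"
proof -
  obtain w \<X> where X: "quasi_visual_approximation (julia_set g) w \<X>" and dyn: "dynamical g \<X>"
    using assms(3) by blast
  have qva: "bounded (julia_set g)" "\<exists>x\<in>julia_set g. \<exists>y\<in>julia_set g. x \<noteq> y"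
    "\<And>n. \<Union>(\<X> n) = julia_set g" "\<X> 0 = {julia_set g}"
    using X by (simp_all only: quasi_visual_approximation_def)
  have "\<exists>(C::real) (l::nat) (r::real). C \<ge> 1 \<and> l \<ge> 1 \<and> 0 < r \<and> r < 1 \<and> (\<forall>n. (\<forall>X\<in>\<X> n. \<forall>Y\<in>\<X> n. X \<inter> Y \<noteq> {} \<longrightarrow> comparable_diameters C X Y) \<and>
         (\<forall>X\<in>\<X> n. \<forall>Y\<in>\<X> n.
            tile_neighborhood (\<X> n) w X \<inter> tile_neighborhood (\<X> n) w Y = {} \<longrightarrow>
            tile_dist X Y \<ge> ereal (diameter X / C)) \<and>
         (\<forall>X\<in>\<X> n. \<forall>Y\<in>\<X> (n + 1). X \<inter> Y \<noteq> {} \<longrightarrow> comparable_diameters C X Y) \<and>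
         (\<forall>X\<in>\<X> n. \<forall>Y\<in>\<X> (n + l). X \<inter> Y \<noteq> {} \<longrightarrow> diameter Y \<le> r * diameter X))"
    using X by (simp only: quasi_visual_approximation_def)
  then obtain C :: real and l :: nat and r :: real where C: "C \<ge> 1" "l \<ge> 1" "0 < r" "r < 1" and
    ax: "(\<forall>n. (\<forall>X\<in>\<X> n. \<forall>Y\<in>\<X> n. X \<inter> Y \<noteq> {} \<longrightarrow> comparable_diameters C X Y) \<and>
         (\<forall>X\<in>\<X> n. \<forall>Y\<in>\<X> n.
            tile_neighborhood (\<X> n) w X \<inter> tile_neighborhood (\<X> n) w Y = {} \<longrightarrow>
            tile_dist X Y \<ge> ereal (diameter X / C)) \<and>
         (\<forall>X\<in>\<X> n. \<forall>Y\<in>\<X> (n + 1). X \<inter> Y \<noteq> {} \<longrightarrow> comparable_diameters C X Y) \<and>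
         (\<forall>X\<in>\<X> n. \<forall>Y\<in>\<X> (n + l). X \<inter> Y \<noteq> {} \<longrightarrow> diameter Y \<le> r * diameter X))"
    by (elim exE conjE) (rule that)
  have cd: "comparable_diameters C X Y \<Longrightarrow> diameter Y \<le> C * diameter X \<and> diameter X \<le> C * diameter Y"
    for X Y :: "rsphere set"
    using C(1) by (simp add: comparable_diameters_def divide_le_eq mult.commute)
  note ax1 = ax[THEN spec, THEN conjunct1, THEN bspec, THEN bspec, THEN mp]
    and ax2 = ax[THEN spec, THEN conjunct2, THEN conjunct1, THEN bspec, THEN bspec, THEN mp]
    and ax3 = ax[THEN spec, THEN conjunct2, THEN conjunct2, THEN conjunct1, THEN bspec, THEN bspec, THEN mp]
    and ax4 = ax[THEN spec, THEN conjunct2, THEN conjunct2, THEN conjunct2, THEN bspec, THEN bspec, THEN mp]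
  interpret dynamical_tiling g d w \<X> C l r
  proof
    show "\<And>n X Y. X \<in> \<X> n \<Longrightarrow> Y \<in> \<X> n \<Longrightarrow> X \<inter> Y \<noteq> {} \<Longrightarrow> diameter Y \<le> C * diameter X"
      by (rule cd[OF ax1, THEN conjunct1])
    show "\<And>n X Y. X \<in> \<X> n \<Longrightarrow> Y \<in> \<X> (n + 1) \<Longrightarrow> X \<inter> Y \<noteq> {} \<Longrightarrow>
      diameter Y \<le> C * diameter X \<and> diameter X \<le> C * diameter Y"
      by (rule cd[OF ax3])
    show "\<And>n X Y. X \<in> \<X> n \<Longrightarrow> Y \<in> \<X> n \<Longrightarrow>
      tile_neighborhood (\<X> n) w X \<inter> tile_neighborhood (\<X> n) w Y = {} \<Longrightarrow>
      ereal (diameter X / C) \<le> tile_dist X Y"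
      by (rule ax2)
    show "\<And>n X Y. X \<in> \<X> n \<Longrightarrow> Y \<in> \<X> (n + l) \<Longrightarrow> X \<inter> Y \<noteq> {} \<Longrightarrow> diameter Y \<le> r * diameter X"
      by (rule ax4)
    show "\<And>n X. n \<ge> 1 \<Longrightarrow> X \<in> \<X> (n + 1) \<Longrightarrow> g ` X \<in> \<X> n"
      using dyn unfolding dynamical_def by blast
  qed (use qva C assms(1,2) in auto)
  show ?thesis
    unfolding semi_hyperbolic_def
    using assms(1,2) no_parabolic_point critical_point_not_recurrent by blast
qed

end
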